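(* Let $A$ be a cellular algebra with totally ordered cell indices $\lambda_1>\cdots>\lambda_r$ and let $\Lambda_0\subseteq\Lambda$ index its simple modules. For the cellular structure on $A\wr S_n$ described below, the set $(\underline{\Lambda}^r_n)_0$ of multipartitions $(\nu_1,\ldots,\nu_r)$ for which the cell form of $\Delta^{(\nu_1,\ldots,\nu_r)}$ is nonzero consists exactly of those $(\nu_1,\ldots,\nu_r)\in\underline{\Lambda}^r_n$ such that $\nu_i=()$ whenever $\lambda_i\notin\Lambda_0$, and every $\nu_i$ is $p$-restricted.
   Context: $k$ is a field of characteristic $p\ge0$. For a cellular algebra with cell modules $\Delta^\lambda$ carrying cell forms, $\Lambda_0$ is the set of $\lambda$ for which the cell form is not identically zero, and then $L^\lambda=\Delta^\lambda/\mathrm{rad}$ is simple; these give all simples without redundancy. A partition is $p$-restricted if $p=0$, or if $p>0$ and consecutive parts differ by less than $p$ (the empty partition $()$ is always $p$-restricted). $S^\nu$ denotes the cell module of $kS_m$ ($|\nu|=m$) in its standard cellular structure (dual of James's Specht module) with its cell form. $A\wr S_n$ ($kS_n\otimes A^{\otimes n}$ with product $(\sigma;a)(\pi;b)=(\sigma\pi;a_{(1)\pi^{-1}}b_1,\ldots,a_{(n)\pi^{-1}}b_n)$, permutations acting on the right) is cellular with anti-involution $(\sigma;a_1,\ldots,a_n)^*=(\sigma^{-1};a^*_{(1)\sigma},\ldots,a^*_{(n)\sigma})$ and cell indices the set $\underline{\Lambda}^r_n$ of length-$r$ multipartitions of $n$; for $\mu=(|\nu_1|,\ldots,|\nu_r|)$,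 its cell module $\Delta^{(\nu_1,\ldots,\nu_r)}$ is the induced module $\Theta^\mu\bigl((\Delta^{\lambda_1},\ldots,\Delta^{\lambda_r}),(S^{\nu_1},\ldots,S^{\nu_r})\bigr)=\bigl(\Delta(\lambda_1)^{\otimes\mu_1}\otimes\cdots\otimes\Delta(\lambda_r)^{\otimes\mu_r}\otimes S^{\nu_1}\otimes\cdots\otimes S^{\nu_r}\bigr)\otimes_{A\wr S_\mu}A\wr S_n$ (where $A\wr S_\mu$, spanned by $(\sigma;a)$ with $\sigma$ in the Young subgroup $S_\mu\cong\prod S_{\mu_i}$, acts by $(x_1\otimes\cdots\otimes x_n\otimes y_1\otimes\cdots\otimes y_r)(\sigma;a_1,\ldots,a_n)=x_{(1)\sigma^{-1}}a_1\otimes\cdots\otimes x_{(n)\sigma^{-1}}a_n\otimes y_1\sigma_1\otimes\cdots\otimes y_r\sigma_r$), with cell form $\langle x\otimes y\otimes\gamma,x'\otimes y'\otimes\gamma'\rangle=\delta_{\gamma\gamma'}\prod_i\langle y_i,y'_i\rangle\prod_j\langle x_j,x'_j\rangle$, where $x\otimes y\otimes\gamma$ denotes $(x_1\otimes\cdots\otimes x_n\otimes y_1\otimes\cdots\otimes y_r)\otimes(\gamma;1,\ldots,1)$ for $\gamma$ a minimal-length right coset representative of $S_\mu$ in $S_n$. $L^{(\nu_1,\ldots,\nu_r)}$ denotes the quotient of $\Delta^{(\nu_1,\ldots,\nu_r)}$ by the radical of its cell form. *)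

theory Defs
  imports Main "HOL-Combinatorics.Permutations"
begin

definition kspan :: "('b \<Rightarrow> 'k::field) set \<Rightarrow> ('b \<Rightarrow> 'k) set" where
  "kspan S = {f. \<exists>F c. finite F \<and> F \<subseteq> S \<and> f = (\<lambda>x. \<Sum>v\<in>F. c v * v x)}"

definition form_nonzero :: "('a \<Rightarrow> 'a \<Rightarrow> 'k::field) \<Rightarrow> 'a set \<Rightarrow> bool" where
  "form_nonzero G B \<longleftrightarrow>
     (\<exists>u v. (\<Sum>a\<in>B. \<Sum>b\<in>B. u a * G a b * v b) \<noteq> 0)"

text \<open>A cellular algebra with cell indices \<open>\<lambda>\<^sub>0 > \<lambda>\<^sub>1 > \<dots> > \<lambda>\<^sub>r\<^sub>-\<^sub>1\<close>
  (index \<open>i < r\<close>; \<open>\<lambda>\<^sub>i > \<lambda>\<^sub>j\<close> iff \<open>i < j\<close>), index sets \<open>M i\<close>, is modelled (up to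
  isomorphism) as the space of coordinate vectors with respect to its cellular basis
  \<open>C\<^sup>\<lambda>\<^sub>s\<^sub>t\<close>, indexed by triples \<open>(i,s,t)\<close>, with multiplication given by structure
  constants \<open>sc\<close>.\<close>

definition cbasis :: "nat \<Rightarrow> (nat \<Rightarrow> 'm set) \<Rightarrow> (nat \<times> 'm \<times> 'm) set" where
  "cbasis r M = {(i,s,t). i < r \<and> s \<in> M i \<and> t \<in> M i}"

definition calg :: "nat \<Rightarrow> (nat \<Rightarrow> 'm set) \<Rightarrow> (nat \<times> 'm \<times> 'm \<Rightarrow> 'k::field) set" where
  "calg r M = {a. \<forall>x. x \<notin> cbasis r M \<longrightarrow> a x = 0}"

definition cmul :: "nat \<Rightarrow> (nat \<Rightarrow> 'm set)
    \<Rightarrow> (nat \<times> 'm \<times> 'm \<Rightarrow> nat \<times> 'm \<times> 'm \<Rightarrow> nat \<times> 'm \<times> 'm \<Rightarrow> 'k::field)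
    \<Rightarrow> (nat \<times> 'm \<times> 'm \<Rightarrow> 'k) \<Rightarrow> (nat \<times> 'm \<times> 'm \<Rightarrow> 'k) \<Rightarrow> (nat \<times> 'm \<times> 'm \<Rightarrow> 'k)" where
  "cmul r M sc a b = (\<lambda>z. if z \<in> cbasis r M then
      (\<Sum>x\<in>cbasis r M. \<Sum>y\<in>cbasis r M. a x * b y * sc x y z) else 0)"

definition cel :: "nat \<Rightarrow> 'm \<Rightarrow> 'm \<Rightarrow> (nat \<times> 'm \<times> 'm \<Rightarrow> 'k::field)" where
  "cel i s t = (\<lambda>x. if x = (i,s,t) then 1 else 0)"

definition cstar :: "(nat \<times> 'm \<times> 'm \<Rightarrow> 'k::field) \<Rightarrow> (nat \<times> 'm \<times> 'm \<Rightarrow> 'k)" where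
  "cstar a = (\<lambda>(i,s,t). a (i,t,s))"

definition cgt :: "nat \<Rightarrow> (nat \<Rightarrow> 'm set) \<Rightarrow> nat \<Rightarrow> (nat \<times> 'm \<times> 'm \<Rightarrow> 'k::field) set" where
  "cgt r M i = {a \<in> calg r M. \<forall>j s t. a (j,s,t) \<noteq> 0 \<longrightarrow> j < i}"

definition cellular :: "nat \<Rightarrow> (nat \<Rightarrow> 'm set)
    \<Rightarrow> (nat \<times> 'm \<times> 'm \<Rightarrow> nat \<times> 'm \<times> 'm \<Rightarrow> nat \<times> 'm \<times> 'm \<Rightarrow> 'k::field) \<Rightarrow> bool" where
  "cellular r M sc \<longleftrightarrow>
     (\<forall>i<r. finite (M i)) \<and>
     \<comment> \<open>associative with identity\<close>
     (\<forall>a\<in>calg r M. \<forall>b\<in>calg r M. \<forall>c\<in>calg r M.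
        cmul r M sc (cmul r M sc a b) c = cmul r M sc a (cmul r M sc b c)) \<and>
     (\<exists>e\<in>calg r M. \<forall>a\<in>calg r M. cmul r M sc e a = a \<and> cmul r M sc a e = a) \<and>
     \<comment> \<open>\<open>*\<close> is an anti-automorphism\<close>
     (\<forall>a\<in>calg r M. \<forall>b\<in>calg r M.
        cstar (cmul r M sc a b) = cmul r M sc (cstar b) (cstar a)) \<and>
     \<comment> \<open>cellular multiplication rule\<close>
     (\<forall>a\<in>calg r M. \<forall>i<r. \<forall>s\<in>M i. \<exists>ra :: 'm \<Rightarrow> 'k. \<forall>t\<in>M i.
        (\<lambda>x. cmul r M sc a (cel i s t) x - (\<Sum>s'\<in>M i. ra s' * cel i s' t x)) \<in> cgt r M i)"

definition cell_form :: "nat \<Rightarrow> (nat \<Rightarrow> 'm set)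
    \<Rightarrow> (nat \<times> 'm \<times> 'm \<Rightarrow> nat \<times> 'm \<times> 'm \<Rightarrow> nat \<times> 'm \<times> 'm \<Rightarrow> 'k::field)
    \<Rightarrow> nat \<Rightarrow> 'm \<Rightarrow> 'm \<Rightarrow> 'k" where
  "cell_form r M sc i t u = (SOME c. \<forall>s\<in>M i. \<forall>v\<in>M i.
      (\<lambda>x. cmul r M sc (cel i s t) (cel i u v) x - c * cel i s v x) \<in> cgt r M i)"

definition Lambda0 :: "nat \<Rightarrow> (nat \<Rightarrow> 'm set)
    \<Rightarrow> (nat \<times> 'm \<times> 'm \<Rightarrow> nat \<times> 'm \<times> 'm \<Rightarrow> nat \<times> 'm \<times> 'm \<Rightarrow> 'k::field) \<Rightarrow> nat set" where
  "Lambda0 r M sc = {i. i < r \<and> form_nonzero (cell_form r M sc i) (M i)}"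

definition is_partition :: "nat list \<Rightarrow> bool" where
  "is_partition \<nu> \<longleftrightarrow> sorted (rev \<nu>) \<and> 0 \<notin> set \<nu>"

definition partitions_of :: "nat \<Rightarrow> nat list set" where
  "partitions_of m = {\<nu>. is_partition \<nu> \<and> sum_list \<nu> = m}"

definition p_restricted :: "nat \<Rightarrow> nat list \<Rightarrow> bool" where
  "p_restricted p \<nu> \<longleftrightarrow> p = 0 \<or>
     (\<forall>i<length \<nu>. \<nu>!i - (if Suc i < length \<nu> then \<nu>!Suc i else 0) < p)"

definition dominates_strict :: "nat list \<Rightarrow> nat list \<Rightarrow> bool" where
  "dominates_strict \<mu> \<nu> \<longleftrightarrow> \<mu> \<noteq> \<nu> \<and>
     (\<forall>k. sum_list (take k \<mu>) \<ge> sum_list (take k \<nu>))"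

definition nodes :: "nat list \<Rightarrow> (nat \<times> nat) set" where
  "nodes \<nu> = {(a,b). a < length \<nu> \<and> b < \<nu>!a}"

definition std_tab :: "nat list \<Rightarrow> (nat \<times> nat \<Rightarrow> nat) set" where
  "std_tab \<nu> = {t. bij_betw t (nodes \<nu>) {1..sum_list \<nu>} \<and>
      (\<forall>x. x \<notin> nodes \<nu> \<longrightarrow> t x = 0) \<and>
      (\<forall>a b. (a, Suc b) \<in> nodes \<nu> \<longrightarrow> t (a,b) < t (a, Suc b)) \<and>
      (\<forall>a b. (Suc a, b) \<in> nodes \<nu> \<longrightarrow> t (a,b) < t (Suc a, b))}"

definition tinit :: "nat list \<Rightarrow> nat \<times> nat \<Rightarrow> nat" where
  "tinit \<nu> = (\<lambda>(a,b). if (a,b) \<in> nodes \<nu> then sum_list (take a \<nu>) + b + 1 else 0)"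

text \<open>Permutations act on the right: \<open>(i)(\<sigma>\<pi>) = ((i)\<sigma>)\<pi>\<close>, i.e. \<open>\<sigma>\<pi> = \<pi> \<circ> \<sigma>\<close>.
  \<open>d(t)\<close> is the permutation with \<open>t = t\<^sup>\<nu> d(t)\<close>.\<close>
definition dperm :: "nat list \<Rightarrow> (nat \<times> nat \<Rightarrow> nat) \<Rightarrow> nat \<Rightarrow> nat" where
  "dperm \<nu> t = (\<lambda>k. if k \<in> {1..sum_list \<nu>} then t (inv_into (nodes \<nu>) (tinit \<nu>) k) else k)"

definition gmul :: "nat \<Rightarrow> ((nat \<Rightarrow> nat) \<Rightarrow> 'k::field) \<Rightarrow> ((nat \<Rightarrow> nat) \<Rightarrow> 'k) \<Rightarrow> ((nat \<Rightarrow> nat) \<Rightarrow> 'k)" where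
  "gmul m f g = (\<lambda>w. if w permutes {1..m} then
      (\<Sum>\<sigma>\<in>{\<sigma>. \<sigma> permutes {1..m}}. f \<sigma> * g (w \<circ> inv \<sigma>)) else 0)"

definition gel :: "(nat \<Rightarrow> nat) \<Rightarrow> ((nat \<Rightarrow> nat) \<Rightarrow> 'k::field)" where
  "gel \<sigma> = (\<lambda>w. if w = \<sigma> then 1 else 0)"

definition row_stab :: "nat list \<Rightarrow> (nat \<Rightarrow> nat) set" where
  "row_stab \<nu> = {w. w permutes {1..sum_list \<nu>} \<and>
     (\<forall>a<length \<nu>. w ` (tinit \<nu> ` {(a,b) |b. b < \<nu>!a}) = tinit \<nu> ` {(a,b) |b. b < \<nu>!a})}"

definition xel :: "nat list \<Rightarrow> ((nat \<Rightarrow> nat) \<Rightarrow> 'k::field)" where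
  "xel \<nu> = (\<lambda>w. if w \<in> row_stab \<nu> then 1 else 0)"

definition murphy :: "nat list \<Rightarrow> (nat \<times> nat \<Rightarrow> nat) \<Rightarrow> (nat \<times> nat \<Rightarrow> nat)
    \<Rightarrow> ((nat \<Rightarrow> nat) \<Rightarrow> 'k::field)" where
  "murphy \<nu> s t = (let m = sum_list \<nu> in
      gmul m (gmul m (gel (inv (dperm \<nu> s))) (xel \<nu>)) (gel (dperm \<nu> t)))"

definition murphy_gt :: "nat list \<Rightarrow> ((nat \<Rightarrow> nat) \<Rightarrow> 'k::field) set" where
  "murphy_gt \<nu> = kspan {murphy \<mu> a b | \<mu> a b. \<mu> \<in> partitions_of (sum_list \<nu>) \<and>
      dominates_strict \<mu> \<nu> \<and> a \<in> std_tab \<mu> \<and> b \<in> std_tab \<mu>}"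

definition specht_form :: "nat list \<Rightarrow> (nat \<times> nat \<Rightarrow> nat) \<Rightarrow> (nat \<times> nat \<Rightarrow> nat) \<Rightarrow> 'k::field" where
  "specht_form \<nu> t u = (SOME c. \<forall>s\<in>std_tab \<nu>. \<forall>v\<in>std_tab \<nu>.
      (\<lambda>w. gmul (sum_list \<nu>) (murphy \<nu> s t) (murphy \<nu> u v) w - c * murphy \<nu> s v w)
        \<in> murphy_gt \<nu>)"

definition multipartitions :: "nat \<Rightarrow> nat \<Rightarrow> nat list list set" where
  "multipartitions r n = {\<nu>s. length \<nu>s = r \<and> (\<forall>\<nu>\<in>set \<nu>s. is_partition \<nu>) \<and>
      sum_list (map sum_list \<nu>s) = n}"

text \<open>composition \<open>\<mu> = (|\<nu>\<^sub>1|,...,|\<nu>\<^sub>r|)\<close>; position \<open>j\<in>{1..n}\<close> lies in block \<open>blk \<mu> j\<close>\<close>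
definition blk :: "nat list \<Rightarrow> nat \<Rightarrow> nat" where
  "blk \<mu> j = (LEAST i. j \<le> sum_list (take (Suc i) \<mu>))"

definition perm_length :: "nat \<Rightarrow> (nat \<Rightarrow> nat) \<Rightarrow> nat" where
  "perm_length n w = card {(a,b). a \<in> {1..n} \<and> b \<in> {1..n} \<and> a < b \<and> w a > w b}"

definition young_sub :: "nat list \<Rightarrow> (nat \<Rightarrow> nat) set" where
  "young_sub \<mu> = {w. w permutes {1..sum_list \<mu>} \<and> (\<forall>j\<in>{1..sum_list \<mu>}. blk \<mu> (w j) = blk \<mu> j)}"

text \<open>minimal length right coset representatives of \<open>S\<^sub>\<mu>\<close> in \<open>S\<^sub>n\<close> (\<open>\<sigma>\<gamma> = \<gamma> \<circ> \<sigma>\<close>)\<close>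
definition min_coset_reps :: "nat list \<Rightarrow> (nat \<Rightarrow> nat) set" where
  "min_coset_reps \<mu> = {\<gamma>. \<gamma> permutes {1..sum_list \<mu>} \<and>
      (\<forall>\<sigma>\<in>young_sub \<mu>. perm_length (sum_list \<mu>) \<gamma> \<le> perm_length (sum_list \<mu>) (\<gamma> \<circ> \<sigma>))}"

text \<open>Basis \<open>x \<otimes> y \<otimes> \<gamma>\<close> of \<open>\<Delta>\<^sup>(\<^sup>\<nu>\<^sup>1\<^sup>,\<^sup>.\<^sup>.\<^sup>.\<^sup>,\<^sup>\<nu>\<^sup>r\<^sup>)\<close>: \<open>x\<^sub>j\<close> a basis vector of \<open>\<Delta>(\<lambda>\<^sub>b\<^sub>l\<^sub>k \<^sub>j)\<close>,
  \<open>y\<^sub>i\<close> a basis vector (standard tableau) of \<open>S\<^sup>\<nu>\<^sup>i\<close>, \<open>\<gamma>\<close> a minimal coset representative.\<close>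
definition wr_basis :: "(nat \<Rightarrow> 'm set) \<Rightarrow> nat list list
    \<Rightarrow> ((nat \<Rightarrow> 'm) \<times> (nat \<Rightarrow> nat \<times> nat \<Rightarrow> nat) \<times> (nat \<Rightarrow> nat)) set" where
  "wr_basis M \<nu>s = (let \<mu> = map sum_list \<nu>s; n = sum_list \<mu> in
     {(x,y,\<gamma>). (\<forall>j\<in>{1..n}. x j \<in> M (blk \<mu> j)) \<and> (\<forall>j. j \<notin> {1..n} \<longrightarrow> x j = undefined) \<and>
        (\<forall>i<length \<nu>s. y i \<in> std_tab (\<nu>s!i)) \<and> (\<forall>i. i \<ge> length \<nu>s \<longrightarrow> y i = undefined) \<and>
        \<gamma> \<in> min_coset_reps \<mu>})"

definition wr_form :: "nat \<Rightarrow> (nat \<Rightarrow> 'm set)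
    \<Rightarrow> (nat \<times> 'm \<times> 'm \<Rightarrow> nat \<times> 'm \<times> 'm \<Rightarrow> nat \<times> 'm \<times> 'm \<Rightarrow> 'k::field) \<Rightarrow> nat list list
    \<Rightarrow> ((nat \<Rightarrow> 'm) \<times> (nat \<Rightarrow> nat \<times> nat \<Rightarrow> nat) \<times> (nat \<Rightarrow> nat))
    \<Rightarrow> ((nat \<Rightarrow> 'm) \<times> (nat \<Rightarrow> nat \<times> nat \<Rightarrow> nat) \<times> (nat \<Rightarrow> nat)) \<Rightarrow> 'k" where
  "wr_form r M sc \<nu>s = (\<lambda>(x,y,\<gamma>) (x',y',\<gamma>'). let \<mu> = map sum_list \<nu>s in
      (if \<gamma> = \<gamma>' then 1 else 0) *
      (\<Prod>i<length \<nu>s. specht_form (\<nu>s!i) (y i) (y' i)) *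
      (\<Prod>j\<in>{1..sum_list \<mu>}. cell_form r M sc (blk \<mu> j) (x j) (x' j)))"

end

theory Submission
  imports Defs "HOL-Library.Function_Algebras" "HOL-Library.FuncSet" "HOL.Vector_Spaces"
begin

text \<open>The cell form of the wreath product is a product of cell forms, so everything reduces to the claim
  that the cell form of \<open>S\<^sup>\<nu>\<close> is nonzero iff \<open>\<nu>\<close> is \<open>p\<close>-restricted. Since \<open>specht_form\<close> is a choice,
  its defining congruence must first be shown to have exactly one solution. Multiplying by the signed
  column sum \<open>\<kappa>\<^sub>\<lambda>\<close> of a diagram \<open>\<lambda>\<close> annihilates the Murphy elements of shape \<open>\<mu>\<close> unless \<open>\<lambda>\<close> dominates \<open>\<mu>\<close>,
  and for \<open>\<mu> = \<lambda>\<close> it produces a matrix that is unitriangular on standard tableaux; hence the Murphy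
  elements are linearly independent, and because the squares of the numbers of standard tableaux add up to
  \<open>m!\<close> they form a basis. Expanding in this basis replaces Garnir straightening, and yields that
  \<open>specht_form \<nu> t u\<close> is the sum over row permutations \<open>\<rho>\<close> of the coefficient of \<open>\<rho> d(t) d(u)\<inverse>\<close> in
  \<open>\<kappa>\<^sub>\<nu> x\<^sub>\<nu>\<close>. If \<open>p\<close> columns have the same length, rotating them acts freely with order \<open>p\<close> on the row
  permutations and preserves the summands, so the form vanishes. Otherwise, as in James's argument, pairing
  a tableau with the one whose columns are reversed gives, up to sign, the number of row permutations that
  preserve column lengths, which is a product of positive integers, all less than \<open>p\<close> if \<open>p > 0\<close>.\<close>

section \<open>Counting standard tableaux\<close>

text \<open>The field is arbitrary, so no step may divide: the detecting functionals are triangular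
  with diagonal entries 1, both from shape to shape and inside one shape. This decides two further
  points. The constant chosen in \<open>specht_form\<close> exists only if a product minus its
  leading term lies in the span of Murphy elements of strictly dominating shapes; this is checked by
  evaluating the functionals of all other shapes, a downward closed set. And the tableau with
  reversed columns is in general not standard, while the form is given on standard tableaux;
  expanding its Murphy element in the basis carries nonvanishing over to a standard one. Columns
  enter because row a exceeds row a + 1 by the number of columns of length a + 1: a difference of at
  least p supplies the p equal columns to rotate, and differences below p bound the sets of equal
  columns that row permutations may shuffle. Tableaux are functions on nodes. Permutations of
  entries are composed on the left and permutations of nodes on the right, so the two actions
  visibly commute.\<close>

definition young :: "(nat \<times> nat) set \<Rightarrow> bool" where
  "young D \<longleftrightarrow> finite D \<and> (\<forall>a b a' b'. (a,b) \<in> D \<and> a' \<le> a \<and> b' \<le> b \<longrightarrow> (a',b') \<in> D)"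

definition diagrams :: "nat \<Rightarrow> (nat \<times> nat) set set" where
  "diagrams m = {D. young D \<and> card D = m}"

text \<open>The value 0 off \<open>D\<close> makes a tableau determined by its entries, so that
  \<open>std D\<close> is finite and agrees literally with \<open>std_tab\<close>.\<close>

definition std :: "(nat \<times> nat) set \<Rightarrow> (nat \<times> nat \<Rightarrow> nat) set" where
  "std D = {t. bij_betw t D {1..card D} \<and> (\<forall>x. x \<notin> D \<longrightarrow> t x = 0) \<and>
      (\<forall>a b. (a, Suc b) \<in> D \<longrightarrow> t (a,b) < t (a, Suc b)) \<and>
      (\<forall>a b. (Suc a, b) \<in> D \<longrightarrow> t (a,b) < t (Suc a, b))}"

definition removable :: "(nat \<times> nat) set \<Rightarrow> (nat \<times> nat) set" where
  "removable D = {x \<in> D. young (D - {x})}"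

definition addable :: "(nat \<times> nat) set \<Rightarrow> (nat \<times> nat) set" where
  "addable D = {x. x \<notin> D \<and> young (insert x D)}"

lemma young_finite: "young D \<Longrightarrow> finite D"
  by (simp add: young_def)

lemma young_down: "young D \<Longrightarrow> (a,b) \<in> D \<Longrightarrow> a' \<le> a \<Longrightarrow> b' \<le> b \<Longrightarrow> (a',b') \<in> D"
  unfolding young_def by blast

lemma young_Int: "young D \<Longrightarrow> young E \<Longrightarrow> young (D \<inter> E)"
  unfolding young_def by blast

lemma young_Un: "young D \<Longrightarrow> young E \<Longrightarrow> young (D \<union> E)"
  unfolding young_def by blast

lemma down_set_nat: "finite S \<Longrightarrow> (\<And>x y. x \<in> S \<Longrightarrow> y \<le> x \<Longrightarrow> y \<in> S) \<Longrightarrow> S = {..<card S}" for S :: "nat set"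
proof -
  assume fin: "finite S" and dn: "\<And>x y. x \<in> S \<Longrightarrow> y \<le> x \<Longrightarrow> y \<in> S"
  define n where "n = (LEAST n. n \<notin> S)"
  have ex: "\<exists>n. n \<notin> S" using fin ex_new_if_finite infinite_UNIV_nat by blast
  have 1: "n \<notin> S" unfolding n_def using ex by (rule LeastI_ex)
  have 2: "\<And>k. k < n \<Longrightarrow> k \<in> S" unfolding n_def using not_less_Least by blast
  have "S = {..<n}" using 1 2 dn by (metis lessThan_iff not_less set_eqI)
  then show ?thesis by simp
qed

definition row_len :: "(nat \<times> nat) set \<Rightarrow> nat \<Rightarrow> nat" where
  "row_len D a = card {b. (a,b) \<in> D}"

definition col_len :: "(nat \<times> nat) set \<Rightarrow> nat \<Rightarrow> nat" where
  "col_len D b = card {a. (a,b) \<in> D}"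

lemma row_len_iff:
  assumes "young D" shows "(a,b) \<in> D \<longleftrightarrow> b < row_len D a"
proof -
  have "{b. (a,b) \<in> D} = {..<card {b. (a,b) \<in> D}}"
  proof (rule down_set_nat)
    have "{b. (a,b) \<in> D} \<subseteq> snd ` D" by force
    then show "finite {b. (a,b) \<in> D}" using young_finite[OF assms] finite_subset by blast
  qed (use young_down[OF assms] in auto)
  then show ?thesis unfolding row_len_def by blast
qed

lemma col_len_iff:
  assumes "young D" shows "(a,b) \<in> D \<longleftrightarrow> a < col_len D b"
proof -
  have "{a. (a,b) \<in> D} = {..<card {a. (a,b) \<in> D}}"
  proof (rule down_set_nat)
    have "{a. (a,b) \<in> D} \<subseteq> fst ` D" by force
    then show "finite {a. (a,b) \<in> D}" using young_finite[OF assms] finite_subset by blast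
  qed (use young_down[OF assms] in auto)
  then show ?thesis unfolding col_len_def by blast
qed

lemma row_len_antimono: "young D \<Longrightarrow> a \<le> a' \<Longrightarrow> row_len D a' \<le> row_len D a"
  by (metis row_len_iff young_down not_less order_refl)

text \<open>A node forces all nodes above it in its column and all nodes to its left in its
  row.\<close>

lemma diagrams_bounded:
  assumes "D \<in> diagrams m" shows "D \<subseteq> {..<m} \<times> {..<m}"
proof
  fix x assume x: "x \<in> D"
  obtain a b where ab: "x = (a,b)" by force
  have y: "young D" and c: "card D = m" using assms by (auto simp: diagrams_def)
  have "(\<lambda>i. (i,b)) ` {..a} \<subseteq> D" using x young_down[OF y] by (auto simp: ab)
  then have "card ((\<lambda>i. (i,b)) ` {..a}) \<le> m" using c card_mono[OF young_finite[OF y]] by blast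
  then have 1: "a < m" by (simp add: card_image inj_on_def)
  have "(\<lambda>i. (a,i)) ` {..b} \<subseteq> D" using x young_down[OF y] by (auto simp: ab)
  then have "card ((\<lambda>i. (a,i)) ` {..b}) \<le> m" using c card_mono[OF young_finite[OF y]] by blast
  then have "b < m" by (simp add: card_image inj_on_def)
  with 1 show "x \<in> {..<m} \<times> {..<m}" by (simp add: ab)
qed

lemma finite_diagrams: "finite (diagrams m)"
proof -
  have "diagrams m \<subseteq> Pow ({..<m} \<times> {..<m})" using diagrams_bounded by blast
  then show ?thesis by (rule finite_subset) simp
qed

lemma finite_std: "finite D \<Longrightarrow> finite (std D)"
proof -
  assume f: "finite D"
  have "std D \<subseteq> {t. \<forall>x. (x \<in> D \<longrightarrow> t x \<in> {1..card D}) \<and> (x \<notin> D \<longrightarrow> t x = 0)}"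
    by (auto simp: std_def bij_betw_def)
  then show ?thesis using finite_set_of_finite_funs[OF f, of "{1..card D}" 0] finite_subset
    by (metis (no_types, lifting) finite_atLeastAtMost)
qed

lemma std_mono:
  assumes y: "young D" and t: "t \<in> std D" and D: "(a,b) \<in> D" and le: "a' \<le> a" "b' \<le> b"
  shows "t (a',b') \<le> t (a,b)"
proof -
  have 1: "t (a,b') \<le> t (a,b)" using le(2) D
  proof (induction rule: dec_induct)
    case (step n)
    then have "t (a,n) < t (a, Suc n)" using t by (simp add: std_def)
    moreover have "(a,n) \<in> D" using step.prems young_down[OF y] by (meson le_SucI le_refl)
    ultimately show ?case using step.IH by simp
  qed simp
  have "(a,b') \<in> D" using y D le(2) young_down by blast
  with le(1) have "t (a',b') \<le> t (a,b')"
  proof (induction rule: dec_induct)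
    case (step n)
    then have "t (n,b') < t (Suc n,b')" using t by (simp add: std_def)
    moreover have "(n,b') \<in> D" using step.prems young_down[OF y] by (meson le_SucI le_refl)
    ultimately show ?case using step.IH by simp
  qed simp
  with 1 show ?thesis by simp
qed

text \<open>Erasing the largest entry writes the default 0 at x, so putting \<open>card D\<close>
  back is the inverse map.\<close>

lemma std_split:
  assumes y: "young D" and x: "x \<in> removable D"
  shows "bij_betw (\<lambda>t. t(x := 0)) {t \<in> std D. t x = card D} (std (D - {x}))"
proof (rule bij_betw_byWitness[where f' = "\<lambda>t. t(x := card D)"])
  have xD: "x \<in> D" and y': "young (D - {x})" using x by (auto simp: removable_def)
  have fin: "finite D" using y by (rule young_finite)
  have cp: "card D > 0" using xD fin card_gt_0_iff by blast
  have cD: "card (D - {x}) = card D - 1" using xD fin by simp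
  have ivl: "{1..card D} - {card D} = {1..card (D - {x})}" using cD cp by auto
  show "\<forall>t\<in>{t \<in> std D. t x = card D}. (t(x := 0))(x := card D) = t"
    by (auto simp: fun_upd_idem_iff)
  show "\<forall>t\<in>std (D - {x}). (t(x := card D))(x := 0) = t"
    by (cases x) (auto simp: fun_upd_idem_iff std_def)
  show "(\<lambda>t. t(x := 0)) ` {t \<in> std D. t x = card D} \<subseteq> std (D - {x})"
  proof (clarsimp)
    fix t assume t: "t \<in> std D" and tx: "t x = card D"
    have b: "bij_betw t D {1..card D}" using t by (simp add: std_def)
    have "bij_betw t (D - {x}) ({1..card D} - {card D})"
      using bij_betw_DiffI[OF b, of "{x}" "{card D}"] xD tx cp by (auto simp: bij_betw_def)
    then have "bij_betw (t(x:=0)) (D - {x}) {1..card (D - {x})}"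
      unfolding ivl by (subst bij_betw_cong[where g = t]) auto
    moreover have "(a, Suc b) \<notin> D" "(Suc a, b) \<notin> D" if "x = (a,b)" for a b
      using young_down[OF y', of a "Suc b" a b] young_down[OF y', of "Suc a" b a b] that by auto
    ultimately show "t(x := 0) \<in> std (D - {x})"
      using t unfolding std_def by auto
  qed
  show "(\<lambda>t. t(x := card D)) ` std (D - {x}) \<subseteq> {t \<in> std D. t x = card D}"
  proof (clarsimp)
    fix t assume t: "t \<in> std (D - {x})"
    have b: "bij_betw t (D - {x}) {1..card (D-{x})}" using t by (simp add: std_def)
    have rng: "\<And>z. z \<in> D - {x} \<Longrightarrow> t z < card D"
    proof -
      fix z assume "z \<in> D - {x}"
      then have "t z \<in> {1..card (D-{x})}" using bij_betwE[OF b] by blast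
      then show "t z < card D" using cD cp by auto
    qed
    have "bij_betw (t(x:=card D)) (D - {x}) {1..card (D-{x})}"
      by (subst bij_betw_cong[where g = t]) (use b in auto)
    then have "bij_betw (t(x:=card D)) ((D - {x}) \<union> {x}) ({1..card (D-{x})} \<union> {(t(x:=card D)) x})"
      using cD cp by (intro notIn_Un_bij_betw) auto
    then have "bij_betw (t(x:=card D)) (insert x (D - {x})) (insert (card D) {1..card (D-{x})})"
      by simp
    moreover have "insert x (D - {x}) = D" using xD by auto
    moreover have "insert (card D) {1..card (D-{x})} = {1..card D}"
      unfolding ivl[symmetric] using cp by (simp add: insert_absorb)
    ultimately have bb: "bij_betw (t(x:=card D)) D {1..card D}" by simp
    have 1: "(t(x:=card D)) (a,b) < (t(x:=card D)) (a,Suc b)" if "(a,Suc b) \<in> D" for a b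
    proof (cases "(a,Suc b) = x")
      case True
      then have "(a,b) \<in> D - {x}" using that y young_down[OF y, of a "Suc b" a b] by auto
      then show ?thesis using rng True by auto
    next
      case False
      then have "(a,b) \<noteq> x" using young_down[OF y', of a "Suc b" a b] that by auto
      then show ?thesis using False t that by (auto simp: std_def)
    qed
    have 2: "(t(x:=card D)) (a,b) < (t(x:=card D)) (Suc a,b)" if "(Suc a,b) \<in> D" for a b
    proof (cases "(Suc a,b) = x")
      case True
      then have "(a,b) \<in> D - {x}" using that y young_down[OF y, of "Suc a" b a b] by auto
      then show ?thesis using rng True by auto
    next
      case False
      then have "(a,b) \<noteq> x" using young_down[OF y', of "Suc a" b a b] that by auto
      then show ?thesis using False t that by (auto simp: std_def)
    qed
    show "t(x := card D) \<in> std D" using bb 1 2 t xD unfolding std_def by auto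
  qed
qed

text \<open>The branching rule: the largest entry of a standard tableau sits at a removable node,
  since a node to its right or below it would carry a larger entry.\<close>

lemma card_std_rec:
  assumes y: "young D" and ne: "D \<noteq> {}"
  shows "card (std D) = (\<Sum>x\<in>removable D. card (std (D - {x})))"
proof -
  have fin: "finite D" using y by (rule young_finite)
  have cp: "card D > 0" using ne fin by (simp add: card_gt_0_iff)
  have fr: "finite (removable D)" using fin by (simp add: removable_def)
  have eq: "std D = (\<Union>x\<in>removable D. {t \<in> std D. t x = card D})"
  proof (safe)
    fix t assume t: "t \<in> std D"
    then have b: "bij_betw t D {1..card D}" by (simp add: std_def)
    then obtain x where x: "x \<in> D" "t x = card D" using cp
      by (metis atLeastAtMost_iff bij_betw_iff_bijections less_eq_Suc_le One_nat_def order_refl)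
    have "young (D - {x})" unfolding young_def
    proof (intro conjI allI impI)
      show "finite (D - {x})" using fin by simp
      fix a b a' b' assume h: "(a, b) \<in> D - {x} \<and> a' \<le> a \<and> b' \<le> b"
      then have d: "(a',b') \<in> D" using y young_down by blast
      have "(a',b') \<noteq> x"
      proof
        assume e: "(a',b') = x"
        then have "t x \<le> t (a,b)" using std_mono[OF y t, of a b a' b'] h by auto
        moreover have "t (a,b) \<le> card D" using b h bij_betwE by fastforce
        ultimately have "t (a,b) = t x" using x by simp
        then show False using b h x by (auto simp: bij_betw_def inj_on_def)
      qed
      then show "(a',b') \<in> D - {x}" using d by simp
    qed
    then show "t \<in> (\<Union>x\<in>removable D. {t \<in> std D. t x = card D})"
      using x t unfolding removable_def by blast
  qed
  have "card (std D) = (\<Sum>x\<in>removable D. card {t \<in> std D. t x = card D})"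
  proof (subst eq, rule card_UN_disjoint[OF fr])
    show "\<forall>i\<in>removable D. finite {t \<in> std D. t i = card D}" using finite_std[OF fin] by simp
    show "\<forall>i\<in>removable D. \<forall>j\<in>removable D. i \<noteq> j \<longrightarrow>
       {t \<in> std D. t i = card D} \<inter> {t \<in> std D. t j = card D} = {}"
    proof -
      have "i = j" if "i \<in> D" "j \<in> D" "t \<in> std D" "t i = card D" "t j = card D" for i j t
        using that unfolding std_def bij_betw_def inj_on_def by (metis (mono_tags, lifting) mem_Collect_eq)
      then show ?thesis unfolding removable_def by blast
    qed
  qed
  also have "\<dots> = (\<Sum>x\<in>removable D. card (std (D - {x})))"
    using std_split[OF y] bij_betw_same_card by (intro sum.cong) blast+
  finally show ?thesis .
qed

section \<open>Removable and addable nodes\<close>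

lemma removable_iff:
  assumes y: "young D"
  shows "(a,b) \<in> removable D \<longleftrightarrow> row_len D (Suc a) < row_len D a \<and> b = row_len D a - 1"
proof
  assume "(a,b) \<in> removable D"
  then have D: "(a,b) \<in> D" and y': "young (D - {(a,b)})" by (auto simp: removable_def)
  have 1: "(a,Suc b) \<notin> D" using young_down[OF y', of a "Suc b" a b] by auto
  have 2: "(Suc a,b) \<notin> D" using young_down[OF y', of "Suc a" b a b] by auto
  show "row_len D (Suc a) < row_len D a \<and> b = row_len D a - 1"
    using D 1 2 unfolding row_len_iff[OF y] by auto
next
  assume h: "row_len D (Suc a) < row_len D a \<and> b = row_len D a - 1"
  have "(a',b') = (a,b)" if "(a',b') \<in> D" "a \<le> a'" "b \<le> b'" for a' b'
  proof -
    have "b' < row_len D a'" using that row_len_iff[OF y] by simp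
    then have "\<not> Suc a \<le> a'" using row_len_antimono[OF y, of "Suc a" a'] h that by auto
    then have "a' = a" using that by auto
    then show ?thesis using \<open>b' < row_len D a'\<close> h that by auto
  qed
  then have "young (D - {(a,b)})" using y unfolding young_def by blast
  moreover have "(a,b) \<in> D" using h by (simp add: row_len_iff[OF y])
  ultimately show "(a,b) \<in> removable D" by (simp add: removable_def)
qed

lemma addable_iff:
  assumes y: "young D"
  shows "(a,b) \<in> addable D \<longleftrightarrow> (a = 0 \<or> row_len D a < row_len D (a - 1)) \<and> b = row_len D a"
proof
  assume "(a,b) \<in> addable D"
  then have D: "(a,b) \<notin> D" and y': "young (insert (a,b) D)" by (auto simp: addable_def)
  have 1: "b = 0 \<or> (a,b - 1) \<in> D" using young_down[OF y', of a b a "b - 1"] by auto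
  have 2: "a = 0 \<or> (a - 1,b) \<in> D" using young_down[OF y', of a b "a - 1" b] by auto
  show "(a = 0 \<or> row_len D a < row_len D (a - 1)) \<and> b = row_len D a"
    using D 1 2 unfolding row_len_iff[OF y] by auto
next
  assume h: "(a = 0 \<or> row_len D a < row_len D (a - 1)) \<and> b = row_len D a"
  have n: "(a,b) \<notin> D" using h by (simp add: row_len_iff[OF y])
  have "(a',b') \<in> insert (a,b) D" if "a' \<le> a" "b' \<le> b" for a' b'
  proof (cases "a' = a")
    case True
    then show ?thesis using that h row_len_iff[OF y] by auto
  next
    case False
    then have "row_len D (a - 1) \<le> row_len D a'" using that row_len_antimono[OF y] by auto
    then show ?thesis using that h False row_len_iff[OF y] by auto
  qed
  then have "young (insert (a,b) D)" using y unfolding young_def by blast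
  then show "(a,b) \<in> addable D" using n by (simp add: addable_def)
qed

lemma finite_removable: "young D \<Longrightarrow> finite (removable D)"
  using young_finite by (auto simp: removable_def)

lemma card_addable:
  assumes y: "young D"
  shows "finite (addable D)" "card (addable D) = Suc (card (removable D))"
proof -
  \<comment> \<open>A removable node in row a says that row a + 1 is strictly shorter, which is the
    condition for adding a node to row a + 1. Row 0 always accepts a node, whence the
    successor.\<close>
  define g where "g = (\<lambda>x::nat \<times> nat. (Suc (fst x), row_len D (Suc (fst x))))"
  have eq: "addable D = insert (0, row_len D 0) (g ` removable D)"
  proof (intro set_eqI, clarify)
    fix a b
    show "((a, b) \<in> addable D) = ((a, b) \<in> insert (0, row_len D 0) (g ` removable D))"
    proof (cases a)
      case 0 then show ?thesis by (auto simp: addable_iff[OF y] g_def)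
    next
      case (Suc k)
      have "(\<exists>x \<in> removable D. (a,b) = g x) \<longleftrightarrow> row_len D a < row_len D k \<and> b = row_len D a"
        unfolding g_def Bex_def split_paired_Ex removable_iff[OF y] by (auto simp: Suc)
      then show ?thesis by (auto simp: addable_iff[OF y] Suc image_iff)
    qed
  qed
  have inj: "inj_on g (removable D)"
    by (auto simp: inj_on_def g_def removable_iff[OF y])
  show "finite (addable D)" using eq finite_removable[OF y] by simp
  show "card (addable D) = Suc (card (removable D))"
    unfolding eq using finite_removable[OF y]
    by (subst card_insert_disjoint) (auto simp: g_def card_image inj[unfolded g_def])
qed

text \<open>For distinct x and z the order of adding x and removing z is immaterial: the diagram
  missing on either side is an intersection or a union of two given ones.\<close>

lemma add_remove_commute:
  assumes y: "young D"
  shows "x \<in> addable D \<and> z \<in> removable (insert x D) - {x} \<longleftrightarrow>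
         z \<in> removable D \<and> x \<in> addable (D - {z}) - {z}" (is "?L \<longleftrightarrow> ?R")
proof
  assume ?L
  then have h: "x \<notin> D" "young (insert x D)" "z \<in> D" "z \<noteq> x" "young (insert x D - {z})"
    by (auto simp: addable_def removable_def)
  have "D - {z} = D \<inter> (insert x D - {z})" using h by auto
  then have "young (D - {z})" using young_Int[OF y h(5)] by simp
  then show ?R using h by (auto simp: addable_def removable_def insert_Diff_if)
next
  assume ?R
  then have h: "z \<in> D" "young (D - {z})" "x \<notin> D" "x \<noteq> z" "young (insert x (D - {z}))"
    by (auto simp: addable_def removable_def)
  have "insert x D = D \<union> insert x (D - {z})" by auto
  then have "young (insert x D)" using young_Un[OF y h(5)] by simp
  then show ?L using h by (auto simp: addable_def removable_def insert_Diff_if)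
qed

text \<open>The commutation relation \<open>DU - UD = 1\<close> of the up and down operators on Young's lattice.\<close>

lemma sum_addable_std:
  "young D \<Longrightarrow> (\<Sum>x\<in>addable D. card (std (insert x D))) = Suc (card D) * card (std D)"
proof (induction "card D" arbitrary: D rule: less_induct)
  case less
  note y = less.prems
  define f where "f = (\<lambda>D. card (std D))"
  define X where "X = (\<Sum>x\<in>addable D. \<Sum>z\<in>removable (insert x D) - {x}. f (insert x D - {z}))"
  define Z where "Z = (\<Sum>z\<in>removable D. \<Sum>x\<in>addable (D - {z}) - {z}. f (insert x (D - {z})))"
  have ya: "young (insert x D)" if "x \<in> addable D" for x using that by (simp add: addable_def)
  have yr: "young (D - {x})" if "x \<in> removable D" for x using that by (simp add: removable_def)
  have fa: "finite (removable (insert x D))" if "x \<in> addable D" for x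
    using finite_removable ya that by blast
  have fr: "finite (addable (D - {x}))" if "x \<in> removable D" for x
    using card_addable yr that by blast
  have XZ: "X = Z"
  proof -
    let ?S = "Sigma (addable D) (\<lambda>x. removable (insert x D) - {x})"
    let ?T = "Sigma (removable D) (\<lambda>z. addable (D - {z}) - {z})"
    have ST: "(x,z) \<in> ?S \<longleftrightarrow> (z,x) \<in> ?T" for x z
      using add_remove_commute[OF y, of x z] by (simp only: mem_Sigma_iff)
    have "X = (\<Sum>(x,z)\<in>?S. f (insert x D - {z}))"
      unfolding X_def using fa card_addable[OF y] by (subst sum.Sigma) auto
    also have "\<dots> = (\<Sum>(z,x)\<in>?T. f (insert x (D - {z})))"
    proof (rule sum.reindex_bij_witness[where i = prod.swap and j = prod.swap])
      fix p assume p: "p \<in> ?S"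
      obtain x z where xz: "p = (x,z)" by (cases p)
      show "prod.swap p \<in> ?T" using p ST[of x z] unfolding xz by simp
      have "x \<noteq> z" using p unfolding xz by auto
      then show "(case prod.swap p of (z, x) \<Rightarrow> f (insert x (D - {z}))) = (case p of (x, z) \<Rightarrow> f (insert x D - {z}))"
        unfolding xz by (simp add: insert_Diff_if)
    next
      fix p assume p: "p \<in> ?T"
      obtain x z where xz: "p = (z,x)" by (cases p)
      show "prod.swap p \<in> ?S" using p ST[of x z] unfolding xz by simp
    qed simp_all
    also have "\<dots> = Z" unfolding Z_def using fr finite_removable[OF y] by (subst sum.Sigma) auto
    finally show ?thesis .
  qed
  \<comment> \<open>In the branching rule for \<open>insert x D\<close> the choice z = x undoes the
    addition and returns \<open>f D\<close>; the other choices make up \<open>X\<close>.\<close>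
  have "(\<Sum>x\<in>addable D. f (insert x D)) =
        (\<Sum>x\<in>addable D. f D + (\<Sum>z\<in>removable (insert x D) - {x}. f (insert x D - {z})))"
  proof (rule sum.cong[OF refl])
    fix x assume x: "x \<in> addable D"
    have xr: "x \<in> removable (insert x D)" using x y by (auto simp: removable_def addable_def)
    have "f (insert x D) = (\<Sum>z\<in>removable (insert x D). f (insert x D - {z}))"
      unfolding f_def using card_std_rec[OF ya[OF x]] by simp
    also have "\<dots> = f (insert x D - {x}) + (\<Sum>z\<in>removable (insert x D) - {x}. f (insert x D - {z}))"
      by (rule sum.remove[OF fa[OF x] xr])
    also have "insert x D - {x} = D" using x by (auto simp: addable_def)
    finally show "f (insert x D) = f D + (\<Sum>z\<in>removable (insert x D) - {x}. f (insert x D - {z}))" .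
  qed
  also have "\<dots> = card (addable D) * f D + X" by (simp add: sum.distrib X_def)
  \<comment> \<open>The one surplus addable node yields the summand \<open>f D\<close>; the rest is
    regrouped around the removable nodes, where the induction hypothesis applies.\<close>
  also have "\<dots> = f D + (card (removable D) * f D + Z)"
    by (simp add: card_addable[OF y] XZ)
  also have "card (removable D) * f D + Z =
      (\<Sum>z\<in>removable D. f D + (\<Sum>x\<in>addable (D - {z}) - {z}. f (insert x (D - {z}))))"
    by (simp add: sum.distrib Z_def)
  also have "\<dots> = (\<Sum>z\<in>removable D. \<Sum>x\<in>addable (D - {z}). f (insert x (D - {z})))"
  proof (rule sum.cong[OF refl])
    fix z assume z: "z \<in> removable D"
    then have zD: "z \<in> D" by (simp add: removable_def)
    then have za: "z \<in> addable (D - {z})" using y by (auto simp: addable_def insert_absorb)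
    show "f D + (\<Sum>x\<in>addable (D - {z}) - {z}. f (insert x (D - {z}))) =
       (\<Sum>x\<in>addable (D - {z}). f (insert x (D - {z})))"
      using sum.remove[OF fr[OF z] za, of "\<lambda>x. f (insert x (D - {z}))"] zD
      by (simp add: insert_absorb)
  qed
  also have "\<dots> = (\<Sum>z\<in>removable D. card D * f (D - {z}))"
  proof (rule sum.cong[OF refl])
    fix z assume z: "z \<in> removable D"
    then have zD: "z \<in> D" by (simp add: removable_def)
    have c: "Suc (card (D - {z})) = card D" using zD young_finite[OF y]
      by (metis card_Suc_Diff1)
    then show "(\<Sum>x\<in>addable (D - {z}). f (insert x (D - {z}))) = card D * f (D - {z})"
      using less.hyps[OF _ yr[OF z]] unfolding f_def by simp
  qed
  also have "\<dots> = card D * f D"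
  proof (cases "D = {}")
    case False
    then show ?thesis using card_std_rec[OF y False] unfolding f_def by (simp add: sum_distrib_left)
  qed simp
  finally show ?case unfolding f_def by simp
qed

text \<open>The edges of Young's lattice between sizes m and m + 1 are counted from both ends: the
  branching rule expands one factor at the larger diagram, and \<open>sum_addable_std\<close> sums
  over the edges at the smaller one.\<close>

lemma sum_std_squares: "(\<Sum>D\<in>diagrams m. card (std D) * card (std D)) = fact m"
proof (induction m)
  case 0
  have 1: "diagrams 0 = {{}}" by (auto simp: diagrams_def young_def)
  have 2: "std {} = {\<lambda>_. 0}" by (auto simp: std_def bij_betw_def)
  show ?case by (simp add: 1 2)
next
  case (Suc m)
  define f where "f = (\<lambda>D. card (std D))"
  have yf: "young D" "finite (removable D)" "finite (addable D)" if "D \<in> diagrams k" for D k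
    using that finite_removable card_addable by (auto simp: diagrams_def)
  have "(\<Sum>D\<in>diagrams (Suc m). f D * f D) = (\<Sum>D\<in>diagrams (Suc m). \<Sum>x\<in>removable D. f D * f (D - {x}))"
  proof (rule sum.cong[OF refl])
    fix D assume "D \<in> diagrams (Suc m)"
    then have "f D = (\<Sum>x\<in>removable D. f (D - {x}))" unfolding f_def
      by (intro card_std_rec) (auto simp: diagrams_def)
    then show "f D * f D = (\<Sum>x\<in>removable D. f D * f (D - {x}))"
      by (metis sum_distrib_left)
  qed
  also have "\<dots> = (\<Sum>(D,x)\<in>Sigma (diagrams (Suc m)) removable. f D * f (D - {x}))"
    using yf by (subst sum.Sigma) (auto simp: finite_diagrams)
  also have "\<dots> = (\<Sum>(D,x)\<in>Sigma (diagrams m) addable. f (insert x D) * f D)"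
    by (rule sum.reindex_bij_witness[where i = "\<lambda>(D,x). (insert x D, x)" and j = "\<lambda>(D,x). (D - {x}, x)"])
      (auto simp: diagrams_def removable_def addable_def insert_absorb young_finite card_insert_if)
  also have "\<dots> = (\<Sum>D\<in>diagrams m. \<Sum>x\<in>addable D. f (insert x D) * f D)"
    using yf by (subst sum.Sigma) (auto simp: finite_diagrams)
  also have "\<dots> = (\<Sum>D\<in>diagrams m. Suc m * (f D * f D))"
  proof (rule sum.cong[OF refl])
    fix D assume D: "D \<in> diagrams m"
    have "(\<Sum>x\<in>addable D. f (insert x D) * f D) = (\<Sum>x\<in>addable D. f (insert x D)) * f D"
      by (simp add: sum_distrib_right)
    also have "\<dots> = Suc m * (f D * f D)"
      using sum_addable_std[of D] D unfolding f_def diagrams_def by (simp add: algebra_simps)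
    finally show "(\<Sum>x\<in>addable D. f (insert x D) * f D) = Suc m * (f D * f D)" .
  qed
  also have "\<dots> = Suc m * fact m" using Suc unfolding f_def by (metis sum_distrib_left)
  finally show ?case by (simp add: f_def)
qed

section \<open>Murphy elements and signed column sums\<close>

definition tab :: "(nat \<times> nat) set \<Rightarrow> (nat \<times> nat \<Rightarrow> nat) set" where
  "tab D = {t. bij_betw t D {1..card D}}"

text \<open>For tableaux this is the permutation w with w o s = t, that is d(s)^-1 d(t) when
  permutations act on the right. It is the identity outside the entries, as \<open>permutes\<close>
  demands.\<close>

definition between :: "(nat \<times> nat) set \<Rightarrow> (nat \<times> nat \<Rightarrow> nat) \<Rightarrow> (nat \<times> nat \<Rightarrow> nat) \<Rightarrow> nat \<Rightarrow> nat" where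
  "between D s t = (\<lambda>k. if k \<in> {1..card D} then t (inv_into D s k) else k)"

definition row :: "(nat \<times> nat) set \<Rightarrow> nat \<Rightarrow> (nat \<times> nat) set" where
  "row D a = {n \<in> D. fst n = a}"

lemma in_row_image: "n \<in> D \<Longrightarrow> s n \<in> s ` row D (fst n)"
  by (simp add: row_def)

definition row_equiv :: "(nat \<times> nat) set \<Rightarrow> (nat \<times> nat \<Rightarrow> nat) \<Rightarrow> (nat \<times> nat \<Rightarrow> nat) \<Rightarrow> bool" where
  "row_equiv D t u \<longleftrightarrow> (\<forall>a. t ` row D a = u ` row D a)"

definition col_group :: "(nat \<times> nat) set \<Rightarrow> (nat \<times> nat \<Rightarrow> nat \<times> nat) set" where
  "col_group D = {c. c permutes D \<and> (\<forall>n\<in>D. snd (c n) = snd n)}"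

definition row_group :: "(nat \<times> nat) set \<Rightarrow> (nat \<times> nat \<Rightarrow> nat \<times> nat) set" where
  "row_group D = {c. c permutes D \<and> (\<forall>n\<in>D. fst (c n) = fst n)}"

text \<open>The Murphy element \<open>d(s)\<inverse> x d(t)\<close> as a function on permutations, and the coefficient of
  \<open>d(t)\<close> in \<open>\<kappa> d(s) h\<close>, where \<open>\<kappa>\<close> is the signed sum over the column stabiliser.\<close>

definition transport :: "(nat \<times> nat) set \<Rightarrow> (nat \<times> nat \<Rightarrow> nat) \<Rightarrow> (nat \<times> nat \<Rightarrow> nat) \<Rightarrow> (nat \<Rightarrow> nat) \<Rightarrow> 'k::field" where
  "transport D s t = (\<lambda>w. if w permutes {1..card D} \<and> row_equiv D (w \<circ> s) t then 1 else 0)"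

definition signed_sum :: "(nat \<times> nat) set \<Rightarrow> (nat \<times> nat \<Rightarrow> nat) \<Rightarrow> (nat \<times> nat \<Rightarrow> nat) \<Rightarrow> ((nat \<Rightarrow> nat) \<Rightarrow> 'k::field) \<Rightarrow> 'k" where
  "signed_sum D s t h = (\<Sum>c\<in>col_group D. of_int (sign c) * h (between D s (t \<circ> c)))"

text \<open>The coefficient of the tabloid of \<open>t\<close> in the polytabloid of
  \<open>s\<close>.\<close>

definition tabloid_sign :: "(nat \<times> nat) set \<Rightarrow> (nat \<times> nat \<Rightarrow> nat) \<Rightarrow> (nat \<times> nat \<Rightarrow> nat) \<Rightarrow> 'k::field" where
  "tabloid_sign D s t = (\<Sum>c\<in>col_group D. of_int (sign c) * (if row_equiv D (s \<circ> c) t then 1 else 0))"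

definition row_count :: "(nat \<times> nat) set \<Rightarrow> nat \<Rightarrow> nat" where
  "row_count D k = card {n \<in> D. fst n < k}"

section \<open>Tableaux, the permutations between them, row and column groups\<close>

lemma tab_bij: "t \<in> tab D \<Longrightarrow> bij_betw t D {1..card D}"
  by (simp add: tab_def)

lemma tab_inj: "t \<in> tab D \<Longrightarrow> x \<in> D \<Longrightarrow> y \<in> D \<Longrightarrow> t x = t y \<longleftrightarrow> x = y"
  by (auto simp: tab_def bij_betw_def inj_on_def)

lemma tab_in: "t \<in> tab D \<Longrightarrow> x \<in> D \<Longrightarrow> t x \<in> {1..card D}"
  using bij_betwE[OF tab_bij] by blast

lemma tab_inv_into:
  assumes "t \<in> tab D" "k \<in> {1..card D}"
  shows "inv_into D t k \<in> D" "t (inv_into D t k) = k"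
  using assms by (metis bij_betw_def inv_into_into tab_bij) (metis assms bij_betw_inv_into_right tab_bij)

lemma tab_inv_into_apply: "t \<in> tab D \<Longrightarrow> x \<in> D \<Longrightarrow> inv_into D t (t x) = x"
  by (meson bij_betw_def inv_into_f_f tab_bij)

lemma tab_comp: "t \<in> tab D \<Longrightarrow> c permutes D \<Longrightarrow> t \<circ> c \<in> tab D"
  unfolding tab_def using bij_betw_trans permutes_imp_bij by blast

lemma tab_perm: "t \<in> tab D \<Longrightarrow> w permutes {1..card D} \<Longrightarrow> w \<circ> t \<in> tab D"
  unfolding tab_def using bij_betw_trans permutes_imp_bij by blast

lemma std_imp_tab: "t \<in> std D \<Longrightarrow> t \<in> tab D"
  by (simp add: std_def tab_def)

lemma between_apply: "s \<in> tab D \<Longrightarrow> n \<in> D \<Longrightarrow> between D s t (s n) = t n"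
  unfolding between_def using tab_in tab_inv_into_apply by simp

lemma between_eqI:
  assumes "s \<in> tab D" "w permutes {1..card D}" "\<And>n. n \<in> D \<Longrightarrow> w (s n) = t n"
  shows "between D s t = w"
proof
  fix k show "between D s t k = w k"
  proof (cases "k \<in> {1..card D}")
    case True
    then show ?thesis unfolding between_def
      using assms(3)[of "inv_into D s k"] tab_inv_into[OF assms(1) True] by simp
  next
    case False
    then show ?thesis unfolding between_def using permutes_not_in[OF assms(2) False] by auto
  qed
qed

lemma between_permutes:
  assumes "s \<in> tab D" "t \<in> tab D" shows "between D s t permutes {1..card D}"
proof (rule bij_imp_permutes)
  have "bij_betw (t \<circ> inv_into D s) {1..card D} {1..card D}"
    using bij_betw_trans[OF bij_betw_inv_into[OF tab_bij[OF assms(1)]] tab_bij[OF assms(2)]] .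
  then show "bij_betw (between D s t) {1..card D} {1..card D}"
    by (subst bij_betw_cong[where g = "t \<circ> inv_into D s"]) (auto simp: between_def)
qed (auto simp: between_def)

lemma between_comp_perm:
  assumes "s \<in> tab D" "t \<in> tab D" "p permutes {1..card D}"
  shows "between D s (p \<circ> t) = p \<circ> between D s t" "between D (p \<circ> s) t = between D s t \<circ> inv p"
proof -
  show "between D s (p \<circ> t) = p \<circ> between D s t"
    by (rule between_eqI[OF assms(1) permutes_compose[OF between_permutes[OF assms(1,2)] assms(3)]])
      (simp add: between_apply[OF assms(1)])
  show "between D (p \<circ> s) t = between D s t \<circ> inv p"
    by (rule between_eqI[OF tab_perm[OF assms(1,3)] permutes_compose[OF permutes_inv[OF assms(3)] between_permutes[OF assms(1,2)]]])
      (simp add: between_apply[OF assms(1)] permutes_inverses(2)[OF assms(3)])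
qed

lemma between_comp_both:
  assumes "s \<in> tab D" "t \<in> tab D" "d permutes D"
  shows "between D (s \<circ> d) (t \<circ> d) = between D s t"
  by (rule between_eqI[OF tab_comp[OF assms(1,3)] between_permutes[OF assms(1,2)]])
    (simp add: between_apply[OF assms(1)] permutes_in_image[OF assms(3)])

lemma col_groupD: "c \<in> col_group D \<Longrightarrow> c permutes D" "c \<in> col_group D \<Longrightarrow> snd (c n) = snd n"
  by (auto simp: col_group_def) (metis permutes_not_in)

lemma row_groupD: "c \<in> row_group D \<Longrightarrow> c permutes D" "c \<in> row_group D \<Longrightarrow> fst (c n) = fst n"
  by (auto simp: row_group_def) (metis permutes_not_in)

lemma col_group_id: "id \<in> col_group D" by (simp add: col_group_def permutes_id)

lemma col_group_comp: "c \<in> col_group D \<Longrightarrow> d \<in> col_group D \<Longrightarrow> c \<circ> d \<in> col_group D"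
  using col_groupD(2)[of c D] col_groupD(2)[of d D]
  by (simp add: col_group_def permutes_compose)

lemma col_group_inv: "c \<in> col_group D \<Longrightarrow> inv c \<in> col_group D"
proof -
  assume c: "c \<in> col_group D"
  have "snd (inv c n) = snd n" for n
    using col_groupD(2)[OF c, of "inv c n"] permutes_inverses(1)[OF col_groupD(1)[OF c]] by simp
  then show ?thesis using c by (simp add: col_group_def permutes_inv)
qed

lemma row_group_comp: "c \<in> row_group D \<Longrightarrow> d \<in> row_group D \<Longrightarrow> c \<circ> d \<in> row_group D"
  using row_groupD(2)[of c D] row_groupD(2)[of d D]
  by (simp add: row_group_def permutes_compose)

lemma finite_col_group: "finite D \<Longrightarrow> finite (col_group D)"
  using finite_permutations[of D] by (rule rev_finite_subset) (auto simp: col_group_def)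

lemma finite_row_group: "finite D \<Longrightarrow> finite (row_group D)"
  using finite_permutations[of D] by (rule rev_finite_subset) (auto simp: row_group_def)

lemma sign_comp_permutes:
  "finite D \<Longrightarrow> c permutes D \<Longrightarrow> d permutes D \<Longrightarrow> sign (c \<circ> d) = sign c * sign d"
  by (meson permutation_permutes sign_compose)

lemma sum_col_group_comp:
  assumes "d \<in> col_group D" shows "(\<Sum>c\<in>col_group D. f (c \<circ> d)) = (\<Sum>c\<in>col_group D. f c)"
proof (rule sum.reindex_bij_witness[where i = "\<lambda>c. c \<circ> inv d" and j = "\<lambda>c. c \<circ> d"])
  have d: "d permutes D" using assms by (rule col_groupD)
  show "(a \<circ> d) \<circ> inv d = a" "(a \<circ> inv d) \<circ> d = a" for a :: "nat \<times> nat \<Rightarrow> nat \<times> nat"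
    using permutes_inv_o[OF d] by (auto simp: o_assoc[symmetric])
qed (use assms col_group_comp col_group_inv in auto)

text \<open>Even and odd elements are matched explicitly: \<open>S = -S\<close> would not suffice in characteristic 2.\<close>

lemma sum_sign_cancel:
  fixes g :: "(nat \<times> nat \<Rightarrow> nat \<times> nat) \<Rightarrow> 'k::field"
  assumes f: "finite D" and d: "d \<in> col_group D" "sign d = -1" "\<And>c. c \<in> col_group D \<Longrightarrow> g (c \<circ> d) = g c"
  shows "(\<Sum>c\<in>col_group D. of_int (sign c) * g c) = 0"
proof -
  let ?E = "{c \<in> col_group D. sign c = 1}" and ?O = "{c \<in> col_group D. sign c = -1}"
  have dp: "d permutes D" using d(1) by (rule col_groupD)
  have fin: "finite ?E" "finite ?O" using finite_col_group[OF f] by auto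
  have "sign c = 1 \<or> sign c = -1" for c :: "nat \<times> nat \<Rightarrow> nat \<times> nat" by (simp add: sign_def)
  then have U: "col_group D = ?E \<union> ?O" by blast
  have "?E \<inter> ?O = {}" by auto
  then have "(\<Sum>c\<in>col_group D. of_int (sign c) * g c) =
     (\<Sum>c\<in>?E. of_int (sign c) * g c) + (\<Sum>c\<in>?O. of_int (sign c) * g c)"
    by (rule sum.union_disjoint[OF fin, folded U])
  also have "\<dots> = (\<Sum>c\<in>?E. g c) - (\<Sum>c\<in>?O. g c)" by (simp add: sum_negf)
  also have "(\<Sum>c\<in>?O. g c) = (\<Sum>c\<in>?E. g c)"
  proof (rule sum.reindex_bij_witness[where i = "\<lambda>c. c \<circ> d" and j = "\<lambda>c. c \<circ> inv d"])
    have s: "sign (a \<circ> d) = - sign a" if "a \<in> col_group D" for a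
      using sign_comp_permutes[OF f col_groupD(1)[OF that] dp] d(2) by simp
    show 1: "(a \<circ> d) \<circ> inv d = a" "(a \<circ> inv d) \<circ> d = a" for a :: "nat \<times> nat \<Rightarrow> nat \<times> nat"
      using permutes_inv_o[OF dp] by (auto simp: o_assoc[symmetric])
    have i: "a \<circ> inv d \<in> col_group D" if "a \<in> col_group D" for a
      using that d(1) col_group_comp col_group_inv by auto
    show "a \<circ> inv d \<in> ?E" if "a \<in> ?O" for a
      using s[OF i[of a]] that i[of a] unfolding 1 by auto
    show "b \<circ> d \<in> ?O" if "b \<in> ?E" for b
      using s[of b] that d(1) col_group_comp by auto
    show "g (a \<circ> inv d) = g a" if "a \<in> ?O" for a
      using d(3)[OF i[of a]] that unfolding 1 by auto
  qed
  finally show ?thesis by simp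
qed

lemma row_equiv_refl: "row_equiv D t t" by (simp add: row_equiv_def)
lemma row_equiv_sym: "row_equiv D t u \<longleftrightarrow> row_equiv D u t" by (auto simp: row_equiv_def)
lemma row_equiv_trans: "row_equiv D t u \<Longrightarrow> row_equiv D u v \<Longrightarrow> row_equiv D t v" by (auto simp: row_equiv_def)

lemma row_equiv_cong:
  assumes "\<And>n. n \<in> D \<Longrightarrow> t n = t' n" shows "row_equiv D t u \<longleftrightarrow> row_equiv D t' u"
proof -
  have "t ` row D a = t' ` row D a" for a using assms by (auto simp: row_def image_iff)
  then show ?thesis by (simp add: row_equiv_def)
qed

lemma row_equivD: "row_equiv D t u \<Longrightarrow> n \<in> D \<Longrightarrow> t n \<in> u ` row D (fst n)"
  unfolding row_equiv_def row_def by blast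

text \<open>Inclusion row by row is enough because the two images of a row have the same finite
  cardinality.\<close>

lemma row_equivI:
  assumes fin: "finite D" and t: "t \<in> tab D" and u: "u \<in> tab D"
    and sub: "\<And>n. n \<in> D \<Longrightarrow> t n \<in> u ` row D (fst n)"
  shows "row_equiv D t u"
  unfolding row_equiv_def
proof
  fix a
  have s: "row D a \<subseteq> D" by (auto simp: row_def)
  have "t ` row D a \<subseteq> u ` row D a" using sub by (auto simp: row_def)
  moreover have "card (t ` row D a) = card (u ` row D a)"
    using t u s by (metis bij_betw_def card_image inj_on_subset tab_bij)
  ultimately show "t ` row D a = u ` row D a"
    using fin s by (meson card_subset_eq finite_imageI finite_subset)
qed

lemma row_comp:
  assumes "w \<in> row_group D" shows "w ` row D a = row D a"
proof -
  have w: "w permutes D" using assms by (rule row_groupD)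
  show ?thesis
  proof
    show "w ` row D a \<subseteq> row D a" using row_groupD(2)[OF assms] permutes_in_image[OF w] by (auto simp: row_def)
    show "row D a \<subseteq> w ` row D a"
    proof
      fix n assume n: "n \<in> row D a"
      have e: "w (inv w n) = n" using permutes_inverses(1)[OF w] .
      then have "inv w n \<in> row D a" using n row_groupD(2)[OF assms, of "inv w n"] permutes_in_image[OF permutes_inv[OF w], of n]
        by (simp add: row_def)
      then show "n \<in> w ` row D a" using e by (metis imageI)
    qed
  qed
qed

lemma row_equiv_row_group: "w \<in> row_group D \<Longrightarrow> row_equiv D (t \<circ> w) u \<longleftrightarrow> row_equiv D t u"
  unfolding row_equiv_def image_comp[symmetric] by (simp add: row_comp)

text \<open>Replacing c by c o d applies d to both tableaux at once, which \<open>between\<close>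
  does not notice; what is left is the sign of d.\<close>

lemma signed_sum_left:
  assumes f: "finite D" and s: "s \<in> tab D" and t: "t \<in> tab D" and d: "d \<in> col_group D"
  shows "signed_sum D (s \<circ> d) t h = of_int (sign d) * signed_sum D s t h"
proof -
  have dp: "d permutes D" using d by (rule col_groupD)
  have "signed_sum D (s \<circ> d) t h = (\<Sum>c\<in>col_group D. of_int (sign (c \<circ> d)) * h (between D (s \<circ> d) (t \<circ> (c \<circ> d))))"
    unfolding signed_sum_def by (rule sum_col_group_comp[OF d, symmetric])
  also have "\<dots> = (\<Sum>c\<in>col_group D. of_int (sign d) * (of_int (sign c) * h (between D s (t \<circ> c))))"
  proof (rule sum.cong[OF refl])
    fix c assume c: "c \<in> col_group D"
    show "of_int (sign (c \<circ> d)) * h (between D (s \<circ> d) (t \<circ> (c \<circ> d))) = of_int (sign d) * (of_int (sign c) * h (between D s (t \<circ> c)))"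
      using sign_comp_permutes[OF f col_groupD(1)[OF c] dp]
        between_comp_both[OF s tab_comp[OF t col_groupD(1)[OF c]] dp] by (simp add: o_assoc)
  qed
  finally show ?thesis by (simp add: signed_sum_def sum_distrib_left)
qed

lemma tabloid_sign_left:
  assumes f: "finite D" and d: "d \<in> col_group D"
  shows "tabloid_sign D (s \<circ> d) t = of_int (sign d) * (tabloid_sign D s t :: 'k::field)"
proof -
  have dp: "d permutes D" using d by (rule col_groupD)
  have "inv d \<in> col_group D" using d by (rule col_group_inv)
  then have "tabloid_sign D (s \<circ> d) t = (\<Sum>c\<in>col_group D. of_int (sign (d \<circ> c)) * of_int (sign d) * (if row_equiv D (s \<circ> (d \<circ> c)) t then 1 else (0::'k)))"
    unfolding tabloid_sign_def
    by (intro sum.cong refl) (auto simp: sign_comp_permutes[OF f dp] col_groupD o_assoc mult.assoc mult.left_commute simp flip: of_int_mult)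
  also have "\<dots> = (\<Sum>c\<in>col_group D. of_int (sign c) * of_int (sign d) * (if row_equiv D (s \<circ> c) t then 1 else (0::'k)))"
  proof (rule sum.reindex_bij_witness[where i = "\<lambda>c. inv d \<circ> c" and j = "\<lambda>c. d \<circ> c"])
    show "inv d \<circ> (d \<circ> a) = a" "d \<circ> (inv d \<circ> a) = a" for a :: "nat \<times> nat \<Rightarrow> nat \<times> nat"
      using permutes_inv_o[OF dp] by (auto simp: o_assoc)
  qed (use d col_group_comp col_group_inv in auto)
  finally show ?thesis by (simp add: tabloid_sign_def sum_distrib_left mult_ac)
qed

lemma tabloid_sign_cong: "(\<And>n. n \<in> D \<Longrightarrow> s n = s' n) \<Longrightarrow> tabloid_sign D s t = tabloid_sign D s' t"
  unfolding tabloid_sign_def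
proof (intro sum.cong refl)
  fix c assume "\<And>n. n \<in> D \<Longrightarrow> s n = s' n" and c: "c \<in> col_group D"
  then have "row_equiv D (s \<circ> c) t \<longleftrightarrow> row_equiv D (s' \<circ> c) t"
    by (intro row_equiv_cong) (simp add: permutes_in_image[OF col_groupD(1)[OF c]])
  then show "of_int (sign c) * (if row_equiv D (s \<circ> c) t then 1 else 0) = of_int (sign c) * (if row_equiv D (s' \<circ> c) t then 1 else 0)"
    by simp
qed

text \<open>A node is determined by its row and its column; c preserves the one and row equivalence
  the other.\<close>

lemma row_col_trivial:
  assumes s: "s \<in> tab D" and c: "c \<in> col_group D" and r: "row_equiv D (s \<circ> c) s"
  shows "c = id"
proof
  have cp: "c permutes D" using c by (rule col_groupD)
  fix n show "c n = id n"
  proof (cases "n \<in> D")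
    case True
    then have "s (c n) \<in> s ` row D (fst n)" using row_equivD[OF r True] by simp
    then obtain z where z: "z \<in> D" "fst z = fst n" "s (c n) = s z" by (auto simp: row_def)
    then have "c n = z" using tab_inj[OF s] True permutes_in_image[OF cp] by metis
    then show ?thesis using z col_groupD(2)[OF c, of n] by (simp add: prod_eq_iff)
  next
    case False then show ?thesis using permutes_not_in[OF cp] by simp
  qed
qed

text \<open>Only the identity contributes, so the value is 1 in every characteristic. The triangular
  arguments take their diagonal entries from here.\<close>

lemma tabloid_sign_equiv:
  assumes f: "finite D" and s: "s \<in> tab D" and r: "row_equiv D s t"
  shows "tabloid_sign D s t = 1"
proof -
  have "row_equiv D (s \<circ> c) t \<longleftrightarrow> c = id" if "c \<in> col_group D" for c
    using row_col_trivial[OF s that] r row_equiv_trans row_equiv_sym by (metis comp_id)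
  then have "tabloid_sign D s t = (\<Sum>c\<in>col_group D. if c = id then 1 else 0)"
    unfolding tabloid_sign_def by (intro sum.cong) auto
  also have "\<dots> = 1" using col_group_id finite_col_group[OF f] by simp
  finally show ?thesis .
qed

text \<open>The hypothesis of James's basic combinatorial lemma: entries in a common column of
  \<open>s'\<close> lie in different rows of \<open>s\<close>.\<close>

definition separated :: "(nat \<times> nat) set \<Rightarrow> (nat \<times> nat \<Rightarrow> nat) \<Rightarrow> (nat \<times> nat) set \<Rightarrow> (nat \<times> nat \<Rightarrow> nat) \<Rightarrow> bool" where
  "separated D s' E s \<longleftrightarrow> (\<forall>x\<in>D. \<forall>y\<in>D. \<forall>a. snd x = snd y \<and> s' x \<in> s ` row E a \<and> s' y \<in> s ` row E a \<longrightarrow> x = y)"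

lemma transport_transpose:
  assumes s: "s \<in> tab E" and xy: "x \<in> s ` row E a" "y \<in> s ` row E a"
  shows "transport E s t (w \<circ> transpose x y) = transport E s t w"
proof -
  have m: "x \<in> s ` row E b \<longleftrightarrow> b = a" "y \<in> s ` row E b \<longleftrightarrow> b = a" for b
    using xy tab_inj[OF s] by (auto simp: row_def image_iff)
  have tr: "transpose x y permutes {1..card E}"
    using xy tab_in[OF s] by (intro permutes_swap_id) (auto simp: row_def)
  have "w \<circ> transpose x y permutes {1..card E} \<longleftrightarrow> w permutes {1..card E}"
  proof
    assume "w \<circ> transpose x y permutes {1..card E}"
    from permutes_compose[OF tr this] show "w permutes {1..card E}"
      by (simp add: o_assoc[symmetric])
  qed (rule permutes_compose[OF tr])
  moreover have "transpose x y ` s ` row E b = s ` row E b" for b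
    by (rule transpose_image_eq) (simp add: m)
  then have "row_equiv E (w \<circ> transpose x y \<circ> s) t \<longleftrightarrow> row_equiv E (w \<circ> s) t"
    unfolding row_equiv_def image_comp[symmetric] by simp
  ultimately show ?thesis by (simp add: transport_def)
qed

text \<open>Two entries that share a column of \<open>s'\<close> and a row of \<open>s\<close> give
  an odd column permutation which \<open>transport\<close> absorbs, so the signed terms cancel in
  pairs.\<close>

lemma signed_sum_not_separated:
  assumes f: "finite D" and c: "card E = card D" and s': "s' \<in> tab D" and t': "t' \<in> tab D"
    and s: "s \<in> tab E" and ns: "\<not> separated D s' E s"
  shows "signed_sum D s' t' (transport E s t) = 0"
proof -
  obtain x y a where xy: "x \<in> D" "y \<in> D" "snd x = snd y" "s' x \<in> s ` row E a" "s' y \<in> s ` row E a" "x \<noteq> y"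
    using ns unfolding separated_def by blast
  define d where "d = transpose x y"
  have dp: "d permutes D" unfolding d_def using xy by (intro permutes_swap_id)
  have d: "d \<in> col_group D" using dp xy by (auto simp: col_group_def d_def transpose_def)
  have sd: "sign d = -1" using xy by (simp add: d_def sign_swap_id)
  show ?thesis unfolding signed_sum_def
  proof (rule sum_sign_cancel[OF f d sd])
    fix k assume k: "k \<in> col_group D"
    have kp: "k permutes D" using k by (rule col_groupD)
    have "between D s' (t' \<circ> (k \<circ> d)) = between D s' (t' \<circ> k) \<circ> transpose (s' x) (s' y)"
    proof (rule between_eqI[OF s'])
      show "between D s' (t' \<circ> k) \<circ> transpose (s' x) (s' y) permutes {1..card D}"
        using between_permutes[OF s' tab_comp[OF t' kp]] tab_in[OF s'] xy
        by (intro permutes_compose permutes_swap_id)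
      fix n assume n: "n \<in> D"
      have "transpose (s' x) (s' y) (s' n) = s' (d n)"
        using tab_inj[OF s'] n xy by (auto simp: d_def transpose_def)
      then show "(between D s' (t' \<circ> k) \<circ> transpose (s' x) (s' y)) (s' n) = (t' \<circ> (k \<circ> d)) n"
        using between_apply[OF s'] n permutes_in_image[OF dp] by simp
    qed
    then show "transport E s t (between D s' (t' \<circ> (k \<circ> d))) = transport E s t (between D s' (t' \<circ> k))"
      using transport_transpose[OF s xy(4,5)] by simp
  qed
qed

section \<open>Counting along columns and the dominance order\<close>

lemma column_count:
  assumes y: "young D"
  shows "card {n \<in> D. snd n = b \<and> fst n < k} = min (col_len D b) k"
proof -
  have "{n \<in> D. snd n = b \<and> fst n < k} = (\<lambda>a. (a,b)) ` {..<min (col_len D b) k}"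
    using col_len_iff[OF y] by force
  then show ?thesis by (simp add: card_image inj_on_def)
qed

text \<open>Inside one column the labels are distinct, so at most k of them are below k, and there
  are at most \<open>col_len D b\<close> nodes; the true row numbers attain the smaller of the two
  bounds.\<close>

lemma column_count_le:
  assumes y: "young D" and inj: "\<forall>x\<in>D. \<forall>z\<in>D. snd x = snd z \<longrightarrow> r x = r z \<longrightarrow> x = z"
  shows "card {n \<in> D. snd n = b \<and> r n < k} \<le> card {n \<in> D. snd n = b \<and> fst n < (k::nat)}"
proof -
  let ?A = "{n \<in> D. snd n = b \<and> r n < k}"
  have fin: "finite D" using y by (rule young_finite)
  have eq: "{n \<in> D. snd n = b} = {n \<in> D. snd n = b \<and> fst n < col_len D b}"
    using col_len_iff[OF y] by auto
  have "card ?A \<le> card {n \<in> D. snd n = b}" using fin by (intro card_mono) auto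
  then have 1: "card ?A \<le> col_len D b" unfolding eq column_count[OF y] by simp
  have "inj_on r ?A" using inj by (auto simp: inj_on_def)
  then have "card ?A = card (r ` ?A)" by (simp add: card_image)
  also have "\<dots> \<le> card {..<k}" by (intro card_mono) auto
  finally show ?thesis using 1 unfolding column_count[OF y] by simp
qed

lemma card_by_columns:
  assumes "finite D"
  shows "card {n \<in> D. P n} = (\<Sum>b\<in>snd ` D. card {n \<in> D. snd n = b \<and> P n})"
proof -
  have "{n \<in> D. P n} = (\<Union>b\<in>snd ` D. {n \<in> D. snd n = b \<and> P n})" by auto
  moreover have "card (\<Union>b\<in>snd ` D. {n \<in> D. snd n = b \<and> P n}) = (\<Sum>b\<in>snd ` D. card {n \<in> D. snd n = b \<and> P n})"
    using assms by (intro card_UN_disjoint) auto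
  ultimately show ?thesis by simp
qed

lemma column_inj_count_le:
  assumes y: "young D" and inj: "\<forall>x\<in>D. \<forall>z\<in>D. snd x = snd z \<longrightarrow> r x = r z \<longrightarrow> x = z"
  shows "card {n \<in> D. r n < k} \<le> row_count D k"
proof -
  have fin: "finite D" using y by (rule young_finite)
  show "card {n \<in> D. r n < k} \<le> row_count D k"
    unfolding row_count_def card_by_columns[OF fin, of "\<lambda>n. r n < k"] card_by_columns[OF fin, of "\<lambda>n. fst n < k"]
    by (intro sum_mono column_count_le[OF y inj])
qed

text \<open>Equal totals force equality column by column. With k the length of the column, all its
  labels lie below that length, which is membership in \<open>D\<close>.\<close>

lemma column_inj_count_eq:
  assumes y: "young D" and inj: "\<forall>x\<in>D. \<forall>z\<in>D. snd x = snd z \<longrightarrow> r x = r z \<longrightarrow> x = z"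
    and eq: "\<And>k. card {n \<in> D. r n < k} = row_count D k" and n: "n \<in> D"
  shows "(r n, snd n) \<in> D"
proof -
  have fin: "finite D" using y by (rule young_finite)
  let ?b = "snd n" and ?L = "col_len D (snd n)"
  have "card {x \<in> D. snd x = ?b \<and> r x < ?L} = card {x \<in> D. snd x = ?b \<and> fst x < ?L}"
  proof (rule sum_mono_inv[of "\<lambda>b. card {x \<in> D. snd x = b \<and> r x < ?L}" "snd ` D" "\<lambda>b. card {x \<in> D. snd x = b \<and> fst x < ?L}"])
    show "(\<Sum>b\<in>snd ` D. card {x \<in> D. snd x = b \<and> r x < ?L}) = (\<Sum>b\<in>snd ` D. card {x \<in> D. snd x = b \<and> fst x < ?L})"
      using eq[of ?L] card_by_columns[OF fin, of "\<lambda>n. r n < ?L"] card_by_columns[OF fin, of "\<lambda>n. fst n < ?L"]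
      unfolding row_count_def by linarith
  qed (use n fin column_count_le[OF y inj] in auto)
  moreover have "{x \<in> D. snd x = ?b \<and> fst x < ?L} = {x \<in> D. snd x = ?b}"
    using col_len_iff[OF y] by auto
  ultimately have "{x \<in> D. snd x = ?b \<and> r x < ?L} = {x \<in> D. snd x = ?b}"
    using fin by (intro card_subset_eq) auto
  then show "(r n, snd n) \<in> D" using n col_len_iff[OF y] by blast
qed

text \<open>\<open>r n\<close> is the row in which \<open>s\<close> holds the entry that
  \<open>s'\<close> has at n. Separation makes it injective on columns, and its level sets
  correspond to the rows of \<open>E\<close>.\<close>

lemma separated_row:
  assumes y: "young D" and c: "card E = card D" and s': "s' \<in> tab D"
    and s: "s \<in> tab E" and sep: "separated D s' E s"
  defines "r \<equiv> \<lambda>n. fst (inv_into E s (s' n))"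
  shows "\<forall>x\<in>D. \<forall>z\<in>D. snd x = snd z \<longrightarrow> r x = r z \<longrightarrow> x = z"
    and "card {n \<in> D. r n < k} = row_count E k"
proof -
  have iv: "inv_into E s (s' n) \<in> E" "s (inv_into E s (s' n)) = s' n" if "n \<in> D" for n
    using tab_inv_into[OF s] tab_in[OF s' that] c by auto
  show "\<forall>x\<in>D. \<forall>z\<in>D. snd x = snd z \<longrightarrow> r x = r z \<longrightarrow> x = z"
  proof (intro ballI impI)
    fix x z assume h: "x \<in> D" "z \<in> D" "snd x = snd z" "r x = r z"
    have "s' x \<in> s ` row E (r x)" "s' z \<in> s ` row E (r x)"
      using in_row_image[OF iv(1)[OF h(1)], of s] in_row_image[OF iv(1)[OF h(2)], of s] iv(2) h
      by (simp_all add: r_def)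
    then show "x = z" using sep h unfolding separated_def by blast
  qed
  let ?g = "\<lambda>n. inv_into E s (s' n)"
  have bij: "bij_betw ?g D E"
    using bij_betw_trans[OF tab_bij[OF s'], of "inv_into E s" E] bij_betw_inv_into[OF tab_bij[OF s]] c
    by (simp add: comp_def)
  have "?g ` {n \<in> D. r n < k} = {n \<in> E. fst n < k}"
  proof -
    have "?g ` D = E" using bij by (simp add: bij_betw_def)
    moreover have "g ` {n \<in> D. fst (g n) < k} = {n \<in> g ` D. fst n < k}" for g :: "nat \<times> nat \<Rightarrow> nat \<times> nat" by auto
    ultimately show ?thesis unfolding r_def by simp
  qed
  moreover have "card (?g ` {n \<in> D. r n < k}) = card {n \<in> D. r n < k}"
    by (intro card_image inj_on_subset[OF bij_betw_imp_inj_on[OF bij]]) auto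
  ultimately show "card {n \<in> D. r n < k} = row_count E k" unfolding row_count_def by simp
qed

lemma signed_sum_transport_dominance:
  assumes y: "young D" and c: "card E = card D" and s': "s' \<in> tab D" and t': "t' \<in> tab D"
    and s: "s \<in> tab E" and nz: "signed_sum D s' t' (transport E s t) \<noteq> (0::'k::field)"
  shows "row_count E k \<le> row_count D k"
proof -
  have sep: "separated D s' E s" using signed_sum_not_separated[OF young_finite[OF y] c s' t' s] nz by blast
  show ?thesis
    using column_inj_count_le[OF y separated_row(1)[OF y c s' s sep], of k] separated_row(2)[OF y c s' s sep, where k = k] by simp
qed

text \<open>The equality case of the dominance inequality: moving each node vertically to its row
  \<open>r n\<close> stays inside the diagram, so it is a column permutation.\<close>

lemma separated_same:
  assumes y: "young D" and s': "s' \<in> tab D" and s: "s \<in> tab D" and sep: "separated D s' D s"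
  obtains c where "c \<in> col_group D" "row_equiv D (s' \<circ> c) s"
proof -
  define r where "r = (\<lambda>n. fst (inv_into D s (s' n)))"
  have sr: "\<forall>x\<in>D. \<forall>z\<in>D. snd x = snd z \<longrightarrow> r x = r z \<longrightarrow> x = z"
    "\<And>k. card {n \<in> D. r n < k} = row_count D k"
    using separated_row[OF y refl s' s sep] unfolding r_def by blast+
  have fin: "finite D" using y by (rule young_finite)
  define q where "q = (\<lambda>n. if n \<in> D then (r n, snd n) else n)"
  have inD: "(r n, snd n) \<in> D" if "n \<in> D" for n using column_inj_count_eq[OF y sr that] .
  have "inj_on q D" using sr(1) by (auto simp: inj_on_def q_def)
  moreover have "q ` D \<subseteq> D" using inD by (auto simp: q_def)
  ultimately have "bij_betw q D D" using fin by (simp add: bij_betw_def endo_inj_surj)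
  then have qp: "q permutes D" by (rule bij_imp_permutes) (simp add: q_def)
  have q: "q \<in> col_group D" using qp by (simp add: col_group_def q_def)
  have i: "inv q \<in> col_group D" using q by (rule col_group_inv)
  \<comment> \<open>The entry that \<open>s'\<close> has at n must appear at q n, hence the
    inverse.\<close>
  have "row_equiv D (s' \<circ> inv q) s"
  proof (rule row_equivI[OF fin tab_comp[OF s' permutes_inv[OF qp]] s])
    fix n assume n: "n \<in> D"
    have z: "inv q n \<in> D" using n permutes_in_image[OF permutes_inv[OF qp]] by simp
    have "q (inv q n) = n" using permutes_inverses(1)[OF qp] .
    moreover have "q (inv q n) = (r (inv q n), snd (inv q n))" using z by (simp add: q_def[THEN fun_cong])
    ultimately have "r (inv q n) = fst n" by (metis fst_conv)
    moreover have "inv_into D s (s' (inv q n)) \<in> D" "s (inv_into D s (s' (inv q n))) = s' (inv q n)"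
      using tab_inv_into[OF s tab_in[OF s' z]] by auto
    ultimately show "(s' \<circ> inv q) n \<in> s ` row D (fst n)"
      using in_row_image[of "inv_into D s (s' (inv q n))" D s] by (simp add: r_def)
  qed
  then show ?thesis using that i by blast
qed

lemma signed_sum_equiv:
  assumes s'': "s'' \<in> tab D" and t': "t' \<in> tab D" and r: "row_equiv D s'' s"
  shows "signed_sum D s'' t' (transport D s t) = tabloid_sign D t' t"
  unfolding signed_sum_def tabloid_sign_def
proof (intro sum.cong refl)
  fix c assume c: "c \<in> col_group D"
  have tc: "t' \<circ> c \<in> tab D" using tab_comp[OF t' col_groupD(1)[OF c]] .
  let ?w = "between D s'' (t' \<circ> c)"
  have "?w ` s ` row D a = (t' \<circ> c) ` row D a" for a
  proof -
    have "?w ` s ` row D a = ?w ` s'' ` row D a" using r by (simp add: row_equiv_def)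
    also have "\<dots> = (t' \<circ> c) ` row D a" unfolding image_image
      by (intro image_cong refl) (simp add: between_apply[OF s''] row_def)
    finally show ?thesis .
  qed
  then have "row_equiv D (?w \<circ> s) t \<longleftrightarrow> row_equiv D (t' \<circ> c) t"
    unfolding row_equiv_def image_comp[symmetric] by simp
  then show "of_int (sign c) * transport D s t ?w = of_int (sign c) * (if row_equiv D (t' \<circ> c) t then 1 else 0)"
    unfolding transport_def using between_permutes[OF s'' tc] by simp
qed

text \<open>On a fixed shape the matrix of functionals against Murphy elements is a tensor product.
  If the tableaux are separated, a column permutation makes \<open>s'\<close> row equivalent to
  \<open>s\<close> and changes both sides by the same sign; otherwise both sides are 0.\<close>

lemma signed_sum_transport:
  assumes y: "young D" and s': "s' \<in> tab D" and t': "t' \<in> tab D" and s: "s \<in> tab D"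
  shows "signed_sum D s' t' (transport D s t) = tabloid_sign D s' s * (tabloid_sign D t' t :: 'k::field)"
proof (cases "separated D s' D s")
  case True
  have fin: "finite D" using y by (rule young_finite)
  obtain c where c: "c \<in> col_group D" "row_equiv D (s' \<circ> c) s" using separated_same[OF y s' s True] .
  have sc: "s' \<circ> c \<in> tab D" using tab_comp[OF s' col_groupD(1)[OF c(1)]] .
  let ?e = "of_int (sign c) :: 'k"
  have "?e * signed_sum D s' t' (transport D s t) = tabloid_sign D t' t"
    using signed_sum_left[OF fin s' t' c(1)] signed_sum_equiv[OF sc t' c(2)] by metis
  moreover have "?e * tabloid_sign D s' s = 1"
    using tabloid_sign_left[OF fin c(1)] tabloid_sign_equiv[OF fin sc c(2)] by metis
  moreover have "?e * ?e = 1" by (simp flip: of_int_mult add: sign_idempotent)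
  ultimately show ?thesis by (metis mult.assoc mult.commute mult_1)
next
  case False
  have fin: "finite D" using y by (rule young_finite)
  have "\<not> row_equiv D (s' \<circ> c) s" if c: "c \<in> col_group D" for c
  proof
    have cp: "c permutes D" using c by (rule col_groupD)
    assume r: "row_equiv D (s' \<circ> c) s"
    obtain x z a where h: "x \<in> D" "z \<in> D" "snd x = snd z" "s' x \<in> s ` row D a" "s' z \<in> s ` row D a" "x \<noteq> z"
      using False unfolding separated_def by blast
    have "u \<in> c ` row D a" if "u \<in> D" "s' u \<in> s ` row D a" for u
    proof -
      have "s' u \<in> (s' \<circ> c) ` row D a" using that r by (simp add: row_equiv_def)
      then obtain v where v: "v \<in> row D a" "s' u = s' (c v)" by auto
      then have "u = c v" using tab_inj[OF s'] that permutes_in_image[OF cp] by (simp add: row_def)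
      then show ?thesis using v by simp
    qed
    then obtain x' z' where x': "x' \<in> row D a" "x = c x'" and z': "z' \<in> row D a" "z = c z'" using h by blast
    then have "x' = z'" using h(3) col_groupD(2)[OF c] by (simp add: row_def prod_eq_iff)
    then show False using h x' z' by simp
  qed
  then have "tabloid_sign D s' s = (0::'k)" by (simp add: tabloid_sign_def)
  then show ?thesis using signed_sum_not_separated[OF fin refl s' t' s False] by simp
qed

section \<open>The Murphy basis\<close>

lemma inv_into_in_row: "s \<in> tab D \<Longrightarrow> x \<in> s ` row D a \<Longrightarrow> fst (inv_into D s x) = a"
  using tab_inv_into_apply by (fastforce simp: row_def)

text \<open>Rows increase, so each row lists its set of entries in order, and the row of each entry
  determines the tableau.\<close>

lemma std_rows_eq:
  assumes y: "young D" and s: "s \<in> std D" and s': "s' \<in> std D"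
    and eq: "\<And>k. k \<in> {1..card D} \<Longrightarrow> fst (inv_into D s k) = fst (inv_into D s' k)"
  shows "s = s'"
proof -
  note st = std_imp_tab[OF s] and st' = std_imp_tab[OF s']
  \<comment> \<open>Kept general in u and v to be used in both directions: the entry of u at (a,b)
    lies in row a of v, and not to the left of column b.\<close>
  have le: "v (a,b) \<le> u (a,b)"
    if D: "(a,b) \<in> D" and u: "u \<in> std D" and v: "v \<in> std D"
      and rows: "\<And>k. k \<in> {1..card D} \<Longrightarrow> fst (inv_into D u k) = fst (inv_into D v k)"
      and IH: "\<And>b'. b' < b \<Longrightarrow> u (a,b') = v (a,b')" for a b u v
  proof -
    note ut = std_imp_tab[OF u] and vt = std_imp_tab[OF v]
    define k where "k = u (a,b)"
    have k: "k \<in> {1..card D}" unfolding k_def using tab_in[OF ut D] .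
    have "fst (inv_into D v k) = a" using rows[OF k] tab_inv_into_apply[OF ut D] by (simp add: k_def)
    then obtain j where j: "inv_into D v k = (a,j)" by (metis prod.collapse)
    have jD: "(a,j) \<in> D" "v (a,j) = k" using tab_inv_into[OF vt k] j by auto
    have "\<not> j < b"
    proof
      assume "j < b"
      then have "u (a,j) = u (a,b)" using IH jD k_def by simp
      then show False using tab_inj[OF ut jD(1) D] \<open>j < b\<close> by simp
    qed
    then have "v (a,b) \<le> v (a,j)" using std_mono[OF y v jD(1)] by simp
    then show ?thesis using jD k_def by simp
  qed
  have "(a,b) \<in> D \<Longrightarrow> s (a,b) = s' (a,b)" for a b
  proof (induction b rule: less_induct)
    case (less b)
    have IH: "s (a,b') = s' (a,b')" if "b' < b" for b'
      using less.IH[OF that] young_down[OF y less.prems, of a b'] that by simp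
    show ?case
      using le[OF less.prems s s' eq IH] le[OF less.prems s' s eq[symmetric] IH[symmetric]] by simp
  qed
  moreover have "s x = s' x" if "x \<notin> D" for x using that s s' by (cases x) (simp add: std_def)
  ultimately show ?thesis by (metis ext surj_pair)
qed

text \<open>Row indices are complemented so that the well-founded order \<open>lex less_than\<close> runs in the direction
  in which \<open>tabloid_sign\<close> is triangular.\<close>

definition row_word :: "(nat \<times> nat) set \<Rightarrow> (nat \<times> nat \<Rightarrow> nat) \<Rightarrow> nat list" where
  "row_word D s = map (\<lambda>k. card D - fst (inv_into D s (Suc k))) [0..<card D]"

text \<open>From \<open>s'\<close> to \<open>s\<close> the smallest entry that changes its row can
  only move down. Moving up inside its column, it would take the node of a smaller entry, which has
  kept its row and hence its node.\<close>

lemma tabloid_sign_triangular: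
  assumes y: "young D" and s: "s \<in> std D" and s': "s' \<in> std D"
    and nz: "tabloid_sign D s' s \<noteq> (0::'k::field)" and ne: "s \<noteq> s'"
  shows "(row_word D s, row_word D s') \<in> lex less_than"
proof -
  note st = std_imp_tab[OF s] and st' = std_imp_tab[OF s']
  define rw where "rw = (\<lambda>(s :: nat \<times> nat \<Rightarrow> nat) k. fst (inv_into D s k))"
  obtain c where c: "c \<in> col_group D" "row_equiv D (s' \<circ> c) s"
  proof -
    have "\<exists>c\<in>col_group D. of_int (sign c) * (if row_equiv D (s' \<circ> c) s then 1 else 0) \<noteq> (0::'k)"
      using sum.not_neutral_contains_not_neutral[OF nz[unfolded tabloid_sign_def]] by blast
    then show ?thesis using that by (auto split: if_splits)
  qed
  have cp: "c permutes D" using c(1) by (rule col_groupD)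
  have ip: "inv c permutes D" using cp by (rule permutes_inv)
  have rwc: "rw s (s' (c n)) = fst n" if "n \<in> D" for n
    using inv_into_in_row[OF st row_equivD[OF c(2) that]] by (simp add: rw_def)
  have "\<exists>k. k \<in> {1..card D} \<and> rw s k \<noteq> rw s' k"
    using std_rows_eq[OF y s s'] ne unfolding rw_def by blast
  then obtain k where k: "k \<in> {1..card D}" "rw s k \<noteq> rw s' k"
    and min: "\<And>j. j < k \<Longrightarrow> j \<in> {1..card D} \<Longrightarrow> rw s j = rw s' j"
    using exists_least_iff[of "\<lambda>k. k \<in> {1..card D} \<and> rw s k \<noteq> rw s' k"] by blast
  define n where "n = inv_into D s' k"
  define n' where "n' = inv c n"
  have n: "n \<in> D" "s' n = k" "fst n = rw s' k" using tab_inv_into[OF st' k(1)] by (auto simp: n_def rw_def)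
  have n': "n' \<in> D" "c n' = n" "snd n' = snd n"
    using n(1) permutes_in_image[OF ip] permutes_inverses(1)[OF cp] col_groupD(2)[OF c(1), of n'] by (auto simp: n'_def)
  have r: "rw s k = fst n'" using rwc[OF n'(1)] n' n by simp
  have gt: "rw s' k < rw s k"
  proof (rule ccontr)
    assume "\<not> rw s' k < rw s k"
    then have lt: "fst n' < fst n" using k(2) r n by simp
    have "s' n' \<le> s' n"
      using std_mono[OF y s', of "fst n" "snd n" "fst n'" "snd n'", unfolded prod.collapse] n(1) n'(3) lt by simp
    moreover have "s' n' \<noteq> s' n" using tab_inj[OF st' n'(1) n(1)] lt by auto
    ultimately have k': "s' n' < k" using n by simp
    have "rw s (s' n') = rw s' (s' n')" using min[OF k'] tab_in[OF st' n'(1)] by blast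
    also have "\<dots> = fst n'" using tab_inv_into_apply[OF st' n'(1)] by (simp add: rw_def)
    finally have e: "rw s (s' n') = fst n'" .
    define n'' where "n'' = inv c n'"
    have n'': "n'' \<in> D" "c n'' = n'" "snd n'' = snd n'"
      using n'(1) permutes_in_image[OF ip] permutes_inverses(1)[OF cp] col_groupD(2)[OF c(1), of n''] by (auto simp: n''_def)
    have "n'' = n'" using rwc[OF n''(1)] n'' e by (simp add: prod_eq_iff)
    then show False using n''(2) n'(2) lt by simp
  qed
  \<comment> \<open>Natural subtraction from \<open>card D\<close> is strictly decreasing only on
    arguments up to \<open>card D\<close>, so row numbers must be bounded by it.\<close>
  have "fst (inv_into D s k) < card D"
    if "s \<in> tab D" "k \<in> {1..card D}" for s k
    using diagrams_bounded[of D "card D"] y tab_inv_into(1)[OF that] by (force simp: diagrams_def)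
  then have lt: "card D - rw s k < card D - rw s' k" using gt st' k(1) by (auto simp: rw_def diff_less_mono2)
  obtain j where j: "k = Suc j" "j < card D" using k(1) by (metis Suc_le_eq Suc_le_D One_nat_def atLeastAtMost_iff)
  have "take j (row_word D s) = take j (row_word D s')"
    using min j unfolding row_word_def rw_def by (auto simp: take_map)
  moreover have "row_word D s ! j < row_word D s' ! j" using lt j by (simp add: row_word_def rw_def)
  moreover have len: "length (row_word D s) = card D" for s by (simp add: row_word_def)
  ultimately have "(take j (row_word D s) @ row_word D s ! j # drop (Suc j) (row_word D s),
      take j (row_word D s') @ row_word D s' ! j # drop (Suc j) (row_word D s')) \<in> lex less_than"
    by (simp add: lex_append_leftI Cons_in_lex)
  then show ?thesis using j(2) by (simp add: id_take_nth_drop[symmetric] len)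
qed

text \<open>A unitriangular system over a well-founded order has only the zero solution.\<close>

lemma tabloid_sign_kernel:
  fixes v :: "(nat \<times> nat \<Rightarrow> nat) \<Rightarrow> 'k::field"
  assumes y: "young D" and z: "\<And>s'. s' \<in> std D \<Longrightarrow> (\<Sum>s\<in>std D. tabloid_sign D s' s * v s) = 0"
  shows "s \<in> std D \<Longrightarrow> v s = 0"
proof (induction s rule: wf_induct_rule[OF wf_inv_image[OF wf_lex[OF wf_less_than], of "row_word D"]])
  case (1 s')
  have fin: "finite D" using y by (rule young_finite)
  have "tabloid_sign D s' s * v s = (if s = s' then v s' else 0)" if "s \<in> std D" for s
  proof (cases "s = s'")
    case True then show ?thesis using tabloid_sign_equiv[OF fin std_imp_tab[OF that] row_equiv_refl, where 'a='k] by simp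
  next
    case False
    then show ?thesis using tabloid_sign_triangular[OF y that 1(2)] 1(1)[of s] that by (cases "tabloid_sign D s' s = (0::'k)") auto
  qed
  then have "(\<Sum>s\<in>std D. tabloid_sign D s' s * v s) = (\<Sum>s\<in>std D. if s = s' then v s' else 0)"
    by (rule sum.cong[OF refl])
  also have "\<dots> = v s'" using finite_std[OF fin] 1(2) by simp
  finally show ?case using z[OF 1(2)] by simp
qed

type_synonym index = "(nat \<times> nat) set \<times> (nat \<times> nat \<Rightarrow> nat) \<times> (nat \<times> nat \<Rightarrow> nat)"

definition transport_index :: "nat \<Rightarrow> index set" where
  "transport_index m = Sigma (diagrams m) (\<lambda>D. std D \<times> std D)"

definition transport_of :: "index \<Rightarrow> (nat \<Rightarrow> nat) \<Rightarrow> 'k::field" where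
  "transport_of i = transport (fst i) (fst (snd i)) (snd (snd i))"

lemma finite_transport_index: "finite (transport_index m)"
  unfolding transport_index_def using finite_diagrams finite_std by (intro finite_SigmaI) (auto simp: diagrams_def young_finite)

lemma card_transport_index: "card (transport_index m) = fact m"
proof -
  have "card (transport_index m) = (\<Sum>D\<in>diagrams m. card (std D \<times> std D))"
    unfolding transport_index_def using finite_diagrams finite_std
    by (intro card_SigmaI) (auto simp: diagrams_def young_finite)
  then show ?thesis by (simp add: card_cartesian_product sum_std_squares)
qed

lemma signed_sum_sum: "signed_sum D s t (\<lambda>w. \<Sum>i\<in>I. C i * h i w) = (\<Sum>i\<in>I. C i * signed_sum D s t (h i))"
proof -
  have "signed_sum D s t (\<lambda>w. \<Sum>i\<in>I. C i * h i w) =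
    (\<Sum>c\<in>col_group D. \<Sum>i\<in>I. C i * (of_int (sign c) * h i (between D s (t \<circ> c))))"
    unfolding signed_sum_def by (simp add: sum_distrib_left mult_ac)
  also have "\<dots> = (\<Sum>i\<in>I. \<Sum>c\<in>col_group D. C i * (of_int (sign c) * h i (between D s (t \<circ> c))))"
    by (rule sum.swap)
  finally show ?thesis by (simp add: signed_sum_def sum_distrib_left)
qed

lemma row_count_Suc: "finite D \<Longrightarrow> row_count D (Suc a) = row_count D a + row_len D a"
proof -
  assume f: "finite D"
  have "{n \<in> D. fst n < Suc a} = {n \<in> D. fst n < a} \<union> Pair a ` {b. (a,b) \<in> D}" by (auto simp: less_Suc_eq)
  moreover have "{b. (a,b) \<in> D} \<subseteq> snd ` D" by force
  then have "finite {b. (a,b) \<in> D}" using f finite_surj by blast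
  ultimately show ?thesis unfolding row_count_def row_len_def using f
    by (simp add: card_Un_disjoint card_image inj_on_def disjoint_iff image_iff)
qed

text \<open>Row lengths are differences of consecutive counts, and a diagram of size m has no node
  outside its first m rows.\<close>

lemma row_count_inj:
  assumes D: "D \<in> diagrams m" and E: "E \<in> diagrams m" and eq: "\<And>k. k \<le> m \<Longrightarrow> row_count D k = row_count E k"
  shows "D = E"
proof -
  have y: "young D" "young E" using D E by (auto simp: diagrams_def)
  have len: "row_len D a = row_len E a" if "a < m" for a
    using eq[of a] eq[of "Suc a"] that row_count_Suc[OF young_finite[OF y(1)], of a] row_count_Suc[OF young_finite[OF y(2)], of a] by simp
  have "(a,b) \<in> D \<longleftrightarrow> (a,b) \<in> E" for a b
    using diagrams_bounded[OF D] diagrams_bounded[OF E] len[of a] row_len_iff[OF y(1), of a b] row_len_iff[OF y(2), of a b] by auto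
  then show ?thesis by auto
qed

definition dominated :: "(nat \<times> nat) set \<Rightarrow> (nat \<times> nat) set \<Rightarrow> bool" where
  "dominated E D \<longleftrightarrow> (\<forall>k. row_count E k \<le> row_count D k)"

lemma signed_sum_transport_dominated:
  assumes "D \<in> diagrams m" "E \<in> diagrams m" "s' \<in> tab D" "t' \<in> tab D" "s \<in> tab E"
    and "signed_sum D s' t' (transport E s t) \<noteq> (0::'k::field)"
  shows "dominated E D"
  unfolding dominated_def using assms signed_sum_transport_dominance[of D E s' t' s t] by (auto simp: diagrams_def)

text \<open>A functional of shape D kills Murphy elements of every shape that D does not dominate,
  the induction removes the shapes strictly below D, and the equations left for shape D are solved
  by \<open>tabloid_sign_kernel\<close> in one tableau variable after the other. \<open>Q\<close>
  always true gives independence; other downward closed \<open>Q\<close> tell which shapes can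
  occur.\<close>

lemma transport_coeff_zero:
  fixes C :: "index \<Rightarrow> 'k::field"
  assumes Q: "\<And>D E. D \<in> diagrams m \<Longrightarrow> E \<in> diagrams m \<Longrightarrow> Q D \<Longrightarrow> dominated E D \<Longrightarrow> Q E"
    and zero: "\<And>D s t. D \<in> diagrams m \<Longrightarrow> Q D \<Longrightarrow> s \<in> std D \<Longrightarrow> t \<in> std D \<Longrightarrow>
       signed_sum D s t (\<lambda>w. \<Sum>i\<in>transport_index m. C i * transport_of i w) = 0"
  shows "D \<in> diagrams m \<Longrightarrow> Q D \<Longrightarrow> s \<in> std D \<Longrightarrow> t \<in> std D \<Longrightarrow> C (D,s,t) = 0"
\<comment> \<open>On diagrams of size m this number strictly increases along the dominance
  order.\<close>
proof (induction "\<Sum>k\<le>m. row_count D k" arbitrary: D s t rule: less_induct)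
  case (less D)
  note D = less.prems(1)
  have y: "young D" using D by (simp add: diagrams_def)
  have lower: "C (E,s,t) = 0" if E: "E \<in> diagrams m" "E \<noteq> D" "dominated E D" "s \<in> std E" "t \<in> std E" for E s t
  proof -
    have "\<exists>k\<le>m. row_count E k \<noteq> row_count D k" using row_count_inj[OF E(1) D] E(2) by blast
    then have "\<exists>k\<in>{..m}. row_count E k < row_count D k" using E(3) unfolding dominated_def by (metis atMost_iff le_neq_implies_less)
    then have "(\<Sum>k\<le>m. row_count E k) < (\<Sum>k\<le>m. row_count D k)"
      using E(3) by (intro sum_strict_mono_ex1) (auto simp: dominated_def)
    then show ?thesis using less.hyps E Q[OF D E(1) less.prems(2) E(3)] by blast
  qed
  have main: "(\<Sum>s\<in>std D. tabloid_sign D s' s * (\<Sum>t\<in>std D. tabloid_sign D t' t * C (D,s,t))) = 0"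
    if s': "s' \<in> std D" and t': "t' \<in> std D" for s' t'
  proof -
    have fd: "finite (std E)" if "E \<in> diagrams m" for E using that finite_std young_finite by (auto simp: diagrams_def)
    have "0 = (\<Sum>i\<in>transport_index m. C i * signed_sum D s' t' (transport_of i))"
      using zero[OF D less.prems(2) s' t'] by (simp add: signed_sum_sum)
    also have "\<dots> = (\<Sum>E\<in>diagrams m. \<Sum>st\<in>std E \<times> std E. C (E,st) * signed_sum D s' t' (transport_of (E,st)))"
      unfolding transport_index_def using finite_diagrams fd by (subst sum.Sigma) auto
    also have "\<dots> = (\<Sum>E\<in>diagrams m. if E = D then \<Sum>st\<in>std D \<times> std D. C (D,st) * signed_sum D s' t' (transport_of (D,st)) else 0)"
    proof (rule sum.cong[OF refl])
      fix E assume E: "E \<in> diagrams m"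
      have "C (E,st) * signed_sum D s' t' (transport_of (E,st)) = 0" if "E \<noteq> D" "st \<in> std E \<times> std E" for st
      proof (cases "signed_sum D s' t' (transport_of (E,st)) = (0::'k)")
        case False
        then have "dominated E D"
          using signed_sum_transport_dominated[OF D E std_imp_tab[OF s'] std_imp_tab[OF t'], of "fst st" "snd st", where 'k='k] that std_imp_tab[of "fst st" E]
          by (auto simp: transport_of_def)
        then show ?thesis using lower[OF E that(1), of "fst st" "snd st"] that by auto
      qed simp
      then show "(\<Sum>st\<in>std E \<times> std E. C (E,st) * signed_sum D s' t' (transport_of (E,st))) =
         (if E = D then \<Sum>st\<in>std D \<times> std D. C (D,st) * signed_sum D s' t' (transport_of (D,st)) else 0)"
        by (cases "E = D") (simp_all add: sum.neutral)
    qed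
    also have "\<dots> = (\<Sum>st\<in>std D \<times> std D. C (D,st) * signed_sum D s' t' (transport_of (D,st)))"
      using D finite_diagrams by simp
    also have "\<dots> = (\<Sum>(s,t)\<in>std D \<times> std D. tabloid_sign D s' s * (tabloid_sign D t' t * C (D,s,t)))"
      using signed_sum_transport[OF y std_imp_tab[OF s'] std_imp_tab[OF t'] std_imp_tab, where 'k='k]
      by (intro sum.cong refl) (auto simp: transport_of_def)
    also have "\<dots> = (\<Sum>s\<in>std D. \<Sum>t\<in>std D. tabloid_sign D s' s * (tabloid_sign D t' t * C (D,s,t)))"
      by (rule sum.cartesian_product[symmetric])
    finally show ?thesis by (simp add: sum_distrib_left)
  qed
  have "(\<Sum>t\<in>std D. tabloid_sign D t' t * C (D,s,t)) = 0" if "t' \<in> std D" for t'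
    by (rule tabloid_sign_kernel[OF y main[OF _ that] less.prems(3)])
  then show ?case by (rule tabloid_sign_kernel[OF y _ less.prems(4)])
qed

section \<open>From independence to a basis of the group algebra\<close>

lemma vector_space_fun: "vector_space (\<lambda>(c::'k::field) (f::'b \<Rightarrow> 'k) x. c * f x)"
  by unfold_locales (auto simp: fun_eq_iff algebra_simps)

lemma sum_apply: "(\<Sum>i\<in>I. f i) x = (\<Sum>i\<in>I. f i x :: 'k::comm_monoid_add)"
  by (induction I rule: infinite_finite_induct) auto

lemma signed_sum_zero: "signed_sum D s t (\<lambda>w. 0) = 0"
  by (simp add: signed_sum_def)

lemma transport_independent:
  fixes C :: "index \<Rightarrow> 'k::field"
  assumes "\<And>w. (\<Sum>i\<in>transport_index m. C i * transport_of i w) = 0" "i \<in> transport_index m"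
  shows "C i = 0"
proof -
  obtain D s t where i: "i = (D,s,t)" by (metis surj_pair)
  show ?thesis unfolding i
    by (rule transport_coeff_zero[where Q = "\<lambda>_. True" and m = m]) (use assms in \<open>auto simp: signed_sum_zero transport_index_def i\<close>)
qed

text \<open>Independence is known for the indexed family; to pass to a set of m! vectors its members
  must be distinct. A repetition would be the relation with coefficients 1 and -1.\<close>

lemma transport_of_inj: "inj_on (transport_of :: index \<Rightarrow> (nat \<Rightarrow> nat) \<Rightarrow> 'k::field) (transport_index m)"
proof (rule inj_onI, rule ccontr)
  fix i j assume ij: "i \<in> transport_index m" "j \<in> transport_index m" "transport_of i = (transport_of j :: _ \<Rightarrow> 'k)" "i \<noteq> j"
  define C where "C = (\<lambda>x. (if x = i then 1 else 0) - (if x = j then 1 else (0::'k)))"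
  have "(\<Sum>x\<in>transport_index m. C x * transport_of x w) = 0" for w
  proof -
    have "(\<Sum>x\<in>transport_index m. C x * transport_of x w) =
      (\<Sum>x\<in>transport_index m. (if x = i then transport_of i w else 0) - (if x = j then transport_of j w else 0))"
      by (intro sum.cong) (auto simp: C_def)
    also have "\<dots> = transport_of i w - transport_of j w"
      using ij finite_transport_index by (simp add: sum_subtractf)
    finally show ?thesis using ij by simp
  qed
  from transport_independent[OF this ij(1)] ij(4) show False by (simp add: C_def)
qed

lemma transport_of_support: "i \<in> transport_index m \<Longrightarrow> \<not> w permutes {1..m} \<Longrightarrow> transport_of i w = 0"
  by (auto simp: transport_index_def transport_of_def transport_def diagrams_def)

text \<open>The m! independent Murphy elements lie in the span of m! group elements; a function
  outside their span would produce one independent vector too many.\<close>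

lemma transport_spanning:
  fixes h :: "(nat \<Rightarrow> nat) \<Rightarrow> 'k::field"
  assumes "\<And>w. \<not> w permutes {1..m} \<Longrightarrow> h w = 0"
  obtains C where "h = (\<lambda>w. \<Sum>i\<in>transport_index m. C i * transport_of i w)"
proof -
  interpret fs: vector_space "\<lambda>(c::'k) (f::(nat \<Rightarrow> nat) \<Rightarrow> 'k) x. c * f x" by (rule vector_space_fun)
  let ?G = "{w. w permutes {1..m}}"
  define S where "S = (transport_of ` transport_index m :: ((nat \<Rightarrow> nat) \<Rightarrow> 'k) set)"
  define T where "T = (gel ` ?G :: ((nat \<Rightarrow> nat) \<Rightarrow> 'k) set)"
  have fG: "finite ?G" by (simp add: finite_permutations)
  have fS: "finite S" unfolding S_def using finite_transport_index by simp
  have fT: "finite T" unfolding T_def using fG by simp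
  have cS: "card S = fact m" unfolding S_def by (simp add: card_image transport_of_inj card_transport_index)
  have "inj_on (gel :: _ \<Rightarrow> (nat \<Rightarrow> nat) \<Rightarrow> 'k) ?G" by (rule inj_onI) (metis gel_def one_neq_zero)
  moreover have "card ?G = fact m" by (rule card_permutations) auto
  ultimately have cT: "card T = fact m" unfolding T_def by (simp add: card_image)
  have reindex: "(\<Sum>v\<in>S. (\<lambda>x. u v * v x)) = (\<lambda>w. \<Sum>i\<in>transport_index m. u (transport_of i) * transport_of i w)" for u
    unfolding S_def by (rule ext) (simp add: sum_apply sum.reindex[OF transport_of_inj])
  have ind: "fs.independent S"
    unfolding fs.dependent_finite[OF fS]
  proof safe
    fix u v assume v: "v \<in> S" "u v \<noteq> 0" and 0: "(\<Sum>v\<in>S. (\<lambda>x. u v * v x)) = 0"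
    obtain i where i: "i \<in> transport_index m" "v = transport_of i" using v(1) by (auto simp: S_def)
    have "(\<Sum>i\<in>transport_index m. u (transport_of i) * transport_of i w) = 0" for w
      using fun_cong[OF 0[unfolded reindex], of w] by simp
    then have "u (transport_of i) = 0"
      using transport_independent[where m = m and C = "\<lambda>i. u (transport_of i)", OF _ i(1)] by blast
    then show False using v i by simp
  qed
  have supp: "f \<in> fs.span T" if "\<And>w. \<not> w permutes {1..m} \<Longrightarrow> f w = 0" for f
  proof -
    have "f = (\<Sum>\<sigma>\<in>?G. (\<lambda>x. f \<sigma> * gel \<sigma> x))"
    proof
      fix w
      have "(\<Sum>\<sigma>\<in>?G. (\<lambda>x. f \<sigma> * gel \<sigma> x)) w = (\<Sum>\<sigma>\<in>?G. if \<sigma> = w then f w else 0)"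
        unfolding sum_apply by (intro sum.cong) (auto simp: gel_def)
      also have "\<dots> = f w" using fG that by simp
      finally show "f w = (\<Sum>\<sigma>\<in>?G. (\<lambda>x. f \<sigma> * gel \<sigma> x)) w" by simp
    qed
    moreover have "(\<Sum>\<sigma>\<in>?G. (\<lambda>x. f \<sigma> * gel \<sigma> x)) \<in> fs.span T"
      by (intro fs.span_sum fs.span_scale fs.span_base) (auto simp: T_def)
    ultimately show ?thesis by simp
  qed
  have ST: "S \<subseteq> fs.span T"
  proof
    fix f assume "f \<in> S"
    then obtain i where "i \<in> transport_index m" "f = transport_of i" by (auto simp: S_def)
    then show "f \<in> fs.span T" by (auto intro!: supp transport_of_support simp del: One_nat_def)
  qed
  have "h \<in> fs.span S"
  proof (rule ccontr)
    assume h: "h \<notin> fs.span S"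
    then have "fs.independent (insert h S)" using ind by (rule fs.independent_insertI)
    moreover have "insert h S \<subseteq> fs.span T" using ST supp[OF assms] by simp
    ultimately have "card (insert h S) \<le> card T" using fs.independent_span_bound[OF fT] by blast
    moreover have "h \<notin> S" using h fs.span_base by blast
    ultimately show False using cS cT fS by simp
  qed
  then obtain u where "h = (\<Sum>v\<in>S. (\<lambda>x. u v * v x))" unfolding fs.span_finite[OF fS] by (rule rangeE)
  then show ?thesis unfolding reindex by (rule that)
qed

text \<open>Vanishing functionals alone tell which shapes occur in an expansion; no coefficient has
  to be computed.\<close>

lemma transport_expansion:
  fixes h :: "(nat \<Rightarrow> nat) \<Rightarrow> 'k::field"
  assumes supp: "\<And>w. \<not> w permutes {1..m} \<Longrightarrow> h w = 0"
    and Q: "\<And>D E. D \<in> diagrams m \<Longrightarrow> E \<in> diagrams m \<Longrightarrow> Q D \<Longrightarrow> dominated E D \<Longrightarrow> Q E"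
    and zero: "\<And>D s t. D \<in> diagrams m \<Longrightarrow> Q D \<Longrightarrow> s \<in> std D \<Longrightarrow> t \<in> std D \<Longrightarrow> signed_sum D s t h = 0"
  obtains C where "h = (\<lambda>w. \<Sum>i\<in>{i \<in> transport_index m. \<not> Q (fst i)}. C i * transport_of i w)"
proof -
  obtain C where C: "h = (\<lambda>w. \<Sum>i\<in>transport_index m. C i * transport_of i w)" using transport_spanning[of m h] supp by blast
  have z: "C i = 0" if "i \<in> transport_index m" "Q (fst i)" for i
  proof -
    obtain D s t where i: "i = (D,s,t)" by (metis surj_pair)
    have "D \<in> diagrams m" "Q D" "s \<in> std D" "t \<in> std D" using that by (auto simp: transport_index_def i)
    then show ?thesis unfolding i
      by (rule transport_coeff_zero[where Q = Q and m = m, rotated 2]) (erule (3) Q, unfold C[symmetric], erule (3) zero)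
  qed
  have "(\<Sum>i\<in>transport_index m. C i * transport_of i w) = (\<Sum>i\<in>{i \<in> transport_index m. \<not> Q (fst i)}. C i * transport_of i w)" for w
    by (rule sum.mono_neutral_right[OF finite_transport_index]) (auto simp: z)
  then have "h = (\<lambda>w. \<Sum>i\<in>{i \<in> transport_index m. \<not> Q (fst i)}. C i * transport_of i w)"
    by (subst C) (rule ext)
  then show ?thesis by (rule that)
qed

section \<open>Products in the group algebra and the functionals\<close>

lemma gmul_support: "\<not> w permutes {1..m} \<Longrightarrow> gmul m f g w = 0"
  by (simp add: gmul_def)

lemma gmul_sum_left: "gmul m (\<lambda>w. \<Sum>i\<in>I. C i * h i w) g = (\<lambda>w. \<Sum>i\<in>I. C i * gmul m (h i) g w)"
proof
  fix w
  have "(\<Sum>\<sigma> | \<sigma> permutes {1..m}. (\<Sum>i\<in>I. C i * h i \<sigma>) * g (w \<circ> inv \<sigma>)) =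
     (\<Sum>i\<in>I. \<Sum>\<sigma> | \<sigma> permutes {1..m}. C i * (h i \<sigma> * g (w \<circ> inv \<sigma>)))"
    by (subst sum.swap) (simp add: sum_distrib_right mult.assoc)
  then show "gmul m (\<lambda>w. \<Sum>i\<in>I. C i * h i w) g w = (\<Sum>i\<in>I. C i * gmul m (h i) g w)"
    by (auto simp: gmul_def sum_distrib_left)
qed

lemma gmul_swap:
  assumes w: "w permutes {1..m}"
  shows "gmul m f g w = (\<Sum>\<pi> | \<pi> permutes {1..m}. g \<pi> * f (inv \<pi> \<circ> w))"
proof -
  have i: "w \<circ> inv \<sigma> permutes {1..m}" "inv \<sigma> \<circ> w permutes {1..m}" if "\<sigma> permutes {1..m}" for \<sigma>
    using w that by (auto intro: permutes_compose permutes_inv)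
  have e1: "inv (w \<circ> inv \<sigma>) \<circ> w = \<sigma>" if s: "\<sigma> permutes {1..m}" for \<sigma>
    using permutes_inv_o[OF w] permutes_inv_inv[OF s]
    by (simp add: o_inv_distrib permutes_bij[OF w] permutes_bij[OF permutes_inv[OF s]] o_assoc[symmetric])
  have e2: "w \<circ> inv (inv \<sigma> \<circ> w) = \<sigma>" if s: "\<sigma> permutes {1..m}" for \<sigma>
    using permutes_inv_o[OF w] permutes_inv_inv[OF s]
    by (simp add: o_inv_distrib permutes_bij[OF w] permutes_bij[OF permutes_inv[OF s]] o_assoc)
  have "(\<Sum>\<sigma>\<in>{\<sigma>. \<sigma> permutes {1..m}}. f \<sigma> * g (w \<circ> inv \<sigma>)) = (\<Sum>\<pi>\<in>{\<pi>. \<pi> permutes {1..m}}. g \<pi> * f (inv \<pi> \<circ> w))"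
    by (rule sum.reindex_bij_witness[where i = "\<lambda>\<pi>. inv \<pi> \<circ> w" and j = "\<lambda>\<sigma>. w \<circ> inv \<sigma>"])
      (simp_all only: i e1 e2 mem_Collect_eq mult.commute)
  then show ?thesis using w by (simp add: gmul_def)
qed

text \<open>A left factor moves only the first tableau. Its companion for right factors moves only
  the second, and comparing the two evaluates products of Murphy elements.\<close>

lemma signed_sum_gmul_left:
  assumes D: "card D = m" and s: "s \<in> tab D" and t: "t \<in> tab D"
  shows "signed_sum D s t (gmul m f g) = (\<Sum>\<sigma> | \<sigma> permutes {1..m}. f \<sigma> * signed_sum D (\<sigma> \<circ> s) t g)"
proof -
  have "signed_sum D s t (gmul m f g) = (\<Sum>c\<in>col_group D. \<Sum>\<sigma> | \<sigma> permutes {1..m}.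
      f \<sigma> * (of_int (sign c) * g (between D (\<sigma> \<circ> s) (t \<circ> c))))"
    unfolding signed_sum_def
  proof (rule sum.cong[OF refl])
    fix c assume c: "c \<in> col_group D"
    have tc: "t \<circ> c \<in> tab D" using tab_comp[OF t col_groupD(1)[OF c]] .
    show "of_int (sign c) * gmul m f g (between D s (t \<circ> c)) = (\<Sum>\<sigma> | \<sigma> permutes {1..m}.
      f \<sigma> * (of_int (sign c) * g (between D (\<sigma> \<circ> s) (t \<circ> c))))"
      using between_permutes[OF s tc] between_comp_perm(2)[OF s tc] D
      by (simp add: gmul_def sum_distrib_left mult_ac)
  qed
  also have "\<dots> = (\<Sum>\<sigma> | \<sigma> permutes {1..m}. \<Sum>c\<in>col_group D.
      f \<sigma> * (of_int (sign c) * g (between D (\<sigma> \<circ> s) (t \<circ> c))))" by (rule sum.swap)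
  finally show ?thesis by (simp add: signed_sum_def sum_distrib_left)
qed

lemma signed_sum_gmul_right:
  assumes D: "card D = m" and s: "s \<in> tab D" and t: "t \<in> tab D"
  shows "signed_sum D s t (gmul m f g) = (\<Sum>\<pi> | \<pi> permutes {1..m}. g \<pi> * signed_sum D s (inv \<pi> \<circ> t) f)"
proof -
  have "signed_sum D s t (gmul m f g) = (\<Sum>c\<in>col_group D. \<Sum>\<pi> | \<pi> permutes {1..m}.
      g \<pi> * (of_int (sign c) * f (between D s (inv \<pi> \<circ> t \<circ> c))))"
    unfolding signed_sum_def
  proof (rule sum.cong[OF refl])
    fix c assume c: "c \<in> col_group D"
    have tc: "t \<circ> c \<in> tab D" using tab_comp[OF t col_groupD(1)[OF c]] .
    have "gmul m f g (between D s (t \<circ> c)) = (\<Sum>\<pi> | \<pi> permutes {1..m}. g \<pi> * f (inv \<pi> \<circ> between D s (t \<circ> c)))"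
      using between_permutes[OF s tc] D by (intro gmul_swap) simp
    also have "\<dots> = (\<Sum>\<pi> | \<pi> permutes {1..m}. g \<pi> * f (between D s (inv \<pi> \<circ> t \<circ> c)))"
      using between_comp_perm(1)[OF s tc permutes_inv] D by (intro sum.cong refl) (simp add: o_assoc)
    finally show "of_int (sign c) * gmul m f g (between D s (t \<circ> c)) = (\<Sum>\<pi> | \<pi> permutes {1..m}.
      g \<pi> * (of_int (sign c) * f (between D s (inv \<pi> \<circ> t \<circ> c))))"
      by (simp add: sum_distrib_left mult_ac)
  qed
  also have "\<dots> = (\<Sum>\<pi> | \<pi> permutes {1..m}. \<Sum>c\<in>col_group D.
      g \<pi> * (of_int (sign c) * f (between D s (inv \<pi> \<circ> t \<circ> c))))" by (rule sum.swap)
  finally show ?thesis by (simp add: signed_sum_def sum_distrib_left)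
qed

definition gram :: "(nat \<times> nat) set \<Rightarrow> (nat \<times> nat \<Rightarrow> nat) \<Rightarrow> (nat \<times> nat \<Rightarrow> nat) \<Rightarrow> 'k::field" where
  "gram D t u = (\<Sum>\<rho>\<in>row_group D. tabloid_sign D (t \<circ> \<rho>) u)"

text \<open>The permutations \<sigma> in the support of \<open>transport D s t\<close> correspond to
  the row permutations \<rho> through \<sigma> o s = t o \<rho> on \<open>D\<close>.\<close>

lemma sum_transport_tabloid_sign:
  assumes fin: "finite D" and s: "s \<in> tab D" and t: "t \<in> tab D"
  shows "(\<Sum>\<sigma> | \<sigma> permutes {1..card D}. transport D s t \<sigma> * tabloid_sign D (\<sigma> \<circ> s) u) = (gram D t u :: 'k::field)"
proof -
  let ?G = "{\<sigma>. \<sigma> permutes {1..card D}}"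
  have "(\<Sum>\<sigma>\<in>?G. transport D s t \<sigma> * tabloid_sign D (\<sigma> \<circ> s) u) = (\<Sum>\<sigma>\<in>{\<sigma> \<in> ?G. row_equiv D (\<sigma> \<circ> s) t}. tabloid_sign D (\<sigma> \<circ> s) u :: 'k)"
    by (rule sum.mono_neutral_cong_right) (auto simp: transport_def finite_permutations)
  also have "\<dots> = gram D t u" unfolding gram_def
  proof (rule sum.reindex_bij_witness[where i = "\<lambda>\<rho>. between D s (t \<circ> \<rho>)"
        and j = "\<lambda>\<sigma> n. if n \<in> D then inv_into D t (\<sigma> (s n)) else n"])
    fix \<sigma> assume "\<sigma> \<in> {\<sigma> \<in> ?G. row_equiv D (\<sigma> \<circ> s) t}"
    then have sp: "\<sigma> permutes {1..card D}" and r: "row_equiv D (\<sigma> \<circ> s) t" by auto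
    let ?\<rho> = "\<lambda>n. if n \<in> D then inv_into D t (\<sigma> (s n)) else n"
    have ss: "\<sigma> \<circ> s \<in> tab D" using tab_perm[OF s sp] .
    have iv: "inv_into D t (\<sigma> (s n)) \<in> D" "t (inv_into D t (\<sigma> (s n))) = \<sigma> (s n)" if "n \<in> D" for n
      using tab_inv_into[OF t] tab_in[OF ss that] by auto
    have "bij_betw (inv_into D t \<circ> (\<sigma> \<circ> s)) D D"
      using bij_betw_trans[OF tab_bij[OF ss] bij_betw_inv_into[OF tab_bij[OF t]]] .
    then have "bij_betw ?\<rho> D D"
      by (subst bij_betw_cong[where g = "inv_into D t \<circ> (\<sigma> \<circ> s)"]) auto
    then have p: "?\<rho> permutes D" by (rule bij_imp_permutes) simp
    have tr: "t (?\<rho> n) = \<sigma> (s n)" if "n \<in> D" for n using iv[OF that] that by simp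
    show "?\<rho> \<in> row_group D" using p inv_into_in_row[OF t row_equivD[OF r]] by (simp add: row_group_def)
    show "between D s (t \<circ> ?\<rho>) = \<sigma>" by (rule between_eqI[OF s sp]) (use tr in simp)
    show "tabloid_sign D (t \<circ> ?\<rho>) u = tabloid_sign D (\<sigma> \<circ> s) u" by (rule tabloid_sign_cong) (use tr in simp)
  next
    fix \<rho> assume r: "\<rho> \<in> row_group D"
    have rp: "\<rho> permutes D" using r by (rule row_groupD)
    have tr: "t \<circ> \<rho> \<in> tab D" using tab_comp[OF t rp] .
    have "row_equiv D (between D s (t \<circ> \<rho>) \<circ> s) t \<longleftrightarrow> row_equiv D (t \<circ> \<rho>) t"
      by (rule row_equiv_cong) (simp add: between_apply[OF s])
    then show "between D s (t \<circ> \<rho>) \<in> {\<sigma> \<in> ?G. row_equiv D (\<sigma> \<circ> s) t}"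
      using between_permutes[OF s tr] row_equiv_row_group[OF r, of t t] row_equiv_refl by simp
    show "(\<lambda>n. if n \<in> D then inv_into D t (between D s (t \<circ> \<rho>) (s n)) else n) = \<rho>"
      using permutes_not_in[OF rp] permutes_in_image[OF rp]
      by (auto simp: between_apply[OF s] tab_inv_into_apply[OF t])
  qed
  finally show ?thesis .
qed

text \<open>Compared with \<open>signed_sum_transport\<close>, this says that functionals of shape
  \<open>D\<close> do not distinguish the product from \<open>gram D t u\<close> times
  \<open>transport D s v\<close>: the cellular multiplication rule modulo higher shapes.\<close>

lemma signed_sum_transport_transport:
  assumes y: "young D" and tabs: "s' \<in> tab D" "t' \<in> tab D" "s \<in> tab D" "t \<in> tab D" "u \<in> tab D" "v \<in> tab D"
  shows "signed_sum D s' t' (gmul (card D) (transport D s t) (transport D u v)) = tabloid_sign D s' s * gram D t u * (tabloid_sign D t' v :: 'k::field)"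
proof -
  have fin: "finite D" using y by (rule young_finite)
  define A where "A = (\<lambda>s'. \<Sum>\<sigma> | \<sigma> permutes {1..card D}. transport D s t \<sigma> * tabloid_sign D (\<sigma> \<circ> s') u :: 'k)"
  define B where "B = (\<lambda>t'. \<Sum>\<pi> | \<pi> permutes {1..card D}. transport D u v \<pi> * tabloid_sign D (inv \<pi> \<circ> t') t :: 'k)"
  txt \<open>Expanding the product along either factor separates the variables, which forces \<open>A\<close> to be
    proportional to \<open>\<lambda>s'. tabloid_sign D s' s\<close>.\<close>
  have l: "signed_sum D s' t' (gmul (card D) (transport D s t) (transport D u v)) = A s' * tabloid_sign D t' v"
    if "s' \<in> tab D" "t' \<in> tab D" for s' t'
    using signed_sum_transport[OF y tab_perm[OF that(1)] that(2) tabs(5), where 'k='k]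
    unfolding signed_sum_gmul_left[OF refl that] A_def by (simp add: sum_distrib_right mult.assoc)
  have r: "signed_sum D s' t' (gmul (card D) (transport D s t) (transport D u v)) = tabloid_sign D s' s * B t'"
    if "s' \<in> tab D" "t' \<in> tab D" for s' t'
    using signed_sum_transport[OF y that(1) tab_perm[OF that(2) permutes_inv] tabs(3), where 'k='k]
    unfolding signed_sum_gmul_right[OF refl that] B_def by (simp add: sum_distrib_left mult_ac)
  \<comment> \<open>The diagonal values at s and v make \<open>B v\<close> the constant of
    proportionality, and evaluation at s identifies it with \<open>gram D t u\<close>.\<close>
  have one: "tabloid_sign D s s = (1::'k)" "tabloid_sign D v v = (1::'k)"
    using tabloid_sign_equiv[OF fin _ row_equiv_refl] tabs by auto
  have "A s = gram D t u" unfolding A_def by (rule sum_transport_tabloid_sign[OF fin tabs(3,4)])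
  moreover have "A s = B v" using l[OF tabs(3,6)] r[OF tabs(3,6)] one by simp
  moreover have "A s' = tabloid_sign D s' s * B v" using l[OF tabs(1,6)] r[OF tabs(1,6)] one by simp
  ultimately show ?thesis using l[OF tabs(1,2)] by simp
qed

section \<open>The form on the Specht module\<close>

lemma nodes_Sigma: "nodes \<nu> = Sigma {..<length \<nu>} (\<lambda>a. {..<\<nu>!a})"
  by (auto simp: nodes_def)

lemma finite_nodes: "finite (nodes \<nu>)"
  by (simp add: nodes_Sigma)

lemma card_nodes: "card (nodes \<nu>) = sum_list \<nu>"
  by (simp add: nodes_Sigma card_SigmaI sum_list_sum_nth atLeast0LessThan)

lemma young_nodes:
  assumes "is_partition \<nu>" shows "young (nodes \<nu>)"
  unfolding young_def
proof (intro conjI allI impI)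
  fix a b a' b' assume h: "(a, b) \<in> nodes \<nu> \<and> a' \<le> a \<and> b' \<le> b"
  then have "\<nu>!a \<le> \<nu>!a'" using assms sorted_rev_nth_mono[of \<nu> a' a] by (auto simp: is_partition_def nodes_def)
  then show "(a', b') \<in> nodes \<nu>" using h by (auto simp: nodes_def)
qed (rule finite_nodes)

lemma nodes_diagram: "\<nu> \<in> partitions_of m \<Longrightarrow> nodes \<nu> \<in> diagrams m"
  by (simp add: partitions_of_def diagrams_def young_nodes card_nodes)

lemma row_count_nodes: "row_count (nodes \<nu>) k = sum_list (take k \<nu>)"
proof -
  have "{n \<in> nodes \<nu>. fst n < k} = nodes (take k \<nu>)" by (auto simp: nodes_def)
  then show ?thesis unfolding row_count_def by (simp add: card_nodes)
qed

lemma row_len_nodes: "a < length \<nu> \<Longrightarrow> row_len (nodes \<nu>) a = \<nu>!a"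
  unfolding row_len_def nodes_def by simp

text \<open>Parts are nonzero, so the number of parts can be read off the first column of the
  diagram.\<close>

lemma nodes_inj:
  assumes "is_partition \<mu>" "is_partition \<nu>" "nodes \<mu> = nodes \<nu>"
  shows "\<mu> = \<nu>"
proof -
  have len: "a < length \<mu> \<longleftrightarrow> (a,0) \<in> nodes \<mu>" if "is_partition \<mu>" for \<mu> a
  proof -
    have "a < length \<mu> \<Longrightarrow> \<mu>!a \<noteq> 0" using that by (metis is_partition_def nth_mem)
    then show ?thesis by (auto simp: nodes_def)
  qed
  have l: "a < length \<mu> \<longleftrightarrow> a < length \<nu>" for a using len[OF assms(1), of a] len[OF assms(2), of a] assms(3) by simp
  have "length \<mu> = length \<nu>" using l[of "length \<mu>"] l[of "length \<nu>"] by simp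
  then show ?thesis using row_len_nodes[of _ \<mu>] row_len_nodes[of _ \<nu>] assms(3) by (intro nth_equalityI) auto
qed

lemma nodes_surj:
  assumes D: "D \<in> diagrams m"
  obtains \<nu> where "\<nu> \<in> partitions_of m" "nodes \<nu> = D"
proof -
  have y: "young D" using D by (simp add: diagrams_def)
  \<comment> \<open>Stopping at the length of the first column leaves out exactly the empty
    rows.\<close>
  define \<nu> where "\<nu> = map (row_len D) [0..<col_len D 0]"
  have n: "nodes \<nu> = D"
  proof (intro set_eqI, clarify)
    fix a b
    have "(a,b) \<in> D \<Longrightarrow> a < col_len D 0" using young_down[OF y, of a b a 0] col_len_iff[OF y] by simp
    then show "(a,b) \<in> nodes \<nu> \<longleftrightarrow> (a,b) \<in> D" using row_len_iff[OF y, of a b] by (auto simp: nodes_def \<nu>_def)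
  qed
  have "0 \<notin> set \<nu>"
  proof
    assume "0 \<in> set \<nu>"
    then obtain a where "a < col_len D 0" "row_len D a = 0" by (auto simp: \<nu>_def)
    then show False using col_len_iff[OF y, of a 0] row_len_iff[OF y, of a 0] by simp
  qed
  moreover have "sorted (rev \<nu>)"
    unfolding sorted_rev_iff_nth_mono using row_len_antimono[OF y] by (auto simp: \<nu>_def)
  ultimately have "\<nu> \<in> partitions_of m"
    using D card_nodes[of \<nu>] n by (simp add: partitions_of_def is_partition_def diagrams_def)
  then show ?thesis using that n by blast
qed

lemma std_tab_nodes: "std_tab \<nu> = std (nodes \<nu>)"
  by (simp add: std_tab_def std_def card_nodes)

lemma dominates_strict_iff: "dominates_strict \<mu> \<nu> \<longleftrightarrow> \<mu> \<noteq> \<nu> \<and> dominated (nodes \<nu>) (nodes \<mu>)"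
  by (simp add: dominates_strict_def dominated_def row_count_nodes)

lemma dominated_trans: "dominated D E \<Longrightarrow> dominated E F \<Longrightarrow> dominated D F"
  unfolding dominated_def using order_trans by blast

lemma dominated_antisym: "D \<in> diagrams m \<Longrightarrow> E \<in> diagrams m \<Longrightarrow> dominated D E \<Longrightarrow> dominated E D \<Longrightarrow> D = E"
  by (rule row_count_inj) (auto simp: dominated_def intro: antisym)

lemma sum_list_take_Suc: "a < length \<nu> \<Longrightarrow> sum_list (take (Suc a) \<nu>) = sum_list (take a \<nu>) + \<nu>!a" for \<nu> :: "nat list"
  by (simp add: take_Suc_conv_app_nth)

lemma sum_list_take_mono: "a \<le> a' \<Longrightarrow> sum_list (take a \<nu>) \<le> sum_list (take a' \<nu>)" for \<nu> :: "nat list"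
proof -
  assume "a \<le> a'"
  then have "take a \<nu> = take a (take a' \<nu>)" by (simp add: min_def)
  then have "take a' \<nu> = take a \<nu> @ drop a (take a' \<nu>)" by (metis append_take_drop_id)
  then show ?thesis by (metis le_add1 sum_list_append)
qed

lemma tinit_less:
  assumes "(a,b) \<in> nodes \<nu>" "(a',b') \<in> nodes \<nu>" "a < a'"
  shows "tinit \<nu> (a,b) < tinit \<nu> (a',b')"
  using assms sum_list_take_Suc[of a \<nu>] sum_list_take_mono[of "Suc a" a' \<nu>]
  by (simp add: tinit_def) (simp add: nodes_def)

lemma tinit_std: assumes "is_partition \<nu>" shows "tinit \<nu> \<in> std (nodes \<nu>)"
proof -
  have inj: "inj_on (tinit \<nu>) (nodes \<nu>)"
  proof (rule inj_onI, clarify)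
    fix a b a' b' assume h: "(a,b) \<in> nodes \<nu>" "(a',b') \<in> nodes \<nu>" "tinit \<nu> (a,b) = tinit \<nu> (a',b')"
    then have "a = a'" using tinit_less[OF h(1,2)] tinit_less[OF h(2,1)] by (metis linorder_neqE_nat less_irrefl)
    then show "a = a' \<and> b = b'" using h by (simp add: tinit_def)
  qed
  have "tinit \<nu> x \<in> {1..sum_list \<nu>}" if x: "x \<in> nodes \<nu>" for x
  proof -
    obtain a b where ab: "x = (a,b)" by (cases x)
    then have "a < length \<nu>" "b < \<nu>!a" using x by (auto simp: nodes_def)
    then show ?thesis using x sum_list_take_Suc[of a \<nu>] sum_list_take_mono[of "Suc a" "length \<nu>" \<nu>] by (simp add: tinit_def ab)
  qed
  then have "tinit \<nu> ` nodes \<nu> \<subseteq> {1..sum_list \<nu>}" by blast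
  then have "tinit \<nu> ` nodes \<nu> = {1..sum_list \<nu>}"
    by (intro card_subset_eq) (auto simp: card_image[OF inj] card_nodes)
  then have b: "bij_betw (tinit \<nu>) (nodes \<nu>) {1..card (nodes \<nu>)}" using inj by (simp add: bij_betw_def card_nodes)
  have 1: "tinit \<nu> (a,b) < tinit \<nu> (a,Suc b)" if "(a,Suc b) \<in> nodes \<nu>" for a b
    using that by (auto simp: tinit_def nodes_def)
  have 2: "tinit \<nu> (a,b) < tinit \<nu> (Suc a,b)" if "(Suc a,b) \<in> nodes \<nu>" for a b
    using young_down[OF young_nodes[OF assms] that, of a b] tinit_less[OF _ that, of a b] by simp
  show ?thesis unfolding std_def using b 1 2 by (auto simp: tinit_def)
qed

lemma dperm_between: "dperm \<nu> t = between (nodes \<nu>) (tinit \<nu>) t"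
  by (simp add: dperm_def between_def card_nodes)

section \<open>Murphy elements in terms of the rows of tableaux\<close>

lemma gmul_gel_left:
  assumes s: "\<sigma> permutes {1..m}" and w: "w permutes {1..m}"
  shows "gmul m (gel \<sigma>) g w = g (w \<circ> inv \<sigma>)"
proof -
  have "gmul m (gel \<sigma>) g w = (\<Sum>\<tau> | \<tau> permutes {1..m}. if \<tau> = \<sigma> then g (w \<circ> inv \<sigma>) else 0)"
    unfolding gmul_def if_P[OF w] by (intro sum.cong refl) (simp add: gel_def)
  also have "\<dots> = g (w \<circ> inv \<sigma>)" using s by (simp add: finite_permutations)
  finally show ?thesis .
qed

lemma gmul_gel_right:
  assumes s: "\<sigma> permutes {1..m}" and w: "w permutes {1..m}"
  shows "gmul m f (gel \<sigma>) w = f (inv \<sigma> \<circ> w)"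
proof -
  have "gmul m f (gel \<sigma>) w = (\<Sum>\<tau> | \<tau> permutes {1..m}. if \<tau> = \<sigma> then f (inv \<sigma> \<circ> w) else 0)"
    unfolding gmul_swap[OF w] by (intro sum.cong refl) (simp add: gel_def)
  also have "\<dots> = f (inv \<sigma> \<circ> w)" using s by (simp add: finite_permutations)
  finally show ?thesis .
qed

lemma row_stab_iff: "w \<in> row_stab \<nu> \<longleftrightarrow> w permutes {1..sum_list \<nu>} \<and> row_equiv (nodes \<nu>) (w \<circ> tinit \<nu>) (tinit \<nu>)"
proof -
  have r: "{(a,b) |b. b < \<nu>!a} = row (nodes \<nu>) a" if "a < length \<nu>" for a
    using that by (auto simp: row_def nodes_def)
  have e: "row (nodes \<nu>) a = {}" if "\<not> a < length \<nu>" for a using that by (auto simp: row_def nodes_def)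
  have "(\<forall>a<length \<nu>. w ` (tinit \<nu> ` {(a,b) |b. b < \<nu>!a}) = tinit \<nu> ` {(a,b) |b. b < \<nu>!a}) \<longleftrightarrow>
    (\<forall>a. w ` tinit \<nu> ` row (nodes \<nu>) a = tinit \<nu> ` row (nodes \<nu>) a)"
  proof -
    have "(w ` tinit \<nu> ` row (nodes \<nu>) a = tinit \<nu> ` row (nodes \<nu>) a) \<longleftrightarrow>
        (a < length \<nu> \<longrightarrow> w ` (tinit \<nu> ` {(a,b) |b. b < \<nu>!a}) = tinit \<nu> ` {(a,b) |b. b < \<nu>!a})" for a
      by (cases "a < length \<nu>") (simp_all add: r e)
    then show ?thesis by simp
  qed
  then show ?thesis unfolding row_stab_def row_equiv_def image_comp[symmetric] by simp
qed

text \<open>Stripping the outer factors turns the value at w into membership of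
  \<open>inv dt \<circ> w \<circ> ds\<close> in the row stabiliser, which says that w maps each row
  of \<open>s\<close> onto the same row of \<open>t\<close>. The initial tableau disappears.\<close>

lemma murphy_eq_transport:
  assumes p: "is_partition \<nu>" and s: "s \<in> std_tab \<nu>" and t: "t \<in> std_tab \<nu>"
  shows "murphy \<nu> s t = transport (nodes \<nu>) s t"
proof
  fix w
  let ?D = "nodes \<nu>" and ?m = "sum_list \<nu>" and ?t0 = "tinit \<nu>"
  define ds where "ds = dperm \<nu> s"
  define dt where "dt = dperm \<nu> t"
  have st: "s \<in> tab ?D" "t \<in> tab ?D" using s t std_imp_tab unfolding std_tab_nodes by auto
  have t0: "?t0 \<in> tab ?D" using tinit_std[OF p] by (rule std_imp_tab)
  have d: "ds permutes {1..?m}" "dt permutes {1..?m}"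
    using between_permutes[OF t0 st(1)] between_permutes[OF t0 st(2)] by (simp_all add: ds_def dt_def dperm_between card_nodes)
  have dsa: "ds (?t0 n) = s n" and dta: "dt (?t0 n) = t n" if "n \<in> ?D" for n
    using between_apply[OF t0 that] by (simp_all add: ds_def dt_def dperm_between)
  show "murphy \<nu> s t w = transport ?D s t w"
  proof (cases "w permutes {1..?m}")
    case True
    have iw: "inv dt \<circ> w permutes {1..?m}" using True d by (intro permutes_compose permutes_inv)
    have x: "murphy \<nu> s t w = xel \<nu> (inv dt \<circ> w \<circ> ds)"
    proof -
      have "murphy \<nu> s t w = gmul ?m (gel (inv ds)) (xel \<nu>) (inv dt \<circ> w)"
      unfolding murphy_def Let_def ds_def[symmetric] dt_def[symmetric] by (rule gmul_gel_right[OF d(2) True])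
      also have "\<dots> = xel \<nu> (inv dt \<circ> w \<circ> ds)"
        using gmul_gel_left[OF permutes_inv[OF d(1)] iw] by (simp add: permutes_inv_inv[OF d(1)])
      finally show ?thesis .
    qed
    have "inv dt \<circ> w \<circ> ds \<in> row_stab \<nu> \<longleftrightarrow> row_equiv ?D (inv dt \<circ> w \<circ> ds \<circ> ?t0) ?t0"
      using permutes_compose[OF d(1) iw] by (simp add: row_stab_iff)
    also have "\<dots> \<longleftrightarrow> row_equiv ?D (w \<circ> s) t"
    proof -
      have 1: "(inv dt \<circ> w \<circ> ds \<circ> ?t0) ` row ?D a = inv dt ` (w \<circ> s) ` row ?D a" for a
        unfolding image_image by (intro image_cong refl) (simp add: dsa row_def)
      have 2: "t ` row ?D a = dt ` ?t0 ` row ?D a" for a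
        unfolding image_image by (intro image_cong refl) (simp add: dta row_def)
      have 3: "inv dt ` X = Y \<longleftrightarrow> X = dt ` Y" for X Y
      proof -
        have "dt ` inv dt ` X = X" "inv dt ` dt ` Y = Y" by (simp_all add: image_comp permutes_inv_o[OF d(2)])
        then show ?thesis by metis
      qed
      show ?thesis unfolding row_equiv_def 1 2 3 ..
    qed
    finally show ?thesis using True by (simp add: x xel_def transport_def card_nodes)
  next
    case False
    then show ?thesis by (simp add: murphy_def Let_def gmul_support transport_def card_nodes)
  qed
qed

lemma signed_sum_diff: "signed_sum D s t (\<lambda>w. f w - c * g w) = signed_sum D s t f - c * signed_sum D s t g"
  by (simp add: signed_sum_def algebra_simps sum_subtractf sum_distrib_left)

text \<open>A nonzero value would make the shape of some generator both dominated by
  \<open>\<nu>\<close> and strictly dominating it. Uniqueness of the constant in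
  \<open>specht_form\<close> rests on this.\<close>

lemma murphy_gt_signed_sum:
  fixes h :: "(nat \<Rightarrow> nat) \<Rightarrow> 'k::field"
  assumes p: "is_partition \<nu>" and h: "h \<in> murphy_gt \<nu>" and s: "s \<in> tab (nodes \<nu>)" and t: "t \<in> tab (nodes \<nu>)"
  shows "signed_sum (nodes \<nu>) s t h = 0"
proof -
  obtain F c where F: "F \<subseteq> {murphy \<mu> a b | \<mu> a b. \<mu> \<in> partitions_of (sum_list \<nu>) \<and>
      dominates_strict \<mu> \<nu> \<and> a \<in> std_tab \<mu> \<and> b \<in> std_tab \<mu>}" and hF: "h = (\<lambda>x. \<Sum>v\<in>F. c v * v x)"
    using h unfolding murphy_gt_def kspan_def by blast
  have "signed_sum (nodes \<nu>) s t v = 0" if v: "v \<in> F" for v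
  proof (rule ccontr)
    assume nz: "signed_sum (nodes \<nu>) s t v \<noteq> 0"
    obtain \<mu> a b where m: "v = murphy \<mu> a b" "\<mu> \<in> partitions_of (sum_list \<nu>)" "dominates_strict \<mu> \<nu>"
        "a \<in> std_tab \<mu>" "b \<in> std_tab \<mu>" using v F by blast
    have \<nu>: "\<nu> \<in> partitions_of (sum_list \<nu>)" using p by (simp add: partitions_of_def)
    have pm: "is_partition \<mu>" using m by (simp add: partitions_of_def)
    have "a \<in> tab (nodes \<mu>)" using m(4) std_imp_tab unfolding std_tab_nodes by blast
    then have "dominated (nodes \<mu>) (nodes \<nu>)"
      using signed_sum_transport_dominated[OF nodes_diagram[OF \<nu>] nodes_diagram[OF m(2)] s t, of a b, where 'k='k] nz
        murphy_eq_transport[OF pm m(4,5), where 'a='k] m(1) by simp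
    then have "nodes \<mu> = nodes \<nu>" using m(3) dominated_antisym[OF nodes_diagram[OF m(2)] nodes_diagram[OF \<nu>]]
      by (simp add: dominates_strict_iff)
    then show False using nodes_inj[OF pm p] m(3) by (simp add: dominates_strict_def)
  qed
  then show ?thesis unfolding hF signed_sum_sum by simp
qed

lemma transport_of_murphy:
  assumes \<mu>: "\<mu> \<in> partitions_of m" and i: "i \<in> transport_index m" "fst i = nodes \<mu>"
  shows "transport_of i = (murphy \<mu> (fst (snd i)) (snd (snd i)) :: _ \<Rightarrow> 'k::field)" "fst (snd i) \<in> std_tab \<mu>" "snd (snd i) \<in> std_tab \<mu>"
proof -
  show st: "fst (snd i) \<in> std_tab \<mu>" "snd (snd i) \<in> std_tab \<mu>"
    using i by (auto simp: transport_index_def std_tab_nodes)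
  show "transport_of i = (murphy \<mu> (fst (snd i)) (snd (snd i)) :: _ \<Rightarrow> 'k)"
    using murphy_eq_transport[OF _ st, where 'a='k] \<mu> i by (simp add: transport_of_def partitions_of_def)
qed

text \<open>\<open>kspan\<close> sums over a set of functions, the expansions over indices;
  injectivity of \<open>transport_of\<close> carries the coefficients over.\<close>

lemma murphy_gtI:
  fixes C :: "index \<Rightarrow> 'k::field"
  assumes p: "is_partition \<nu>" and J: "J \<subseteq> transport_index (sum_list \<nu>)"
    and dom: "\<And>i. i \<in> J \<Longrightarrow> dominated (nodes \<nu>) (fst i) \<and> fst i \<noteq> nodes \<nu>"
  shows "(\<lambda>w. \<Sum>i\<in>J. C i * transport_of i w) \<in> murphy_gt \<nu>"
proof -
  let ?m = "sum_list \<nu>"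
  have fJ: "finite J" using J finite_transport_index finite_subset by blast
  have inj: "inj_on (transport_of :: index \<Rightarrow> _ \<Rightarrow> 'k) J" using inj_on_subset[OF transport_of_inj J] .
  define F where "F = (transport_of ` J :: ((nat \<Rightarrow> nat) \<Rightarrow> 'k) set)"
  define c where "c = (\<lambda>v :: (nat \<Rightarrow> nat) \<Rightarrow> 'k. C (inv_into J transport_of v))"
  have "(\<lambda>w. \<Sum>i\<in>J. C i * transport_of i w) = (\<lambda>x. \<Sum>v\<in>F. c v * v x)"
    unfolding F_def c_def by (simp add: sum.reindex[OF inj] inv_into_f_f[OF inj])
  moreover have "F \<subseteq> {murphy \<mu> a b | \<mu> a b. \<mu> \<in> partitions_of ?m \<and>
      dominates_strict \<mu> \<nu> \<and> a \<in> std_tab \<mu> \<and> b \<in> std_tab \<mu>}"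
  proof
    fix v assume "v \<in> F"
    then obtain i where i: "i \<in> J" "v = transport_of i" by (auto simp: F_def)
    have iI: "i \<in> transport_index ?m" using i J by blast
    then have "fst i \<in> diagrams ?m" by (auto simp: transport_index_def)
    then obtain \<mu> where \<mu>: "\<mu> \<in> partitions_of ?m" "nodes \<mu> = fst i" by (rule nodes_surj)
    have "dominates_strict \<mu> \<nu>" using dom[OF i(1)] \<mu>(2) by (auto simp: dominates_strict_iff)
    then show "v \<in> {murphy \<mu> a b | \<mu> a b. \<mu> \<in> partitions_of ?m \<and>
      dominates_strict \<mu> \<nu> \<and> a \<in> std_tab \<mu> \<and> b \<in> std_tab \<mu>}"
      using transport_of_murphy[OF \<mu>(1) iI \<mu>(2)[symmetric]] \<mu>(1) i(2) by blast
  qed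
  ultimately show ?thesis unfolding murphy_gt_def kspan_def using fJ F_def by blast
qed

text \<open>Existence: the difference is killed by every functional of a shape that does not
  strictly dominate \<open>\<nu>\<close>, hence expands in strictly dominating shapes. Uniqueness:
  the functional at (t,t) kills \<open>murphy_gt \<nu>\<close> and sends the difference for s = v =
  t to \<open>gram\<close> minus c.\<close>

lemma specht_form_eq_gram:
  assumes p: "is_partition \<nu>" and t: "t \<in> std_tab \<nu>" and u: "u \<in> std_tab \<nu>"
  shows "specht_form \<nu> t u = (gram (nodes \<nu>) t u :: 'k::field)"
  unfolding specht_form_def
proof (rule some_equality)
  let ?D = "nodes \<nu>" and ?m = "sum_list \<nu>"
  have \<nu>: "\<nu> \<in> partitions_of ?m" using p by (simp add: partitions_of_def)
  have D: "?D \<in> diagrams ?m" using \<nu> by (rule nodes_diagram)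
  have y: "young ?D" using p by (rule young_nodes)
  have fin: "finite ?D" by (rule finite_nodes)
  have tt: "a \<in> tab ?D" if "a \<in> std_tab \<nu>" for a using that std_imp_tab unfolding std_tab_nodes by blast
  have mm: "(murphy \<nu> a b :: _ \<Rightarrow> 'k) = transport ?D a b" if "a \<in> std_tab \<nu>" "b \<in> std_tab \<nu>" for a b
    using murphy_eq_transport[OF p that] .
  have prod: "signed_sum ?D s' t' (\<lambda>w. gmul ?m (murphy \<nu> s t) (murphy \<nu> u v) w - c * murphy \<nu> s v w) =
      tabloid_sign ?D s' s * (gram ?D t u - c) * (tabloid_sign ?D t' v :: 'k)"
    if "s \<in> std_tab \<nu>" "v \<in> std_tab \<nu>" "s' \<in> tab ?D" "t' \<in> tab ?D" for s v s' t' c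
    unfolding signed_sum_diff mm[OF that(1) t] mm[OF u that(2)] mm[OF that(1,2)]
    using signed_sum_transport_transport[OF y that(3,4) tt[OF that(1)] tt[OF t] tt[OF u] tt[OF that(2)], where 'k='k]
      signed_sum_transport[OF y that(3,4) tt[OF that(1)], of v, where 'k='k] by (simp add: card_nodes algebra_simps)
  show "\<forall>s\<in>std_tab \<nu>. \<forall>v\<in>std_tab \<nu>.
      (\<lambda>w. gmul ?m (murphy \<nu> s t) (murphy \<nu> u v) w - gram ?D t u * murphy \<nu> s v w) \<in> (murphy_gt \<nu> :: (_ \<Rightarrow> 'k) set)"
  proof (intro ballI)
    fix s v assume s: "s \<in> std_tab \<nu>" and v: "v \<in> std_tab \<nu>"
    let ?h = "\<lambda>w. gmul ?m (murphy \<nu> s t) (murphy \<nu> u v) w - gram ?D t u * murphy \<nu> s v w :: 'k"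
    define Q where "Q = (\<lambda>E. \<not> (dominated ?D E \<and> E \<noteq> ?D))"
    have supp: "?h w = 0" if "\<not> w permutes {1..?m}" for w
      using that by (simp add: gmul_support mm[OF s v] transport_def card_nodes)
    have Q: "Q F" if "E \<in> diagrams ?m" "F \<in> diagrams ?m" "Q E" "dominated F E" for E F
      using that dominated_trans[of ?D F E] dominated_antisym[OF D that(2)] unfolding Q_def by blast
    have zero: "signed_sum E s' t' ?h = 0" if E: "E \<in> diagrams ?m" "Q E" "s' \<in> std E" "t' \<in> std E" for E s' t'
    proof (cases "E = ?D")
      case True
      then show ?thesis using prod[OF s v, of s' t'] E std_imp_tab by simp
    next
      case False
      then have nd: "\<not> dominated ?D E" using E(2) by (simp add: Q_def)
      have cE: "card E = ?m" using E(1) by (simp add: diagrams_def)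
      have z: "signed_sum E s' t'' (transport ?D a b) = (0::'k)" if "t'' \<in> tab E" "a \<in> std_tab \<nu>" for t'' a b
        using signed_sum_transport_dominated[OF E(1) D std_imp_tab[OF E(3)] that(1) tt[OF that(2)], of b, where 'k='k] nd by blast
      \<comment> \<open>The right factor moves only the second tableau, which is arbitrary in
        \<open>z\<close>, so vanishing on the left factor carries over to the product.\<close>
      have "signed_sum E s' t' (gmul ?m (transport ?D s t) (transport ?D u v)) = (0::'k)"
        unfolding signed_sum_gmul_right[OF cE std_imp_tab[OF E(3)] std_imp_tab[OF E(4)]]
        using z[OF tab_perm[OF std_imp_tab[OF E(4)] permutes_inv] s] cE by (intro sum.neutral) auto
      then show ?thesis unfolding signed_sum_diff mm[OF s t] mm[OF u v] mm[OF s v] using z[OF std_imp_tab[OF E(4)] s] by simp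
    qed
    obtain C where C: "?h = (\<lambda>w. \<Sum>i\<in>{i \<in> transport_index ?m. \<not> Q (fst i)}. C i * transport_of i w)"
      by (rule transport_expansion[where h = ?h and m = ?m and Q = Q]) (erule supp, erule (3) Q, erule (3) zero, blast)
    show "?h \<in> murphy_gt \<nu>" unfolding C
      by (rule murphy_gtI[OF p]) (auto simp: Q_def)
  qed
  fix c :: 'k
  assume c: "\<forall>s\<in>std_tab \<nu>. \<forall>v\<in>std_tab \<nu>.
      (\<lambda>w. gmul ?m (murphy \<nu> s t) (murphy \<nu> u v) w - c * murphy \<nu> s v w) \<in> murphy_gt \<nu>"
  then have "(\<lambda>w. gmul ?m (murphy \<nu> t t) (murphy \<nu> u t) w - c * murphy \<nu> t t w) \<in> murphy_gt \<nu>" using t by blast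
  from murphy_gt_signed_sum[OF p this tt[OF t] tt[OF t]]
  have "tabloid_sign ?D t t * (gram ?D t u - c) * (tabloid_sign ?D t t :: 'k) = 0" using prod[OF t t tt[OF t] tt[OF t]] by simp
  then show "c = gram ?D t u" using tabloid_sign_equiv[OF fin tt[OF t] row_equiv_refl, where 'a='k] by simp
qed

text \<open>Expand \<open>transport D u t\<close> in the Murphy basis and multiply on the right by
  \<open>transport D u u\<close>: terms of shape \<open>D\<close> contribute values of
  \<open>gram\<close> at standard tableaux, and terms of strictly dominating shape are
  killed.\<close>

lemma gram_vanishes:
  assumes D: "D \<in> diagrams m" and u: "u \<in> std D"
    and z: "\<And>t. t \<in> std D \<Longrightarrow> gram D t u = (0::'k::field)" and t: "t \<in> tab D"
  shows "gram D t u = (0::'k)"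
proof -
  have y: "young D" and c: "card D = m" using D by (auto simp: diagrams_def)
  have fin: "finite D" using y by (rule young_finite)
  note ut = std_imp_tab[OF u]
  have one: "tabloid_sign D u u = (1::'k)" using tabloid_sign_equiv[OF fin ut row_equiv_refl] .
  define Q where "Q = (\<lambda>E. \<not> dominated D E)"
  let ?h = "transport D u t :: _ \<Rightarrow> 'k"
  have supp: "?h w = 0" if "\<not> w permutes {1..m}" for w using that by (simp add: transport_def c)
  have Q: "Q F" if "E \<in> diagrams m" "F \<in> diagrams m" "Q E" "dominated F E" for E F
    using that dominated_trans[of D F E] unfolding Q_def by blast
  have zero: "signed_sum E s' t' ?h = 0" if E: "E \<in> diagrams m" "Q E" "s' \<in> std E" "t' \<in> std E" for E s' t'
    using signed_sum_transport_dominated[OF E(1) D std_imp_tab[OF E(3)] std_imp_tab[OF E(4)] ut, of t, where 'k='k] E(2) unfolding Q_def by blast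
  obtain C where C: "?h = (\<lambda>w. \<Sum>i\<in>{i \<in> transport_index m. \<not> Q (fst i)}. C i * transport_of i w)"
    by (rule transport_expansion[where h = ?h and m = m and Q = Q]) (erule supp, erule (3) Q, erule (3) zero, blast)
  have "signed_sum D u u (gmul m (transport_of i) (transport D u u)) = (0::'k)" if i: "i \<in> transport_index m" "\<not> Q (fst i)" for i
  proof (cases "fst i = D")
    case True
    then have st: "fst (snd i) \<in> std D" "snd (snd i) \<in> std D" using i by (auto simp: transport_index_def)
    show ?thesis unfolding transport_of_def True
      using signed_sum_transport_transport[OF y ut ut std_imp_tab[OF st(1)] std_imp_tab[OF st(2)] ut ut, where 'k='k] z[OF st(2)] c by simp
  next
    case False
    have E: "fst i \<in> diagrams m" "fst (snd i) \<in> std (fst i)" using i by (auto simp: transport_index_def)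
    have "\<not> dominated (fst i) D" using i(2) False dominated_antisym[OF D E(1)] by (auto simp: Q_def)
    then have "signed_sum D u t' (transport_of i) = (0::'k)" if "t' \<in> tab D" for t'
      using signed_sum_transport_dominated[OF D E(1) ut that std_imp_tab[OF E(2)], of "snd (snd i)", where 'k='k] unfolding transport_of_def by blast
    then show ?thesis unfolding signed_sum_gmul_right[OF c ut ut]
      using tab_perm[OF ut permutes_inv] c by (intro sum.neutral) auto
  qed
  then have "signed_sum D u u (gmul m ?h (transport D u u)) = (0::'k)"
    unfolding C gmul_sum_left signed_sum_sum by simp
  then show ?thesis using signed_sum_transport_transport[OF y ut ut ut t ut ut, where 'k='k] one c by simp
qed

section \<open>Vanishing of the form\<close>

text \<open>T acts as a cyclic group of order p with free orbits, and each orbit contributes p equal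
  summands, that is 0.\<close>

lemma sum_free_orbits:
  fixes F :: "'b \<Rightarrow> 'k::field"
  assumes fin: "finite S" and p: "p > 0" "of_nat p = (0::'k)"
    and inv: "\<And>x. x \<in> S \<Longrightarrow> T x \<in> S" "\<And>x. x \<in> S \<Longrightarrow> F (T x) = F x" "\<And>x. x \<in> S \<Longrightarrow> (T ^^ p) x = x"
    and inj: "\<And>x. x \<in> S \<Longrightarrow> inj_on (\<lambda>j. (T ^^ j) x) {..<p}"
  shows "sum F S = 0"
  using fin inv inj
proof (induction S rule: finite_psubset_induct)
  case (psubset S)
  show ?case
  proof (cases "S = {}")
    case False
    then obtain x where x: "x \<in> S" by blast
    define Orb where "Orb = (\<lambda>j. (T ^^ j) x) ` {..<p}"
    have it: "(T ^^ j) x \<in> S \<and> F ((T ^^ j) x) = F x" for j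
      by (induction j) (use x psubset.prems(1,2) in auto)
    have all: "(T ^^ j) x \<in> Orb" for j
      using funpow_mod_eq[where f = T and n = p and x = x and m = j] psubset.prems(3)[OF x] p(1) unfolding Orb_def
      by (metis imageI lessThan_iff mod_less_divisor)
    have Orb_sub: "Orb \<subseteq> S" using it by (auto simp: Orb_def)
    have "sum F Orb = (\<Sum>z\<in>Orb. F x)" by (rule sum.cong) (auto simp: Orb_def it)
    also have "\<dots> = of_nat (card Orb) * F x" by simp
    also have "card Orb = p" using psubset.prems(4)[OF x] by (simp add: Orb_def card_image)
    finally have 0: "sum F Orb = 0" using p by simp
    have "x \<in> Orb" using all[of 0] by simp
    then have ps: "S - Orb \<subset> S" using x by blast
    have stable: "T z \<in> S - Orb" if z: "z \<in> S - Orb" for z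
    proof -
      have "T z \<notin> Orb"
      proof
        assume "T z \<in> Orb"
        then obtain j where j: "T z = (T ^^ j) x" by (auto simp: Orb_def)
        \<comment> \<open>Going round once, z is a power of T applied to T z, so a point mapped into
          the orbit already lies in it.\<close>
        have "z = (T ^^ p) z" using psubset.prems(3) z by simp
        also have "\<dots> = (T ^^ (p - 1)) (T z)" using p(1) by (metis Suc_diff_1 funpow_swap1 funpow.simps(2) comp_apply)
        also have "\<dots> = (T ^^ (p - 1 + j)) x" unfolding j by (simp add: funpow_add)
        finally show False using all[of "p - 1 + j"] z by simp
      qed
      then show ?thesis using psubset.prems(1) z by blast
    qed
    have "sum F (S - Orb) = 0"
      by (rule psubset.IH[OF ps]) (use psubset.prems stable in auto)
    then show ?thesis using sum.subset_diff[OF Orb_sub psubset.hyps, of F] 0 by simp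
  qed simp
qed

section \<open>Rotating columns of equal length\<close>

lemma col_group_conj:
  assumes w: "w permutes D" and n: "\<And>x y. x \<in> D \<Longrightarrow> y \<in> D \<Longrightarrow> snd (w x) = snd (w y) \<longleftrightarrow> snd x = snd y"
    and c: "c \<in> col_group D"
  shows "w \<circ> c \<circ> inv w \<in> col_group D" "inv w \<circ> c \<circ> w \<in> col_group D"
proof -
  have cp: "c permutes D" using c by (rule col_groupD)
  have iw: "inv w permutes D" using w by (rule permutes_inv)
  have inD: "w x \<in> D \<longleftrightarrow> x \<in> D" "c x \<in> D \<longleftrightarrow> x \<in> D" "inv w x \<in> D \<longleftrightarrow> x \<in> D" for x
    using permutes_in_image[OF w] permutes_in_image[OF cp] permutes_in_image[OF iw] by auto
  have ww: "w (inv w x) = x" for x using permutes_inverses(1)[OF w] .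
  have "snd ((w \<circ> c \<circ> inv w) x) = snd x" if "x \<in> D" for x
    using n[of "c (inv w x)" "inv w x"] that col_groupD(2)[OF c] by (simp add: inD ww)
  moreover have "w \<circ> c \<circ> inv w permutes D" by (intro permutes_compose w iw cp)
  ultimately show "w \<circ> c \<circ> inv w \<in> col_group D" by (simp add: col_group_def)
  have "snd ((inv w \<circ> c \<circ> w) x) = snd x" if "x \<in> D" for x
    using n[of "inv w (c (w x))" x] that col_groupD(2)[OF c] by (simp add: inD ww)
  moreover have "inv w \<circ> c \<circ> w permutes D" by (intro permutes_compose w iw cp)
  ultimately show "inv w \<circ> c \<circ> w \<in> col_group D" by (simp add: col_group_def)
qed

text \<open>A permutation that moves whole columns normalises the column group, and conjugation
  preserves signs; being also a row permutation, it does not affect row equivalence.\<close>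

lemma tabloid_sign_comp_column_permutation:
  assumes fin: "finite D" and w: "w \<in> row_group D"
    and n: "\<And>x y. x \<in> D \<Longrightarrow> y \<in> D \<Longrightarrow> snd (w x) = snd (w y) \<longleftrightarrow> snd x = snd y"
  shows "tabloid_sign D (t \<circ> w) u = tabloid_sign D t u"
  unfolding tabloid_sign_def
proof (rule sum.reindex_bij_witness[where i = "\<lambda>c. inv w \<circ> c \<circ> w" and j = "\<lambda>c. w \<circ> c \<circ> inv w"])
  have wp: "w permutes D" using w by (rule row_groupD)
  have ip: "inv w permutes D" using wp by (rule permutes_inv)
  show "inv w \<circ> (w \<circ> c \<circ> inv w) \<circ> w = c" "w \<circ> (inv w \<circ> c \<circ> w) \<circ> inv w = c" for c :: "nat \<times> nat \<Rightarrow> nat \<times> nat"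
    using permutes_inverses[OF wp] by (simp_all add: fun_eq_iff)
  fix c assume c: "c \<in> col_group D"
  show "w \<circ> c \<circ> inv w \<in> col_group D" "inv w \<circ> c \<circ> w \<in> col_group D"
    using col_group_conj[OF wp n c] by auto
  have cp: "c permutes D" using c by (rule col_groupD)
  have "permutation w" using fin wp by (auto simp: permutation_permutes)
  then have "sign (inv w) = sign w" by (rule sign_inverse)
  then have s: "sign (w \<circ> c \<circ> inv w) = sign c"
    using sign_comp_permutes[OF fin permutes_compose[OF cp wp] ip] sign_comp_permutes[OF fin wp cp] sign_idempotent[of w]
    by (simp add: mult.commute mult.left_commute)
  have "t \<circ> (w \<circ> c \<circ> inv w) \<circ> w = t \<circ> w \<circ> c" using permutes_inverses[OF wp] by (simp add: fun_eq_iff)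
  then have "row_equiv D (t \<circ> (w \<circ> c \<circ> inv w)) u \<longleftrightarrow> row_equiv D (t \<circ> w \<circ> c) u"
    using row_equiv_row_group[OF w, of "t \<circ> (w \<circ> c \<circ> inv w)" u] by simp
  then show "of_int (sign (w \<circ> c \<circ> inv w)) * (if row_equiv D (t \<circ> (w \<circ> c \<circ> inv w)) u then 1 else 0) =
    of_int (sign c) * (if row_equiv D (t \<circ> w \<circ> c) u then 1 else 0)" by (simp add: s)
qed

text \<open>A cyclic shift by j of the p columns from b0 on, restricted to rows 0 to a. It is meant
  for columns of length a + 1, so that whole columns move.\<close>

definition column_rotation :: "nat \<Rightarrow> nat \<Rightarrow> nat \<Rightarrow> nat \<Rightarrow> nat \<times> nat \<Rightarrow> nat \<times> nat" where
  "column_rotation a b0 p j = (\<lambda>(i,b). if i \<le> a \<and> b0 \<le> b \<and> b < b0 + p then (i, b0 + (b - b0 + j) mod p) else (i,b))"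

lemma column_rotation_comp:
  assumes "p > 0" shows "column_rotation a b0 p j \<circ> column_rotation a b0 p k = column_rotation a b0 p (j + k)"
proof
  fix x :: "nat \<times> nat"
  obtain i b where x: "x = (i,b)" by (cases x)
  show "(column_rotation a b0 p j \<circ> column_rotation a b0 p k) x = column_rotation a b0 p (j + k) x"
  proof (cases "i \<le> a \<and> b0 \<le> b \<and> b < b0 + p")
    case True
    then obtain d where "b = b0 + d" using le_Suc_ex by blast
    then show ?thesis using True assms by (simp add: column_rotation_def x mod_add_left_eq add.assoc add.commute[of j])
  qed (auto simp: column_rotation_def x)
qed

lemma column_rotation_0: "column_rotation a b0 p 0 = id"
  by (auto simp: column_rotation_def fun_eq_iff)

lemma column_rotation_period: "column_rotation a b0 p p = id"
proof
  fix x :: "nat \<times> nat"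
  obtain i b where x: "x = (i,b)" by (cases x)
  show "column_rotation a b0 p p x = id x"
  proof (cases "i \<le> a \<and> b0 \<le> b \<and> b < b0 + p")
    case True
    then obtain d where "b = b0 + d" using le_Suc_ex by blast
    then show ?thesis using True by (simp add: column_rotation_def x)
  qed (auto simp: column_rotation_def x)
qed

text \<open>The p columns starting at \<open>row_len D (Suc a)\<close> reach row a but not row a +
  1. Rotating them preserves every summand of \<open>gram\<close>, and its orbits on row
  permutations have p elements.\<close>

lemma gram_unrestricted:
  assumes D: "young D" and p: "p > 0" "of_nat p = (0::'k::field)" and len: "row_len D (Suc a) + p \<le> row_len D a"
  shows "gram D t u = (0::'k)"
proof -
  have fin: "finite D" using D by (rule young_finite)
  define b0 where "b0 = row_len D (Suc a)"
  define R where "R = column_rotation a b0 p"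
  define w where "w = R 1"
  have comp: "R j \<circ> R k = R (j + k)" for j k unfolding R_def using p(1) by (rule column_rotation_comp)
  have mem: "(i,b) \<in> D \<longleftrightarrow> i \<le> a" if "b0 \<le> b" "b < b0 + p" for i b
  proof
    assume "(i,b) \<in> D"
    then have "b < row_len D i" using row_len_iff[OF D] by simp
    then show "i \<le> a" using row_len_antimono[OF D, of "Suc a" i] that unfolding b0_def by (metis not_less_eq_eq leD order_trans)
  next
    assume "i \<le> a"
    then show "(i,b) \<in> D" using row_len_antimono[OF D, of i a] that len row_len_iff[OF D, of i b] unfolding b0_def by linarith
  qed
  have maps: "R j x \<in> D" if "x \<in> D" for j x
    using that mem p(1) by (cases x) (auto simp: R_def column_rotation_def)
  have fix_out: "R j x = x" if "x \<notin> D" for j x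
    using that mem by (cases x) (auto simp: R_def column_rotation_def)
  have Rp: "R p = id" "R 0 = id" unfolding R_def by (rule column_rotation_period column_rotation_0)+
  have bij: "bij_betw w D D"
  proof (rule bij_betw_byWitness[where f' = "R (p - 1)"])
    show "\<forall>x\<in>D. R (p - 1) (w x) = x" "\<forall>x\<in>D. w (R (p - 1) x) = x"
      using comp[of "p - 1" 1] comp[of 1 "p - 1"] p(1) Rp by (auto simp: w_def fun_eq_iff)
  qed (use maps in \<open>auto simp: w_def\<close>)
  have wp: "w permutes D" using bij by (rule bij_imp_permutes) (simp add: w_def fix_out)
  have wr: "w \<in> row_group D" using wp by (auto simp: row_group_def w_def R_def column_rotation_def)
  \<comment> \<open>The effect of w on column numbers; its injectivity means that w keeps distinct
    columns distinct.\<close>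
  define \<theta> where "\<theta> = (\<lambda>b. if b0 \<le> b \<and> b < b0 + p then b0 + (b - b0 + 1) mod p else b)"
  have sw: "snd (w x) = \<theta> (snd x)" if "x \<in> D" for x
    using that mem by (cases x) (auto simp: w_def R_def column_rotation_def \<theta>_def)
  have \<theta>_range: "b0 \<le> \<theta> b \<and> \<theta> b < b0 + p \<longleftrightarrow> b0 \<le> b \<and> b < b0 + p" for b using p(1) by (auto simp: \<theta>_def)
  have \<theta>_inj: "b = b'" if "\<theta> b = \<theta> b'" for b b'
  proof (cases "b0 \<le> b \<and> b < b0 + p")
    case True
    then have T': "b0 \<le> b' \<and> b' < b0 + p" using that \<theta>_range by metis
    then have "(b - b0 + 1) mod p = (b' - b0 + 1) mod p" using that True by (simp add: \<theta>_def)
    moreover have "(b - b0) mod p = b - b0" "(b' - b0) mod p = b' - b0" using True T' by auto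
    ultimately have "b - b0 = b' - b0" by (auto simp: mod_Suc split: if_splits)
    then show ?thesis using True T' by auto
  next
    case False
    then have "\<not> (b0 \<le> b' \<and> b' < b0 + p)" using that \<theta>_range by metis
    then have "\<theta> b' = b'" unfolding \<theta>_def by (rule if_not_P)
    moreover have "\<theta> b = b" using False unfolding \<theta>_def by (rule if_not_P)
    ultimately show ?thesis using that by simp
  qed
  have n: "snd (w x) = snd (w y) \<longleftrightarrow> snd x = snd y" if "x \<in> D" "y \<in> D" for x y
    using sw[OF that(1)] sw[OF that(2)] \<theta>_inj by auto
  have pow: "((\<lambda>\<rho>. \<rho> \<circ> w) ^^ j) \<rho> = \<rho> \<circ> R j" for j and \<rho> :: "nat \<times> nat \<Rightarrow> nat \<times> nat"
  proof (induction j)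
    case (Suc j)
    have "((\<lambda>\<rho>. \<rho> \<circ> w) ^^ Suc j) \<rho> = ((\<lambda>\<rho>. \<rho> \<circ> w) ^^ j) \<rho> \<circ> w" by simp
    also have "\<dots> = \<rho> \<circ> (R j \<circ> R 1)" unfolding Suc.IH by (simp only: w_def comp_assoc)
    finally show ?case by (simp only: comp Suc_eq_plus1)
  qed (simp add: Rp)
  show ?thesis unfolding gram_def
  proof (rule sum_free_orbits[where T = "\<lambda>\<rho>. \<rho> \<circ> w", OF finite_row_group[OF fin] p])
    fix \<rho> assume r: "\<rho> \<in> row_group D"
    have rp: "\<rho> permutes D" using r by (rule row_groupD)
    show "\<rho> \<circ> w \<in> row_group D" using row_group_comp[OF r wr] .
    show "tabloid_sign D (t \<circ> (\<rho> \<circ> w)) u = (tabloid_sign D (t \<circ> \<rho>) u :: 'k)"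
      using tabloid_sign_comp_column_permutation[OF fin wr n, of "t \<circ> \<rho>" u] by (simp add: o_assoc)
    show "((\<lambda>\<rho>. \<rho> \<circ> w) ^^ p) \<rho> = \<rho>" by (simp add: pow Rp)
    show "inj_on (\<lambda>j. ((\<lambda>\<rho>. \<rho> \<circ> w) ^^ j) \<rho>) {..<p}"
    proof (rule inj_onI, unfold pow)
      fix i j assume ij: "i \<in> {..<p}" "j \<in> {..<p}" "\<rho> \<circ> R i = \<rho> \<circ> R j"
      \<comment> \<open>One node tells the powers of w apart: the images of (0,b0) lie in different
        columns.\<close>
      have "\<rho> (R i (0,b0)) = \<rho> (R j (0,b0))" using fun_cong[OF ij(3), of "(0,b0)"] by simp
      then have "R i (0,b0) = R j (0,b0)" using permutes_inj[OF rp] by (simp add: inj_eq)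
      then show "i = j" using ij p(1) by (simp add: R_def column_rotation_def)
    qed
  qed
qed

section \<open>Permutations preserving a function, and the tableau with reversed columns\<close>

definition fibre_perms :: "('b \<Rightarrow> 'c) \<Rightarrow> 'b set \<Rightarrow> ('b \<Rightarrow> 'b) set" where
  "fibre_perms h S = {\<rho>. \<rho> permutes S \<and> (\<forall>n\<in>S. h (\<rho> n) = h n)}"

text \<open>A permutation is recovered from the image y of x and its product with the transposition
  of x and y, which fixes x. The transposition respects h because x and y lie in one fibre.\<close>

lemma card_fibre_perms_insert:
  assumes x: "x \<notin> S"
  shows "card (fibre_perms h (insert x S)) = card {y \<in> insert x S. h y = h x} * card (fibre_perms h S)"
proof -
  let ?Y = "{y \<in> insert x S. h y = h x}"
  have "bij_betw (\<lambda>(y,q). transpose x y \<circ> q) (?Y \<times> fibre_perms h S) (fibre_perms h (insert x S))"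
  proof (rule bij_betw_byWitness[where f' = "\<lambda>\<rho>. (\<rho> x, transpose x (\<rho> x) \<circ> \<rho>)"])
    have qx: "q x = x" if "q \<in> fibre_perms h S" for q
      using that x permutes_not_in by (fastforce simp: fibre_perms_def)
    show "\<forall>yq\<in>?Y \<times> fibre_perms h S.
        (\<lambda>\<rho>. (\<rho> x, transpose x (\<rho> x) \<circ> \<rho>)) ((\<lambda>(y,q). transpose x y \<circ> q) yq) = yq"
    proof (rule ballI)
      fix yq assume "yq \<in> ?Y \<times> fibre_perms h S"
      then obtain y q where yq: "yq = (y,q)" and q: "q \<in> fibre_perms h S" by blast
      have "q x = x" using q by (rule qx)
      then show "(\<lambda>\<rho>. (\<rho> x, transpose x (\<rho> x) \<circ> \<rho>)) ((\<lambda>(y,q). transpose x y \<circ> q) yq) = yq"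
        by (simp add: fun_eq_iff yq)
    qed
    show "\<forall>\<rho>\<in>fibre_perms h (insert x S). (\<lambda>(y,q). transpose x y \<circ> q) (\<rho> x, transpose x (\<rho> x) \<circ> \<rho>) = \<rho>"
      by (simp add: fun_eq_iff)
    have tr: "h (transpose x y z) = h z" if "h y = h x" for y z
      using that by (auto simp: transpose_def)
    show "(\<lambda>(y,q). transpose x y \<circ> q) ` (?Y \<times> fibre_perms h S) \<subseteq> fibre_perms h (insert x S)"
    proof (rule image_subsetI)
      fix yq assume "yq \<in> ?Y \<times> fibre_perms h S"
      then obtain y q where yq: "yq = (y,q)" and y: "y \<in> insert x S" "h y = h x" and q: "q \<in> fibre_perms h S" by blast
      have "q permutes insert x S" using q permutes_subset[of q S "insert x S"] by (auto simp: fibre_perms_def)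
      then have "transpose x y \<circ> q permutes insert x S"
        using y by (intro permutes_compose permutes_swap_id) auto
      moreover have "h (q n) = h n" if "n \<in> insert x S" for n using q qx[OF q] that by (auto simp: fibre_perms_def)
      ultimately have "transpose x y \<circ> q \<in> fibre_perms h (insert x S)" using tr[OF y(2)] by (simp add: fibre_perms_def)
      then show "(\<lambda>(y,q). transpose x y \<circ> q) yq \<in> fibre_perms h (insert x S)" by (simp add: yq)
    qed
    show "(\<lambda>\<rho>. (\<rho> x, transpose x (\<rho> x) \<circ> \<rho>)) ` fibre_perms h (insert x S) \<subseteq> ?Y \<times> fibre_perms h S"
    proof (rule image_subsetI)
      fix \<rho> assume r: "\<rho> \<in> fibre_perms h (insert x S)"
      then have p: "\<rho> permutes insert x S" and hx: "\<And>n. n \<in> insert x S \<Longrightarrow> h (\<rho> n) = h n" by (auto simp: fibre_perms_def)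
      have "\<rho> x \<in> insert x S" using permutes_in_image[OF p] by simp
      moreover have "transpose x (\<rho> x) \<circ> \<rho> \<in> fibre_perms h S"
        using permutes_insert_lemma[OF p] tr[OF hx] hx by (simp add: fibre_perms_def)
      ultimately show "(\<rho> x, transpose x (\<rho> x) \<circ> \<rho>) \<in> ?Y \<times> fibre_perms h S" using hx[of x] by simp
    qed
  qed
  from bij_betw_same_card[OF this] show ?thesis by (simp add: card_cartesian_product)
qed

text \<open>The cardinality is the product of the factorials of the fibre sizes, built up one point
  at a time; each new factor is positive and at most a fibre size.\<close>

lemma card_fibre_perms_nonzero:
  assumes "finite S" and "\<And>v j. 0 < j \<Longrightarrow> j \<le> card {n \<in> S. h n = v} \<Longrightarrow> of_nat j \<noteq> (0::'k::field)"
  shows "of_nat (card (fibre_perms h S)) \<noteq> (0::'k)"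
  using assms
proof (induction S)
  case empty
  then show ?case by (simp add: fibre_perms_def)
next
  case (insert x S)
  have "card {n \<in> S. h n = v} \<le> card {n \<in> insert x S. h n = v}" for v
    using insert.hyps(1) by (intro card_mono) auto
  then have "of_nat (card (fibre_perms h S)) \<noteq> (0::'k)" using insert.prems by (intro insert.IH) (meson order_trans)
  moreover have "0 < card {y \<in> insert x S. h y = h x}" using insert.hyps(1) by (subst card_gt_0_iff) auto
  then have "of_nat (card {y \<in> insert x S. h y = h x}) \<noteq> (0::'k)" using insert.prems by blast
  ultimately show ?case using insert.hyps(2) by (simp add: card_fibre_perms_insert)
qed

text \<open>The transpose of James's tableau \<open>t\<^sup>*\<close>.\<close>

definition reversal :: "(nat \<times> nat) set \<Rightarrow> nat \<times> nat \<Rightarrow> nat \<times> nat" where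
  "reversal D = (\<lambda>n. if n \<in> D then (col_len D (snd n) - 1 - fst n, snd n) else n)"

lemma col_len_fst: "young D \<Longrightarrow> n \<in> D \<Longrightarrow> fst n < col_len D (snd n)"
  using col_len_iff[of D "fst n" "snd n"] by simp

lemma col_len_mem: "young D \<Longrightarrow> a < col_len D b \<Longrightarrow> (a,b) \<in> D"
  using col_len_iff[of D a b] by simp

lemma reversal_in: "young D \<Longrightarrow> n \<in> D \<Longrightarrow> reversal D n \<in> D"
  using col_len_fst[of D n] by (auto simp: reversal_def intro!: col_len_mem)

lemma reversal_invol: "young D \<Longrightarrow> reversal D (reversal D n) = n"
  using col_len_fst[of D n] reversal_in[of D n] by (cases "n \<in> D") (auto simp: reversal_def prod_eq_iff)

lemma reversal_col_group: assumes y: "young D" shows "reversal D \<in> col_group D"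
proof -
  have "bij_betw (reversal D) D D"
    by (rule bij_betw_byWitness[where f' = "reversal D"]) (use reversal_invol[OF y] reversal_in[OF y] in auto)
  then have "reversal D permutes D" by (rule bij_imp_permutes) (simp add: reversal_def)
  then show ?thesis by (simp add: col_group_def reversal_def)
qed

lemma row_equiv_self:
  assumes fin: "finite D" and u: "u \<in> tab D" and q: "q permutes D"
  shows "row_equiv D (u \<circ> q) u \<longleftrightarrow> (\<forall>n\<in>D. fst (q n) = fst n)"
proof
  assume r: "row_equiv D (u \<circ> q) u"
  show "\<forall>n\<in>D. fst (q n) = fst n"
  proof
    fix n assume n: "n \<in> D"
    have "fst (inv_into D u (u (q n))) = fst n"
      using inv_into_in_row[OF u row_equivD[OF r n]] by simp
    then show "fst (q n) = fst n" using tab_inv_into_apply[OF u] n permutes_in_image[OF q] by simp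
  qed
next
  assume "\<forall>n\<in>D. fst (q n) = fst n"
  then have "q \<in> row_group D" using q by (simp add: row_group_def)
  then show "row_equiv D (u \<circ> q) u" using row_equiv_row_group[of q D u u] row_equiv_refl by simp
qed

text \<open>The condition says that the inverse of c puts n into row
  \<open>col_len D (snd (\<rho> n)) - 1 - fst n\<close>. Going down the rows, a node that \<rho>
  sends to a longer column would collide with a node above it; as \<rho> permutes each row, no
  column length can drop either.\<close>

lemma reversal_row_preserving:
  assumes y: "young D" and \<rho>: "\<rho> \<in> row_group D" and c: "c \<in> col_group D"
  shows "(\<forall>n\<in>D. fst (reversal D (\<rho> (c n))) = fst n) \<longleftrightarrow>
         c = reversal D \<and> (\<forall>n\<in>D. col_len D (snd (\<rho> n)) = col_len D (snd n))" (is "?L \<longleftrightarrow> ?R")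
proof
  have fin: "finite D" using y by (rule young_finite)
  have rp: "\<rho> permutes D" using \<rho> by (rule row_groupD)
  have cp: "c permutes D" using c by (rule col_groupD)
  have ic: "inv c \<in> col_group D" using c by (rule col_group_inv)
  have inD: "\<rho> x \<in> D \<longleftrightarrow> x \<in> D" "c x \<in> D \<longleftrightarrow> x \<in> D" "inv c x \<in> D \<longleftrightarrow> x \<in> D" for x
    using permutes_in_image[OF rp] permutes_in_image[OF cp] permutes_in_image[OF permutes_inv[OF cp]] by auto
  let ?len = "\<lambda>n. col_len D (snd n)"
  {
    assume ?R
    then have cr: "c = reversal D" and pres: "\<And>n. n \<in> D \<Longrightarrow> ?len (\<rho> n) = ?len n" by auto
    show ?L
    proof
      fix n assume n: "n \<in> D"
      have "?len (\<rho> (c n)) = ?len n" using pres[of "c n"] n inD(2) col_groupD(2)[OF c] by simp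
      moreover have "c n = (?len n - 1 - fst n, snd n)" using n by (simp add: cr reversal_def)
      then have "fst (\<rho> (c n)) = ?len n - 1 - fst n" using row_groupD(2)[OF \<rho>, of "c n"] by simp
      moreover have "\<rho> (c n) \<in> D" using n inD(1)[of "c n"] inD(2)[of n] by blast
      ultimately show "fst (reversal D (\<rho> (c n))) = fst n"
        using col_len_fst[OF y n] by (simp add: reversal_def)
    qed
  }
  assume L: ?L
  have key: "fst (inv c n) = ?len (\<rho> n) - 1 - fst n" if n: "n \<in> D" for n
  proof -
    have "fst (reversal D (\<rho> (c (inv c n)))) = fst (inv c n)" using L inD n by blast
    then show ?thesis using n inD row_groupD(2)[OF \<rho>] by (simp add: permutes_inverses(1)[OF cp] reversal_def)
  qed
  have pres: "\<forall>n\<in>row D a. ?len (\<rho> n) = ?len n" for a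
  proof (induction a rule: less_induct)
    case (less a)
    have le: "?len (\<rho> n) \<le> ?len n" if "n \<in> row D a" for n
    proof (rule ccontr)
      assume gt: "\<not> ?len (\<rho> n) \<le> ?len n"
      have n: "n \<in> D" "fst n = a" using that by (auto simp: row_def)
      define x where "x = fst (inv c n)"
      have xL: "x < ?len n" using col_len_fst[OF y, of "inv c n"] inD n col_groupD(2)[OF ic] by (simp add: x_def)
      have xe: "x = ?len (\<rho> n) - 1 - a" using key[OF n(1)] n(2) by (simp add: x_def)
      \<comment> \<open>The row of this column whose node already goes to row x under the inverse of
        c, by the induction hypothesis. It is above a because \<rho> n lies in a longer
        column.\<close>
      define a' where "a' = ?len n - 1 - x"
      have a': "a' < a" using gt xe xL unfolding a'_def by linarith
      define n' where "n' = (a', snd n)"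
      have n': "n' \<in> D" unfolding n'_def using a' n young_down[OF y, of "fst n" "snd n" a' "snd n"]
        unfolding prod.collapse by simp
      have "?len (\<rho> n') = ?len n'" using less.IH[OF a'] n' by (simp add: row_def n'_def)
      then have "fst (inv c n') = x" using key[OF n'] xL by (simp add: n'_def a'_def)
      then have "inv c n' = inv c n" using col_groupD(2)[OF ic] by (simp add: prod_eq_iff x_def n'_def)
      then have "n' = n" using permutes_inj[OF permutes_inv[OF cp]] by (simp add: inj_eq)
      then have "fst n' = a" using n(2) by simp
      then show False using a' by (simp add: n'_def)
    qed
    \<comment> \<open>Since \<rho> permutes row a, both sums of column lengths agree, which turns
      the termwise inequalities into equalities.\<close>
    have "inj_on \<rho> (row D a)" using permutes_inj[OF rp] by (rule inj_on_subset) simp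
    then have "(\<Sum>n\<in>row D a. ?len (\<rho> n)) = (\<Sum>n\<in>\<rho> ` row D a. ?len n)" by (simp add: sum.reindex)
    then have eq: "(\<Sum>n\<in>row D a. ?len (\<rho> n)) = (\<Sum>n\<in>row D a. ?len n)" by (simp add: row_comp[OF \<rho>])
    have "finite (row D a)" using fin by (simp add: row_def)
    then show ?case using sum_mono_inv[OF eq le] by blast
  qed
  have pres': "?len (\<rho> n) = ?len n" if "n \<in> D" for n using bspec[OF pres[of "fst n"], of n] that by (simp add: row_def)
  have "c n = reversal D n" for n
  proof (cases "n \<in> D")
    case True
    have r: "reversal D n \<in> D" using reversal_in[OF y True] .
    have "fst (inv c (reversal D n)) = fst n"
      using key[OF r] pres'[OF r] True col_len_fst[OF y True] by (simp add: reversal_def)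
    moreover have "snd (inv c (reversal D n)) = snd n" using col_groupD(2)[OF ic] True by (simp add: reversal_def)
    ultimately have "inv c (reversal D n) = n" by (simp add: prod_eq_iff)
    then show ?thesis using permutes_inverses(1)[OF cp] by metis
  next
    case False
    then show ?thesis using permutes_not_in[OF cp] by (simp add: reversal_def)
  qed
  then show ?R using pres' by auto
qed

text \<open>For each row permutation at most one column permutation, the reversal itself, gives a
  nonzero summand, so all surviving summands carry the same sign and cannot cancel.\<close>

lemma gram_reversal:
  assumes y: "young D" and u: "u \<in> tab D"
  shows "gram D (u \<circ> reversal D) u =
    of_int (sign (reversal D)) * (of_nat (card (fibre_perms (\<lambda>n. (fst n, col_len D (snd n))) D)) :: 'k::field)"
proof -
  have fin: "finite D" using y by (rule young_finite)
  let ?g = "reversal D" and ?P = "fibre_perms (\<lambda>n. (fst n, col_len D (snd n))) D"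
  have g: "?g \<in> col_group D" using y by (rule reversal_col_group)
  have PR: "?P = {\<rho> \<in> row_group D. \<forall>n\<in>D. col_len D (snd (\<rho> n)) = col_len D (snd n)}"
    by (auto simp: fibre_perms_def row_group_def)
  have "tabloid_sign D (u \<circ> ?g \<circ> \<rho>) u = (if \<rho> \<in> ?P then of_int (sign ?g) else (0::'k))" if \<rho>: "\<rho> \<in> row_group D" for \<rho>
  proof -
    have "row_equiv D (u \<circ> ?g \<circ> \<rho> \<circ> c) u \<longleftrightarrow> c = ?g \<and> \<rho> \<in> ?P" if c: "c \<in> col_group D" for c
    proof -
      have "?g \<circ> \<rho> \<circ> c permutes D" using col_groupD(1)[OF g] col_groupD(1)[OF c] row_groupD(1)[OF \<rho>] by (intro permutes_compose)
      from row_equiv_self[OF fin u this] reversal_row_preserving[OF y \<rho> c]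
      show ?thesis using \<rho> unfolding PR by (simp add: o_assoc)
    qed
    then have "tabloid_sign D (u \<circ> ?g \<circ> \<rho>) u = (\<Sum>c\<in>col_group D. if c = ?g then (if \<rho> \<in> ?P then of_int (sign ?g) else (0::'k)) else 0)"
      unfolding tabloid_sign_def by (intro sum.cong refl) auto
    then show ?thesis using g finite_col_group[OF fin] by simp
  qed
  then have "gram D (u \<circ> ?g) u = (\<Sum>\<rho>\<in>row_group D. if \<rho> \<in> ?P then of_int (sign ?g) else (0::'k))"
    unfolding gram_def by (rule sum.cong[OF refl])
  also have "\<dots> = (\<Sum>\<rho>\<in>?P. of_int (sign ?g))"
    using finite_row_group[OF fin] PR by (subst sum.inter_filter[symmetric]) (auto intro: sum.cong)
  finally show ?thesis by simp
qed

text \<open>The columns of length l > 0 have numbers from \<open>row_len D l\<close> up to but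
  excluding \<open>row_len D (l - 1)\<close>, and nodes of one row are told apart by their columns.
  For l = 0, where l - 1 is truncated, the set is empty.\<close>

lemma card_row_column_fibre:
  assumes y: "young D"
  shows "card {n \<in> D. (fst n, col_len D (snd n)) = (a, l)} \<le> row_len D (l - 1) - row_len D l"
proof (cases "l = 0")
  case True
  have "{n \<in> D. (fst n, col_len D (snd n)) = (a, l)} = {}"
  proof (intro equals0I)
    fix n assume "n \<in> {n \<in> D. (fst n, col_len D (snd n)) = (a, l)}"
    then show False using True col_len_fst[OF y, of n] by simp
  qed
  then show ?thesis by (metis card.empty le0)
next
  case False
  let ?X = "{n \<in> D. (fst n, col_len D (snd n)) = (a, l)}"
  have "inj_on snd ?X" by (auto simp: inj_on_def prod_eq_iff)
  then have "card ?X = card (snd ` ?X)" by (simp add: card_image)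
  also have "\<dots> \<le> card {row_len D l..<row_len D (l - 1)}"
  proof (rule card_mono)
    show "snd ` ?X \<subseteq> {row_len D l..<row_len D (l - 1)}"
    proof (rule image_subsetI)
      fix n assume "n \<in> ?X"
      then have l: "col_len D (snd n) = l" by simp
      have "(l - 1, snd n) \<in> D" "(l, snd n) \<notin> D" using l False col_len_iff[OF y] by auto
      then show "snd n \<in> {row_len D l..<row_len D (l - 1)}" using row_len_iff[OF y] by simp
    qed
  qed simp
  finally show ?thesis by simp
qed

lemma specht_form_nonzero_iff:
  assumes p: "is_partition \<nu>"
  shows "(\<exists>t\<in>std_tab \<nu>. \<exists>u\<in>std_tab \<nu>. specht_form \<nu> t u \<noteq> (0::'k::field)) \<longleftrightarrow> p_restricted CHAR('k) \<nu>"
proof -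
  let ?D = "nodes \<nu>" and ?p = "CHAR('k)"
  have \<nu>: "\<nu> \<in> partitions_of (sum_list \<nu>)" using p by (simp add: partitions_of_def)
  have y: "young ?D" using p by (rule young_nodes)
  have fin: "finite ?D" by (rule finite_nodes)
  have rl: "row_len ?D a = (if a < length \<nu> then \<nu>!a else 0)" for a
    using row_len_nodes[of a \<nu>] by (auto simp: row_len_def nodes_def)
  have restr: "p_restricted ?p \<nu> \<longleftrightarrow> ?p = 0 \<or> (\<forall>a. row_len ?D a - row_len ?D (Suc a) < ?p)"
  proof -
    \<comment> \<open>Beyond the last part all differences are 0, hence below a positive p.\<close>
    have "(\<forall>i<length \<nu>. \<nu>!i - (if Suc i < length \<nu> then \<nu>!Suc i else 0) < ?p) \<longleftrightarrow> (\<forall>a. row_len ?D a - row_len ?D (Suc a) < ?p)" if "?p \<noteq> 0"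
      unfolding rl using that by auto
    then show ?thesis unfolding p_restricted_def by blast
  qed
  show ?thesis
  proof
    assume "\<exists>t\<in>std_tab \<nu>. \<exists>u\<in>std_tab \<nu>. specht_form \<nu> t u \<noteq> (0::'k)"
    then obtain t u where tu: "gram ?D t u \<noteq> (0::'k)" using specht_form_eq_gram[OF p, where 'k='k] by metis
    show "p_restricted ?p \<nu>"
    proof (rule ccontr)
      assume "\<not> p_restricted ?p \<nu>"
      then obtain a where "?p > 0" "\<not> row_len ?D a - row_len ?D (Suc a) < ?p" unfolding restr by blast
      then have "?p > 0" "row_len ?D (Suc a) + ?p \<le> row_len ?D a" by linarith+
      then show False using gram_unrestricted[OF y, of ?p a t u, where 'k='k] tu by simp
    qed
  next
    assume r: "p_restricted ?p \<nu>"
    let ?u = "tinit \<nu>" and ?h = "\<lambda>n. (fst n, col_len ?D (snd n))"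
    have u: "?u \<in> std ?D" using p by (rule tinit_std)
    have "of_nat j \<noteq> (0::'k)" if j: "0 < j" "j \<le> card {n \<in> ?D. ?h n = v}" for v j
    proof -
      obtain a l where v: "v = (a,l)" by (cases v)
      \<comment> \<open>A fibre lies in one row and meets only columns of length l, so the
        restriction at row l - 1 keeps its size below a positive p.\<close>
      have jl: "j \<le> row_len ?D (l - 1) - row_len ?D l" using j(2) card_row_column_fibre[OF y, of a l] v by simp
      then have "l \<noteq> 0" using j by (cases l) auto
      then have "?p = 0 \<or> j < ?p" using r jl unfolding restr by (metis Suc_pred' le_less_trans neq0_conv)
      then show ?thesis using j(1) by (auto simp: of_nat_eq_0_iff_char_dvd dest: dvd_imp_le)
    qed
    then have "of_nat (card (fibre_perms ?h ?D)) \<noteq> (0::'k)" by (intro card_fibre_perms_nonzero[OF fin]) blast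
    moreover have "of_int (sign (reversal ?D)) \<noteq> (0::'k)" by (simp add: sign_def)
    ultimately have "gram ?D (?u \<circ> reversal ?D) ?u \<noteq> (0::'k)" using gram_reversal[OF y std_imp_tab[OF u], where 'k='k] by simp
    \<comment> \<open>This tableau need not be standard; \<open>gram_vanishes\<close> supplies a
      standard one with nonzero value.\<close>
    moreover have "?u \<circ> reversal ?D \<in> tab ?D" using tab_comp[OF std_imp_tab[OF u] col_groupD(1)[OF reversal_col_group[OF y]]] .
    ultimately obtain t where "t \<in> std ?D" "gram ?D t ?u \<noteq> (0::'k)" using gram_vanishes[OF nodes_diagram[OF \<nu>] u, where 'k='k] by blast
    then have "specht_form \<nu> t ?u \<noteq> (0::'k)"
      using specht_form_eq_gram[OF p, of t ?u, where 'k='k] u by (simp add: std_tab_nodes)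
    then show "\<exists>t\<in>std_tab \<nu>. \<exists>u\<in>std_tab \<nu>. specht_form \<nu> t u \<noteq> (0::'k)"
      using u \<open>t \<in> std ?D\<close> unfolding std_tab_nodes by blast
  qed
qed

section \<open>The wreath product\<close>

lemma form_nonzero_iff:
  assumes "finite B"
  shows "form_nonzero G B \<longleftrightarrow> (\<exists>a\<in>B. \<exists>b\<in>B. G a b \<noteq> (0::'k::field))"
proof
  assume "form_nonzero G B"
  then obtain u v where "(\<Sum>a\<in>B. \<Sum>b\<in>B. u a * G a b * v b) \<noteq> 0" unfolding form_nonzero_def by blast
  then obtain a where a: "a \<in> B" "(\<Sum>b\<in>B. u a * G a b * v b) \<noteq> 0" by (rule sum.not_neutral_contains_not_neutral)
  from a(2) obtain b where "b \<in> B" "u a * G a b * v b \<noteq> 0" by (rule sum.not_neutral_contains_not_neutral)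
  with a(1) show "\<exists>a\<in>B. \<exists>b\<in>B. G a b \<noteq> 0" by force
next
  assume "\<exists>a\<in>B. \<exists>b\<in>B. G a b \<noteq> 0"
  then obtain a b where ab: "a \<in> B" "b \<in> B" "G a b \<noteq> 0" by blast
  have "(\<Sum>x\<in>B. \<Sum>y\<in>B. (if x = a then 1 else 0) * G x y * (if y = b then 1 else 0)) =
    (\<Sum>x\<in>B. if x = a then \<Sum>y\<in>B. if y = b then G a b else 0 else 0)"
    by (intro sum.cong refl) (auto intro!: sum.cong)
  also have "\<dots> = G a b" using ab assms by simp
  finally have "(\<Sum>x\<in>B. \<Sum>y\<in>B. (if x = a then 1 else 0) * G x y * (if y = b then 1 else 0)) \<noteq> 0" using ab by simp
  then show "form_nonzero G B" unfolding form_nonzero_def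
    by (intro exI[of _ "\<lambda>x. if x = a then 1 else 0"] exI[of _ "\<lambda>y. if y = b then 1 else 0"])
qed

text \<open>Taking the least index passes over blocks of size 0, so every position lies in a
  nonempty block.\<close>

lemma blk_properties:
  assumes "j \<in> {1..sum_list \<mu>}"
  shows "blk \<mu> j < length \<mu>" "\<mu> ! blk \<mu> j \<noteq> 0"
proof -
  let ?P = "\<lambda>i. j \<le> sum_list (take (Suc i) \<mu>)"
  have ne: "\<mu> \<noteq> []" using assms by auto
  then have P: "?P (length \<mu> - 1)" using assms by simp
  have le: "blk \<mu> j \<le> length \<mu> - 1" unfolding blk_def using P by (rule Least_le)
  then show len: "blk \<mu> j < length \<mu>" using ne by (metis Suc_pred' le_imp_less_Suc length_greater_0_conv)
  have 1: "?P (blk \<mu> j)" unfolding blk_def using P by (rule LeastI)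
  have 2: "sum_list (take (blk \<mu> j) \<mu>) < j"
  proof (cases "blk \<mu> j")
    case 0 then show ?thesis using assms by simp
  next
    case (Suc i)
    then have "\<not> ?P i" unfolding blk_def using not_less_Least[of i ?P] by simp
    then show ?thesis by (simp add: Suc)
  qed
  show "\<mu> ! blk \<mu> j \<noteq> 0" using 1 2 sum_list_take_Suc[OF len] by linarith
qed

lemma blk_surj:
  assumes i: "i < length \<mu>" and pos: "\<mu>!i \<noteq> 0"
  obtains j where "j \<in> {1..sum_list \<mu>}" "blk \<mu> j = i"
proof
  \<comment> \<open>The last position of block i.\<close>
  let ?j = "sum_list (take (Suc i) \<mu>)"
  have s: "?j = sum_list (take i \<mu>) + \<mu>!i" using i by (rule sum_list_take_Suc)
  show "?j \<in> {1..sum_list \<mu>}" using s pos sum_list_take_mono[of "Suc i" "length \<mu>" \<mu>] i by simp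
  show "blk \<mu> ?j = i" unfolding blk_def
  proof (rule Least_equality)
    fix i' assume "?j \<le> sum_list (take (Suc i') \<mu>)"
    then show "i \<le> i'" using sum_list_take_mono[of "Suc i'" i \<mu>] s pos by (metis Suc_leI add_leE le_antisym leI le_add1 add_right_cancel add_0_right order_trans nat_add_left_cancel_le le_zero_eq)
  qed simp
qed

lemma id_min_coset_rep: "id \<in> min_coset_reps \<mu>"
proof -
  have "{(a,b). a \<in> {1..n} \<and> b \<in> {1..n} \<and> a < b \<and> id a > id b} = {}" for n :: nat by auto
  then have "perm_length n id = 0" for n unfolding perm_length_def by (simp only: card.empty)
  then show ?thesis by (simp add: min_coset_reps_def permutes_id)
qed

text \<open>The value \<open>undefined\<close> outside the index ranges makes the components
  extensional, so the basis embeds in a product of finite function sets.\<close>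

lemma finite_wr_basis:
  assumes "\<And>i. i < length \<nu>s \<Longrightarrow> finite (M i)"
  shows "finite (wr_basis M \<nu>s)"
proof -
  let ?\<mu> = "map sum_list \<nu>s"
  let ?X = "PiE {1..sum_list ?\<mu>} (\<lambda>j. M (blk ?\<mu> j))"
  let ?Y = "PiE {..<length \<nu>s} (\<lambda>i. std_tab (\<nu>s!i))"
  have "finite ?X" using blk_properties(1)[of _ ?\<mu>] assms by (intro finite_PiE) auto
  moreover have "finite ?Y" using finite_std[OF finite_nodes] by (intro finite_PiE) (auto simp: std_tab_nodes)
  moreover have "finite {\<gamma>. \<gamma> permutes {1..sum_list ?\<mu>}}" by (rule finite_permutations) simp
  moreover have "wr_basis M \<nu>s \<subseteq> ?X \<times> ?Y \<times> {\<gamma>. \<gamma> permutes {1..sum_list ?\<mu>}}"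
    unfolding wr_basis_def Let_def min_coset_reps_def by (auto simp: PiE_iff extensional_def)
  ultimately show ?thesis by (meson finite_SigmaI finite_subset)
qed

text \<open>The factors of the form involve separate coordinates, so nonzero values can be chosen
  independently. An empty component has no position and hence no factor from its cell form, which is
  why only nonempty components are tied to \<open>Lambda0\<close>.\<close>

theorem theorem5p2:
  fixes r n :: nat
    and M :: "nat \<Rightarrow> 'm set"
    and sc :: "nat \<times> 'm \<times> 'm \<Rightarrow> nat \<times> 'm \<times> 'm \<Rightarrow> nat \<times> 'm \<times> 'm \<Rightarrow> 'k::field"
    and \<nu>s :: "nat list list"
  assumes "cellular r M sc"
    and "\<nu>s \<in> multipartitions r n"
  shows "form_nonzero (wr_form r M sc \<nu>s) (wr_basis M \<nu>s) \<longleftrightarrow>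
           (\<forall>i<r. i \<notin> Lambda0 r M sc \<longrightarrow> \<nu>s!i = []) \<and>
           (\<forall>i<r. p_restricted CHAR('k) (\<nu>s!i))"
proof -
  let ?\<mu> = "map sum_list \<nu>s" and ?c = "cell_form r M sc"
  have len: "length \<nu>s = r" and part: "\<And>i. i < r \<Longrightarrow> is_partition (\<nu>s!i)"
    using assms(2) by (auto simp: multipartitions_def)
  have fin: "finite (M i)" if "i < r" for i using assms(1) that by (simp add: cellular_def)
  have L0: "i \<in> Lambda0 r M sc \<longleftrightarrow> (\<exists>a\<in>M i. \<exists>b\<in>M i. ?c i a b \<noteq> 0)" if "i < r" for i
    using form_nonzero_iff[OF fin[OF that], of "?c i"] that by (simp add: Lambda0_def)
  have size0: "sum_list (\<nu>s!i) = 0 \<longleftrightarrow> \<nu>s!i = []" if "i < r" for i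
    using part[OF that] by (auto simp: is_partition_def) (metis list.set_intros(1) neq_Nil_conv)
  have fB: "finite (wr_basis M \<nu>s)" using finite_wr_basis[of \<nu>s M] fin len by blast
  show ?thesis unfolding form_nonzero_iff[OF fB]
  proof
    assume "\<exists>a\<in>wr_basis M \<nu>s. \<exists>b\<in>wr_basis M \<nu>s. wr_form r M sc \<nu>s a b \<noteq> 0"
    then obtain x y \<gamma> x' y' \<gamma>' where B: "(x,y,\<gamma>) \<in> wr_basis M \<nu>s" "(x',y',\<gamma>') \<in> wr_basis M \<nu>s"
      and nz: "wr_form r M sc \<nu>s (x,y,\<gamma>) (x',y',\<gamma>') \<noteq> 0" by (metis surj_pair)
    have S: "specht_form (\<nu>s!i) (y i) (y' i) \<noteq> (0::'k)" if "i < r" for i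
      using nz that by (auto simp: wr_form_def Let_def len)
    have C: "?c (blk ?\<mu> j) (x j) (x' j) \<noteq> 0" if "j \<in> {1..sum_list ?\<mu>}" for j
      using nz that by (auto simp: wr_form_def Let_def len)
    have y: "y i \<in> std_tab (\<nu>s!i)" "y' i \<in> std_tab (\<nu>s!i)" if "i < r" for i
      using B that by (auto simp: wr_basis_def Let_def len)
    have x: "x j \<in> M (blk ?\<mu> j)" "x' j \<in> M (blk ?\<mu> j)" if "j \<in> {1..sum_list ?\<mu>}" for j
      using B that by (auto simp: wr_basis_def Let_def)
    show "(\<forall>i<r. i \<notin> Lambda0 r M sc \<longrightarrow> \<nu>s!i = []) \<and> (\<forall>i<r. p_restricted CHAR('k) (\<nu>s!i))"
    proof (intro conjI allI impI)
      fix i assume i: "i < r"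
      show "p_restricted CHAR('k) (\<nu>s!i)"
        using specht_form_nonzero_iff[OF part[OF i], where 'k='k] S[OF i] y[OF i] by blast
      assume nL: "i \<notin> Lambda0 r M sc"
      show "\<nu>s!i = []"
      proof (rule ccontr)
        assume "\<nu>s!i \<noteq> []"
        \<comment> \<open>A nonempty component owns a position, whose factor would be a nonzero
          value of the cell form at i.\<close>
        then have "?\<mu>!i \<noteq> 0" using size0[OF i] i len by simp
        then obtain j where j: "j \<in> {1..sum_list ?\<mu>}" "blk ?\<mu> j = i" using blk_surj[of i ?\<mu>] i len by auto
        then show False using C[OF j(1)] x[OF j(1)] nL L0[OF i] by auto
      qed
    qed
  next
    assume R: "(\<forall>i<r. i \<notin> Lambda0 r M sc \<longrightarrow> \<nu>s!i = []) \<and> (\<forall>i<r. p_restricted CHAR('k) (\<nu>s!i))"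
    have "\<exists>y y'. y \<in> std_tab (\<nu>s!i) \<and> y' \<in> std_tab (\<nu>s!i) \<and> specht_form (\<nu>s!i) y y' \<noteq> (0::'k)" if "i < r" for i
      using specht_form_nonzero_iff[OF part[OF that], where 'k='k] R that by blast
    then obtain y y' where y: "\<And>i. i < r \<Longrightarrow> y i \<in> std_tab (\<nu>s!i) \<and> y' i \<in> std_tab (\<nu>s!i) \<and> specht_form (\<nu>s!i) (y i) (y' i) \<noteq> (0::'k)"
      by metis
    have "\<exists>a b. a \<in> M (blk ?\<mu> j) \<and> b \<in> M (blk ?\<mu> j) \<and> ?c (blk ?\<mu> j) a b \<noteq> 0" if j: "j \<in> {1..sum_list ?\<mu>}" for j
    proof -
      have i: "blk ?\<mu> j < r" using blk_properties(1)[OF j] len by simp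
      have "\<nu>s ! blk ?\<mu> j \<noteq> []" using blk_properties(2)[OF j] i len by auto
      then show ?thesis using R i L0[OF i] by blast
    qed
    then obtain x x' where x: "\<And>j. j \<in> {1..sum_list ?\<mu>} \<Longrightarrow>
        x j \<in> M (blk ?\<mu> j) \<and> x' j \<in> M (blk ?\<mu> j) \<and> ?c (blk ?\<mu> j) (x j) (x' j) \<noteq> 0" by metis
    \<comment> \<open>Coordinates outside their ranges must be \<open>undefined\<close> to lie in
      \<open>wr_basis\<close>. Both vectors use the identity as coset representative, so the delta
      factor is 1.\<close>
    define X where "X = (\<lambda>x j. if j \<in> {1..sum_list ?\<mu>} then x j else undefined :: 'm)"
    define Y where "Y = (\<lambda>y i. if i < r then y i else undefined :: nat \<times> nat \<Rightarrow> nat)"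
    have B: "(X x, Y y, id) \<in> wr_basis M \<nu>s" "(X x', Y y', id) \<in> wr_basis M \<nu>s"
      using x y by (auto simp: wr_basis_def Let_def X_def Y_def len id_min_coset_rep)
    have "wr_form r M sc \<nu>s (X x, Y y, id) (X x', Y y', id) \<noteq> 0"
      using x y by (auto simp: wr_form_def Let_def X_def Y_def len)
    then show "\<exists>a\<in>wr_basis M \<nu>s. \<exists>b\<in>wr_basis M \<nu>s. wr_form r M sc \<nu>s a b \<noteq> 0" using B by blast
  qed
qed

end
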